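(* Let $d\ge2$, $\alpha\in[0,(d+1)/2)$ and $\beta=\frac12-\frac{\alpha}{d+1}$. There is a constant $N=N(d,\alpha)$ such that the following holds. Let $T\in(0,\infty)$ and $C=[0,T)\times B$. Let $a(t,x)=(a^{ij}(t,x))$ be a measurable function on $C$ with values in symmetric nonnegative definite $d\times d$ matrices and $r(t,x)$ a nonnegative measurable function on $C$ such that $r+\mathrm{tr}\,a>0$ in $C$. Let $u\in W^{1,2}_{d+1,\mathrm{loc}}(C)\cap C(\bar C)$ and $$L_0u=r\partial_tu+a^{ij}D_{ij}u.$$ Then for every $x_0\in B$ $$u(0,x_0)\le\sup_{\partial'C}u+N\psi^{\beta}(x_0)\Big(\int_C\psi^{\alpha}\,I_{L_0u<0}\,(r\det a)^{-1}|L_0u|^{d+1}\,dx\,dt\Big)^{1/(d+1)}.$$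
   Context: $B=\{x\in\mathbb{R}^d:|x|<1\}$, $\psi(x)=1-|x|^2$, $\partial'C=\partial C\setminus(\{0\}\times\bar B)$ is the parabolic boundary of $C$, $D_{ij}=\partial^2/\partial x^i\partial x^j$, $\partial_t=\partial/\partial t$, summation over repeated indices is understood. $C(\bar C)$ is the space of continuous functions on $\bar C$. $W^{1,2}_{p,\mathrm{loc}}(C)$ is the parabolic Sobolev space of functions $u$ such that $u,\partial_tu,Du,D^2u$ (generalized derivatives; $D$ in $x$) are in $L_p$ on $[\varepsilon,T-\varepsilon)\times\{|x|<1-\varepsilon\}$ for all small $\varepsilon>0$. $I_{L_0u<0}$ is the indicator function of the set where $L_0u<0$. In the integrand, regarded as the quotient $I_{L_0u<0}|L_0u|^{d+1}/(r\det a)$, one uses $0/0:=0$ (and a positive number divided by $0$ is $+\infty$; the right-hand side may be $+\infty$). *)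

theory Defs
  imports "HOL-Analysis.Analysis"
begin

definition cylinder :: "real \<Rightarrow> (real \<times> (real^'n)) set" where
  "cylinder T = {0..<T} \<times> ball 0 1"

definition parabolic_boundary :: "real \<Rightarrow> (real \<times> (real^'n)) set" where
  "parabolic_boundary T = frontier (cylinder T) - {0} \<times> cball 0 1"

definition psi :: "real^'n \<Rightarrow> real" where
  "psi x = 1 - (norm x)\<^sup>2"

subsection \<open>Generalized derivatives\<close>

fun partials :: "'a::euclidean_space list \<Rightarrow> ('a \<Rightarrow> real) \<Rightarrow> ('a \<Rightarrow> real)" where
  "partials [] f = f"
| "partials (e # es) f = partials es (\<lambda>z. frechet_derivative f (at z) e)"

text \<open>
  Infinitely differentiable functions with compact support in \<open>\<Omega>\<close>: if all iterated partial
  derivatives are Frechet differentiable everywhere, then all of them are continuous.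
\<close>

definition test_functions :: "'a::euclidean_space set \<Rightarrow> ('a \<Rightarrow> real) set" where
  "test_functions \<Omega> =
     {\<phi>. (\<forall>es. set es \<subseteq> Basis \<longrightarrow> partials es \<phi> differentiable_on UNIV) \<and>
         compact (closure {z. \<phi> z \<noteq> 0}) \<and> closure {z. \<phi> z \<noteq> 0} \<subseteq> \<Omega>}"

definition locally_integrable_on ::
    "('a::euclidean_space \<Rightarrow> real) \<Rightarrow> 'a set \<Rightarrow> bool" where
  "locally_integrable_on f \<Omega> \<longleftrightarrow>
     (\<forall>K. compact K \<and> K \<subseteq> \<Omega> \<longrightarrow> set_integrable lebesgue K f)"

text \<open>
  \<open>g\<close> is a version of the generalized derivative of \<open>f\<close> on the open set \<open>\<Omega>\<close> in the
  directions \<open>es\<close> (repetitions allowed).  It is a relation, because such a \<open>g\<close> is determined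
  only almost everywhere.
\<close>

definition has_weak_deriv ::
    "'a::euclidean_space set \<Rightarrow> 'a list \<Rightarrow> ('a \<Rightarrow> real) \<Rightarrow> ('a \<Rightarrow> real) \<Rightarrow> bool" where
  "has_weak_deriv \<Omega> es f g \<longleftrightarrow>
     locally_integrable_on f \<Omega> \<and> locally_integrable_on g \<Omega> \<and>
     (\<forall>\<phi>\<in>test_functions \<Omega>.
        (LINT z:\<Omega>|lebesgue. f z * partials es \<phi> z) =
        (-1) ^ length es * (LINT z:\<Omega>|lebesgue. g z * \<phi> z))"

definition dir_t :: "real \<times> (real^'n)" where
  "dir_t = (1, 0)"

definition dir_x :: "'n \<Rightarrow> real \<times> (real^'n)" where
  "dir_x i = (0, axis i 1)"

subsection \<open>The parabolic Sobolev space\<close>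

definition Lp_on :: "real \<Rightarrow> 'a::euclidean_space set \<Rightarrow> ('a \<Rightarrow> real) set" where
  "Lp_on p S = {f. f \<in> borel_measurable (lebesgue_on S) \<and>
                   integrable (lebesgue_on S) (\<lambda>z. \<bar>f z\<bar> powr p)}"

definition Lp_loc_cylinder :: "real \<Rightarrow> real \<Rightarrow> (real \<times> (real^'n) \<Rightarrow> real) set" where
  "Lp_loc_cylinder p T =
     {f. \<forall>\<^sub>F \<epsilon> in at_right 0. f \<in> Lp_on p ({\<epsilon>..<T - \<epsilon>} \<times> ball 0 (1 - \<epsilon>))}"

definition W12_loc :: "real \<Rightarrow> real \<Rightarrow> (real \<times> (real^'n) \<Rightarrow> real) set" where
  "W12_loc p T =
     {u. u \<in> Lp_loc_cylinder p T \<and>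
         (\<exists>ut\<in>Lp_loc_cylinder p T. has_weak_deriv (interior (cylinder T)) [dir_t] u ut) \<and>
         (\<forall>i. \<exists>ui\<in>Lp_loc_cylinder p T.
            has_weak_deriv (interior (cylinder T)) [dir_x i] u ui) \<and>
         (\<forall>i j. \<exists>uij\<in>Lp_loc_cylinder p T.
            has_weak_deriv (interior (cylinder T)) [dir_x i, dir_x j] u uij)}"

subsection \<open>The operator and the right-hand side\<close>

definition nonneg_definite :: "real^'n^'n \<Rightarrow> bool" where
  "nonneg_definite A \<longleftrightarrow> (\<forall>\<xi>. 0 \<le> \<xi> \<bullet> (A *v \<xi>))"

text \<open>
  Here \<open>ut\<close> and \<open>D2u i j\<close> stand for (versions of) the generalized derivatives of \<open>u\<close>.
\<close>

definition L0 ::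
    "(real \<times> (real^'n) \<Rightarrow> real) \<Rightarrow> (real \<times> (real^'n) \<Rightarrow> real^'n^'n) \<Rightarrow>
     (real \<times> (real^'n) \<Rightarrow> real) \<Rightarrow> ('n \<Rightarrow> 'n \<Rightarrow> real \<times> (real^'n) \<Rightarrow> real) \<Rightarrow>
     real \<times> (real^'n) \<Rightarrow> real" where
  "L0 r a ut D2u z = r z * ut z + (\<Sum>i\<in>UNIV. \<Sum>j\<in>UNIV. a z $ i $ j * D2u i j z)"

definition ennreal_powr :: "ennreal \<Rightarrow> real \<Rightarrow> ennreal" where
  "ennreal_powr x q = (if x = \<infinity> then \<infinity> else ennreal (enn2real x powr q))"

text \<open>
  In \<^typ>\<open>ennreal\<close>, \<open>0 / 0 = 0\<close> and \<open>c / 0 = \<infinity>\<close> for \<open>c > 0\<close>, which is the intended reading of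
  the quotient when \<open>r det a\<close> vanishes.  \<open>F\<close> plays the role of \<open>L0 u\<close>.
\<close>

definition weighted_integral ::
    "real \<Rightarrow> real \<Rightarrow> (real \<times> (real^'n) \<Rightarrow> real) \<Rightarrow> (real \<times> (real^'n) \<Rightarrow> real^'n^'n) \<Rightarrow>
     (real \<times> (real^'n) \<Rightarrow> real) \<Rightarrow> ennreal" where
  "weighted_integral \<alpha> T r a F =
     (\<integral>\<^sup>+ z. ennreal (psi (snd z) powr \<alpha>) *
            (ennreal (indicator {z. F z < 0} z * \<bar>F z\<bar> ^ (CARD('n) + 1)) /
             ennreal (r z * det (a z)))
        \<partial>lebesgue_on (cylinder T))"

end

theory Submission
  imports Defs
begin

text \<open>
  Let \<open>d = CARD('n)\<close>. The operator enters only through a pointwise inequality: if \<open>\<tau> \<le> 0\<close> and \<open>- D\<close> is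
  symmetric and nonnegative definite, then \<open>F = r * \<tau> + \<Sum> a\<^sub>i\<^sub>j D\<^sub>i\<^sub>j\<close> is not positive and \<open>\<bar>\<tau> * det D\<bar>\<close> is at
  most \<open>d!\<close> times \<open>\<bar>F\<bar>^(d+1) / (r * det a)\<close> (\<open>abs_det_le_quotient\<close>). Here \<open>r + trace a > 0\<close> settles the
  case \<open>0 / 0\<close>. So it suffices to bound \<open>u\<close> by an integral of \<open>\<bar>u\<^sub>t * det D\<^sup>2u\<bar>\<close> over points where \<open>u\<close> is
  touched from above by planes.

  Let \<open>s\<close> bound \<open>u\<close> on the lateral and upper boundary of a slightly smaller cylinder, let \<open>K\<close> be the maximum
  of \<open>(u - s) / \<psi>^\<beta>\<close> on it, attained at \<open>(t\<^sub>0, x\<^sub>0)\<close>, and put \<open>\<delta> = \<psi>(x\<^sub>0)\<close>, \<open>M = K * \<delta>^\<beta>\<close>. Only \<open>K > 0\<close>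
  needs a proof. Consider affine functions of \<open>x\<close> that are at least \<open>M/8\<close> on the ball and at most \<open>7M/8\<close> at
  \<open>x\<^sub>0\<close>. Go backwards in time from the top of the cylinder until \<open>u - s\<close> first reaches such a plane. This
  happens before \<open>t\<^sub>0\<close> is passed, because \<open>u - s = M\<close> at \<open>(t\<^sub>0, x\<^sub>0)\<close>. Where \<open>\<psi> \<le> c\<^sub>0 * \<delta>\<close>, however,
  \<open>u - s \<le> K * \<psi>^\<beta> \<le> M/16\<close>, so the contact point has \<open>\<psi> > c\<^sub>0 * \<delta>\<close>. There \<open>u\<^sub>t \<le> 0\<close>, \<open>D\<^sup>2u \<le> 0\<close>, and
  the plane is the tangent plane of \<open>u - s\<close> (\<open>contact_point\<close>). A plane is given by its value at \<open>x\<^sub>0\<close> and its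
  slope, and the map \<open>(t, x) \<mapsto> (u - s - (x - x\<^sub>0) \<bullet> Du, Du)\<close> to tangent planes has Jacobian determinant
  \<open>u\<^sub>t * det D\<^sup>2u\<close>. Hence the volume of the family of planes is at most the integral of \<open>\<bar>u\<^sub>t * det D\<^sup>2u\<bar>\<close> over
  the contact set (\<open>measure_legendre_image_le\<close>).

  The family has volume at least \<open>c * (M / \<surd>\<delta>)^(d+1)\<close> (\<open>planes_volume\<close>). By the choice of \<open>\<beta>\<close> this is
  \<open>c * K^(d+1) * \<delta>^(-\<alpha>)\<close>. On the contact set the weight \<open>\<psi>^\<alpha>\<close> is at least \<open>(c\<^sub>0 * \<delta>)^\<alpha>\<close>, so inserting it
  costs a constant times \<open>\<delta>^(-\<alpha>)\<close>. These powers of \<open>\<delta>\<close> cancel, and \<open>K^(d+1)\<close> is bounded by a constant times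
  the weighted integral (\<open>interior_weighted_estimate\<close>). Working at the point of maximal quotient is what
  keeps the contact points away from the lateral boundary, where the weight degenerates. The smaller
  cylinder is finally let grow to the given one, using uniform continuity of \<open>u\<close>.

  A function in \<open>W\<^sup>1\<^sup>,\<^sup>2\<close> with exponent \<open>d + 1\<close> need not be twice differentiable, so the contact argument is run
  for mollifications of \<open>u\<close>. The volume of the family of planes does not depend on the mollification
  parameter, and the integrals pass to the limit by a reverse Fatou argument
  (\<open>planes_le_sobolev_contact_integral\<close>): the derivatives converge almost everywhere along a subsequence,
  and by Jensen's inequality the integrands are dominated by mollifications of a single integrable
  function, which converge in \<open>L\<^sub>1\<close>.
\<close>

section \<open>Smooth functions and mollifiers\<close>

text \<open>
  The building block of smooth bumps. The extra parameter makes the family closed under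
  differentiation up to linear combinations, which is all that is used about higher derivatives.
\<close>

definition flat :: "nat \<Rightarrow> real \<Rightarrow> real" where
  "flat m x = (if x \<le> 0 then 0 else exp (- (1 / x)) / x ^ m)"

lemma flat_nonneg: "0 \<le> flat m x"
  by (simp add: flat_def)

lemma power_le_fact_exp:
  fixes x :: real
  assumes "0 \<le> x"
  shows "x ^ k \<le> fact k * exp x"
proof -
  have s: "summable (\<lambda>n. x ^ n /\<^sub>R fact n)" by (rule summable_exp_generic)
  have "(\<Sum>n\<in>{k}. x ^ n /\<^sub>R fact n) \<le> exp x"
    unfolding exp_def by (rule sum_le_suminf[OF s]) (use assms in auto)
  then show ?thesis by (simp add: field_simps)
qed

text \<open>
  The exponential beats every power, by comparison with a single term of its series. A quadratic bound is what
  differentiability at 0 needs.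
\<close>

lemma flat_le_square: "flat m x \<le> fact (m + 2) * x\<^sup>2"
proof (cases "x \<le> 0")
  case False
  then have x: "x > 0" by simp
  have "(1 / x) ^ (m + 2) \<le> fact (m + 2) * exp (1 / x)"
    by (rule power_le_fact_exp) (use x in auto)
  then have "exp (- (1 / x)) \<le> fact (m + 2) * x ^ (m + 2)"
    using x by (simp add: exp_minus field_simps)
  then have "exp (- (1 / x)) / x ^ m \<le> fact (m + 2) * x ^ (m + 2) / x ^ m"
    using x by (intro divide_right_mono) auto
  also have "\<dots> = fact (m + 2) * x\<^sup>2" using x by (simp add: power_add power2_eq_square)
  finally show ?thesis using x by (simp add: flat_def)
qed (simp add: flat_def)

lemma flat_has_real_derivative:
  "(flat m has_real_derivative flat (m + 2) x - real m * flat (m + 1) x) (at x)"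
proof -
  consider "x < 0" | "x = 0" | "x > 0" by linarith
  then show ?thesis
  proof cases
    case 1
    have "((\<lambda>x. 0) has_real_derivative 0) (at x)" by simp
    then have "(flat m has_real_derivative 0) (at x)"
      by (rule DERIV_cong_ev[THEN iffD1, rotated 3])
        (use 1 in \<open>auto simp: flat_def eventually_nhds intro!: exI[of _ "{..<0}"]\<close>)
    then show ?thesis using 1 by (simp add: flat_def)
  next
    case 3
    have "((\<lambda>x. exp (- (1 / x)) / x ^ m) has_real_derivative
        exp (- (1 / x)) / x ^ (m + 2) - real m * (exp (- (1 / x)) / x ^ (m + 1))) (at x)"
      using 3 apply (auto intro!: derivative_eq_intros simp: field_simps power2_eq_square)
      apply (cases m; simp add: field_simps)
      done
    then have "(flat m has_real_derivative
        exp (- (1 / x)) / x ^ (m + 2) - real m * (exp (- (1 / x)) / x ^ (m + 1))) (at x)"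
      by (rule DERIV_cong_ev[THEN iffD1, rotated 3])
        (use 3 in \<open>auto simp: flat_def eventually_nhds intro!: exI[of _ "{0<..}"]\<close>)
    then show ?thesis using 3 by (simp add: flat_def)
  next
    case 2
    have "flat m 0 = 0" by (simp add: flat_def)
    have "((\<lambda>h. flat m h / h) \<longlongrightarrow> 0) (at 0)"
    proof (rule Lim_null_comparison)
      have "\<bar>flat m h / h\<bar> \<le> fact (m + 2) * \<bar>h\<bar>" for h
      proof (cases "h = 0")
        case False
        have "\<bar>flat m h\<bar> \<le> fact (m + 2) * \<bar>h\<bar>\<^sup>2"
          using flat_le_square[of m h] flat_nonneg[of m h] by simp
        then have "\<bar>flat m h\<bar> / \<bar>h\<bar> \<le> fact (m + 2) * \<bar>h\<bar>\<^sup>2 / \<bar>h\<bar>"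
          by (intro divide_right_mono) auto
        also have "\<dots> = fact (m + 2) * \<bar>h\<bar>"
          using False by (simp only: power2_eq_square times_divide_eq_right[symmetric] divide_self mult_1_right abs_eq_0_iff not_False_eq_True)
        finally show ?thesis by (simp only: abs_divide)
      qed simp
      then show "\<forall>\<^sub>F h in at 0. norm (flat m h / h) \<le> fact (m + 2) * \<bar>h\<bar>" by simp
      show "((\<lambda>h. fact (m + 2) * \<bar>h\<bar>) \<longlongrightarrow> (0::real)) (at 0)"
        by (rule tendsto_eq_intros refl | simp)+
    qed
    then have "(flat m has_real_derivative 0) (at 0)"
      using \<open>flat m 0 = 0\<close> by (simp add: DERIV_def)
    then show ?thesis using 2 by (simp add: flat_def)
  qed
qed

text \<open>
  A class of functions that contains the bumps and, by construction, is closed under directional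
  derivatives. It gives infinite differentiability without any computation of iterated partial derivatives.
\<close>

inductive smooth_fun :: "('a::euclidean_space \<Rightarrow> real) \<Rightarrow> bool" where
  const: "smooth_fun (\<lambda>z. c)"
| inner: "smooth_fun (\<lambda>z. z \<bullet> v)"
| add: "smooth_fun f \<Longrightarrow> smooth_fun g \<Longrightarrow> smooth_fun (\<lambda>z. f z + g z)"
| mult: "smooth_fun f \<Longrightarrow> smooth_fun g \<Longrightarrow> smooth_fun (\<lambda>z. f z * g z)"
| flat: "smooth_fun f \<Longrightarrow> smooth_fun (\<lambda>z. flat m (f z))"

lemma smooth_fun_cmult: "smooth_fun f \<Longrightarrow> smooth_fun (\<lambda>z. c * f z)"
  by (intro smooth_fun.mult smooth_fun.const)

lemma smooth_fun_diff: "smooth_fun f \<Longrightarrow> smooth_fun g \<Longrightarrow> smooth_fun (\<lambda>z. f z - g z)"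
  using smooth_fun.add[of f "\<lambda>z. -1 * g z"] smooth_fun_cmult[of g "-1"] by simp

lemma smooth_fun_sum: "finite A \<Longrightarrow> (\<And>i. i \<in> A \<Longrightarrow> smooth_fun (f i)) \<Longrightarrow> smooth_fun (\<lambda>z. \<Sum>i\<in>A. f i z)"
  by (induction rule: finite_induct) (auto intro: smooth_fun.intros)

lemma smooth_fun_has_derivative:
  assumes "smooth_fun f"
  shows "\<exists>f'. (\<forall>z. (f has_derivative f' z) (at z)) \<and> (\<forall>e. smooth_fun (\<lambda>z. f' z e))"
  using assms
proof induction
  case (const c)
  show ?case by (rule exI[of _ "\<lambda>z e. 0"]) (auto intro: smooth_fun.intros)
next
  case (inner v)
  show ?case
    by (rule exI[of _ "\<lambda>z e. e \<bullet> v"]) (auto intro!: derivative_eq_intros smooth_fun.intros)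
next
  case (add f g)
  then obtain f' g' where "\<forall>z. (f has_derivative f' z) (at z)" "\<forall>e. smooth_fun (\<lambda>z. f' z e)"
    "\<forall>z. (g has_derivative g' z) (at z)" "\<forall>e. smooth_fun (\<lambda>z. g' z e)" by blast
  then show ?case
    by (intro exI[of _ "\<lambda>z e. f' z e + g' z e"]) (auto intro!: derivative_eq_intros smooth_fun.intros)
next
  case (mult f g)
  then obtain f' g' where *: "\<And>z. (f has_derivative f' z) (at z)" "\<And>e. smooth_fun (\<lambda>z. f' z e)"
    "\<And>z. (g has_derivative g' z) (at z)" "\<And>e. smooth_fun (\<lambda>z. g' z e)" by blast
  show ?case
    by (intro exI[of _ "\<lambda>z e. f z * g' z e + f' z e * g z"] conjI allI has_derivative_mult *
        smooth_fun.add smooth_fun.mult mult)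
next
  case (flat f m)
  then obtain f' where *: "\<And>z. (f has_derivative f' z) (at z)" "\<And>e. smooth_fun (\<lambda>z. f' z e)"
    by blast
  show ?case
  proof (intro exI[of _ "\<lambda>z e. (flat (m + 2) (f z) - real m * flat (m + 1) (f z)) * f' z e"] conjI allI)
    show "((\<lambda>z. flat m (f z)) has_derivative
        (\<lambda>e. (flat (m + 2) (f z) - real m * flat (m + 1) (f z)) * f' z e)) (at z)" for z
      using has_derivative_compose[OF *(1) flat_has_real_derivative[unfolded has_field_derivative_def]]
      by simp
    show "smooth_fun (\<lambda>z. (flat (m + 2) (f z) - real m * flat (m + 1) (f z)) * f' z e)" for e
      by (intro smooth_fun.mult smooth_fun_diff smooth_fun.flat flat.hyps smooth_fun_cmult *)
  qed
qed

abbreviation pd :: "'a::euclidean_space \<Rightarrow> ('a \<Rightarrow> real) \<Rightarrow> 'a \<Rightarrow> real" where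
  "pd e f \<equiv> (\<lambda>z. frechet_derivative f (at z) e)"

lemma smooth_fun_frechet:
  assumes "smooth_fun f"
  shows "(f has_derivative frechet_derivative f (at z)) (at z)"
  using smooth_fun_has_derivative[OF assms] frechet_derivative_at by metis

lemma smooth_fun_pd:
  assumes "smooth_fun f"
  shows "smooth_fun (pd e f)"
proof -
  obtain f' where f': "\<And>z. (f has_derivative f' z) (at z)" "\<And>e. smooth_fun (\<lambda>z. f' z e)"
    using smooth_fun_has_derivative[OF assms] by blast
  have "frechet_derivative f (at z) = f' z" for z
    using f'(1) frechet_derivative_at by metis
  then show ?thesis using f'(2) by simp
qed

lemma smooth_fun_partials: "smooth_fun f \<Longrightarrow> smooth_fun (partials es f)"
  by (induction es arbitrary: f) (auto intro: smooth_fun_pd)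

lemma smooth_fun_differentiable: "smooth_fun f \<Longrightarrow> f differentiable_on UNIV"
  using smooth_fun_frechet unfolding differentiable_on_def differentiable_def
  by (metis has_derivative_at_withinI)

lemma smooth_fun_continuous: "smooth_fun f \<Longrightarrow> continuous_on S f"
  using smooth_fun_differentiable differentiable_imp_continuous_on continuous_on_subset by blast

lemma smooth_fun_test_function:
  assumes "smooth_fun f" and supp: "\<And>z. f z \<noteq> 0 \<Longrightarrow> z \<in> K" and "compact K" "K \<subseteq> \<Omega>"
  shows "f \<in> test_functions \<Omega>"
proof -
  have sub: "closure {z. f z \<noteq> 0} \<subseteq> K"
    using supp \<open>compact K\<close> by (intro closure_minimal) (auto simp: compact_imp_closed)
  then have "compact (closure {z. f z \<noteq> 0})"
    using \<open>compact K\<close> by (meson closed_closure closed_subset compact_imp_bounded bounded_subset compact_eq_bounded_closed)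
  then show ?thesis
    using sub assms by (auto simp: test_functions_def intro!: smooth_fun_differentiable smooth_fun_partials)
qed

lemma smooth_fun_reflect:
  assumes "smooth_fun f"
  shows "smooth_fun (\<lambda>y. f (z - y))"
  using assms
proof induction
  case (inner v)
  show ?case unfolding inner_diff_left by (intro smooth_fun.intros smooth_fun_diff)
qed (intro smooth_fun.intros; assumption)+

lemma pd_reflect:
  assumes "smooth_fun f"
  shows "pd e (\<lambda>y. c * f (z - y)) = (\<lambda>y. (- c) * pd e f (z - y))"
proof
  fix y
  have "((\<lambda>y. z - y) has_derivative (\<lambda>h. - h)) (at y)"
    by (auto intro!: derivative_eq_intros)
  from has_derivative_compose[OF this smooth_fun_frechet[OF assms]]
  have "((\<lambda>y. c * f (z - y)) has_derivative (\<lambda>h. c * frechet_derivative f (at (z - y)) (- h))) (at y)"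
    by (intro has_derivative_mult_right) 
  then have "frechet_derivative (\<lambda>y. c * f (z - y)) (at y) = (\<lambda>h. c * frechet_derivative f (at (z - y)) (- h))"
    using frechet_derivative_at by metis
  then show "pd e (\<lambda>y. c * f (z - y)) y = (- c) * pd e f (z - y)"
    using linear_neg[OF has_derivative_linear[OF smooth_fun_frechet[OF assms]]] by simp
qed

text \<open>
  As a function of the second variable, \<open>\<lambda>y. f (z - y)\<close> picks up a sign for each derivative. It cancels the
  sign in the definition of a weak derivative.
\<close>

lemma partials_reflect:
  assumes "smooth_fun f"
  shows "partials es (\<lambda>y. c * f (z - y)) = (\<lambda>y. c * (-1) ^ length es * partials es f (z - y))"
  using assms
proof (induction es arbitrary: f c)
  case (Cons e es)
  show ?case
    by (simp only: partials.simps pd_reflect[OF Cons.prems] Cons.IH[OF smooth_fun_pd[OF Cons.prems]])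
      simp
qed simp

lemma smooth_fun_inner_self: "smooth_fun (\<lambda>z::'a::euclidean_space. z \<bullet> z)"
proof -
  have "smooth_fun (\<lambda>z::'a. \<Sum>b\<in>Basis. (z \<bullet> b) * (z \<bullet> b))"
    by (intro smooth_fun_sum smooth_fun.intros finite_Basis)
  then show ?thesis by (simp add: euclidean_inner[symmetric])
qed

text \<open>
  The factor \<open>(real n)\<^sup>2\<close> shrinks the support to a ball of radius \<open>1 / n\<close>. Normalising by the integral instead of a power
  of \<open>n\<close> avoids a change of variables.
\<close>

definition bump :: "nat \<Rightarrow> 'a::euclidean_space \<Rightarrow> real" where
  "bump n z = flat 0 (1 - (real n)\<^sup>2 * (z \<bullet> z))"

lemma smooth_fun_bump: "smooth_fun (bump n)"
  unfolding bump_def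
  by (intro smooth_fun.flat smooth_fun_diff smooth_fun.const smooth_fun_cmult smooth_fun_inner_self)

lemma bump_nonneg: "0 \<le> bump n z"
  by (simp add: bump_def flat_nonneg)

lemma bump_eq_0:
  assumes "0 < n" "1 / real n \<le> norm z"
  shows "bump n z = 0"
proof -
  have "1 \<le> real n * norm z" using assms by (simp add: field_simps)
  then have "1 \<le> (real n * norm z)\<^sup>2" by simp
  then have "1 \<le> (real n)\<^sup>2 * (z \<bullet> z)" by (simp add: power_mult_distrib power2_norm_eq_inner)
  then show ?thesis by (simp add: bump_def flat_def)
qed

lemma bump_le_1: "bump n z \<le> 1"
proof -
  have "0 \<le> (real n)\<^sup>2 * (z \<bullet> z)" by simp
  then show ?thesis by (auto simp: bump_def flat_def)
qed

lemma bump_pos: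
  assumes "norm z < 1 / real n" "0 < n"
  shows "0 < bump n z"
proof -
  have "real n * norm z < 1" using assms by (simp add: field_simps)
  then have "(real n * norm z)\<^sup>2 < 1" by (simp add: power_less_one_iff abs_square_less_1)
  then have "(real n)\<^sup>2 * (z \<bullet> z) < 1" by (simp add: power_mult_distrib power2_norm_eq_inner)
  then show ?thesis by (simp add: bump_def flat_def)
qed

lemma integrable_bump:
  assumes "0 < n"
  shows "integrable lborel (bump n :: 'a::euclidean_space \<Rightarrow> real)"
proof -
  have "integrable lborel (\<lambda>z::'a. indicator (cball 0 1) z *\<^sub>R bump n z)"
    by (rule borel_integrable_compact) (auto intro: smooth_fun_continuous smooth_fun_bump)
  moreover
  have "indicator (cball 0 1) z *\<^sub>R bump n z = bump n z" for z :: 'a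
  proof (cases "norm z \<le> 1")
    case False
    have "1 / real n \<le> 1" using assms by simp
    then have "1 / real n \<le> norm z" using False by linarith
    then show ?thesis using assms by (simp add: bump_eq_0)
  qed simp
  then have "(\<lambda>z::'a. indicator (cball 0 1) z *\<^sub>R bump n z) = bump n" by (rule ext)
  ultimately show ?thesis by (simp only:)
qed

lemma integral_bump_pos:
  assumes "0 < n"
  shows "0 < (LINT z|lborel. bump n (z::'a::euclidean_space))"
proof -
  have "(LINT z|lborel. bump n (z::'a)) \<noteq> 0"
  proof
    assume "(LINT z|lborel. bump n (z::'a)) = 0"
    then have "AE z in lborel. bump n (z::'a) = 0"
      using integral_nonneg_eq_0_iff_AE[OF integrable_bump[OF assms]] bump_nonneg by auto
    then have "AE z in lborel. z \<notin> ball (0::'a) (1 / real n)"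
      by eventually_elim (use bump_pos[OF _ assms] in \<open>force simp: dist_norm\<close>)
    then have "ball (0::'a) (1 / real n) \<in> null_sets lborel"
      by (simp add: AE_iff_null_sets)
    then have "emeasure lborel (ball (0::'a) (1 / real n)) = 0" by auto
    moreover have "measure lborel (ball (0::'a) (1 / real n)) > 0"
      using content_ball_pos[of "1 / real n" "0::'a"] assms by simp
    ultimately show False by (simp add: measure_def)
  qed
  then show ?thesis using bump_nonneg by (metis less_le AE_I2 integral_nonneg_AE)
qed

definition mollifier :: "nat \<Rightarrow> 'a::euclidean_space \<Rightarrow> real" where
  "mollifier n z = inverse (LINT z|lborel. bump n (z::'a)) * bump n z"

lemma smooth_fun_mollifier: "smooth_fun (mollifier n)"
  unfolding mollifier_def by (intro smooth_fun_cmult smooth_fun_bump)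

lemma mollifier_nonneg: "0 < n \<Longrightarrow> 0 \<le> mollifier n z"
  using integral_bump_pos[of n] by (auto simp: mollifier_def bump_nonneg less_imp_le)

lemma mollifier_eq_0: "0 < n \<Longrightarrow> 1 / real n \<le> norm z \<Longrightarrow> mollifier n z = 0"
  by (simp add: mollifier_def bump_eq_0)

lemma integrable_mollifier: "0 < n \<Longrightarrow> integrable lborel (mollifier n)"
  unfolding mollifier_def by (intro integrable_mult_right integrable_bump)

lemma integral_mollifier: "0 < n \<Longrightarrow> (LINT z|lborel. mollifier n (z::'a::euclidean_space)) = 1"
  using integral_bump_pos[of n, where ?'a='a] by (simp add: mollifier_def)

lemma mollifier_bounded: "0 < n \<Longrightarrow> \<bar>mollifier n (z::'a::euclidean_space)\<bar> \<le> inverse (LINT z|lborel. bump n (z::'a))"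
  using mult_left_mono[OF bump_le_1[of n z], of "inverse (LINT z|lborel. bump n (z::'a))"]
    integral_bump_pos[of n, where ?'a='a] mollifier_nonneg[of n z]
  by (simp add: mollifier_def)

lemma mollifier_measurable[measurable]: "mollifier n \<in> borel_measurable borel"
  using smooth_fun_continuous[OF smooth_fun_mollifier] borel_measurable_continuous_onI by blast

section \<open>Mollification of integrable functions\<close>

lemma nn_integral_lborel_translate:
  fixes g :: "'a::euclidean_space \<Rightarrow> ennreal"
  assumes [measurable]: "g \<in> borel_measurable borel"
  shows "(\<integral>\<^sup>+ z. g (z + w) \<partial>lborel) = (\<integral>\<^sup>+ z. g z \<partial>lborel)"
proof -
  have "(\<integral>\<^sup>+ z. g z \<partial>lborel) = (\<integral>\<^sup>+ z. g z \<partial>distr lborel borel ((+) w))"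
    by (simp add: lborel_distr_plus)
  also have "\<dots> = (\<integral>\<^sup>+ z. g (w + z) \<partial>lborel)"
    by (subst nn_integral_distr) auto
  finally show ?thesis by (simp add: add.commute)
qed

text \<open>
  Finite measure matters here: a closed set of almost full measure is cut off by a large ball.
\<close>

lemma inner_compact_approx:
  fixes A :: "'a::euclidean_space set" and e :: real
  assumes A: "A \<in> sets borel" "emeasure lborel A < \<infinity>" and "0 < e"
  obtains K where "compact K" "K \<subseteq> A" "emeasure lborel (A - K) < ennreal e"
proof -
  have "A \<in> sets lebesgue" using A by auto
  then obtain T where T: "closed T" "T \<subseteq> A" "emeasure lebesgue (A - T) < ennreal e"
    using sets_lebesgue_inner_closed[of A e] \<open>0 < e\<close> by metis
  have [measurable]: "T \<in> sets borel" "A \<in> sets borel" using T A by auto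
  let ?K = "\<lambda>k::nat. T \<inter> cball 0 (real k)"
  have "(\<lambda>k. emeasure lborel (A - ?K k)) \<longlonglongrightarrow> emeasure lborel (\<Inter>k. A - ?K k)"
  proof (rule Lim_emeasure_decseq)
    show "range (\<lambda>k. A - ?K k) \<subseteq> sets lborel" by (auto simp: borel_closed A)
    show "decseq (\<lambda>k. A - ?K k)" by (force simp: decseq_def)
    show "emeasure lborel (A - ?K k) \<noteq> \<infinity>" for k
      using A emeasure_mono[of "A - ?K k" A lborel] by (auto simp: top_unique)
  qed
  moreover have "(\<Inter>k. A - ?K k) = A - T"
  proof -
    have "\<exists>k. norm x \<le> real k" for x :: 'a by (rule real_arch_simple)
    then show ?thesis by auto
  qed
  moreover have "emeasure lborel (A - T) < ennreal e" using T(3) by simp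
  ultimately have "\<forall>\<^sub>F k in sequentially. emeasure lborel (A - ?K k) < ennreal e"
    by (simp add: order_tendstoD(2))
  then obtain k where "emeasure lborel (A - ?K k) < ennreal e"
    by (auto simp: eventually_sequentially)
  then show ?thesis using that[of "?K k"] T(1,2) closed_Int_compact[OF T(1) compact_cball] by blast
qed

lemma ennreal_abs_add_le: "ennreal \<bar>x + y\<bar> \<le> ennreal \<bar>x\<bar> + ennreal \<bar>y\<bar>"
proof -
  have "ennreal \<bar>x + y\<bar> \<le> ennreal (\<bar>x\<bar> + \<bar>y\<bar>)" by (intro ennreal_leI abs_triangle_ineq)
  also have "\<dots> = ennreal \<bar>x\<bar> + ennreal \<bar>y\<bar>" by (intro ennreal_plus) auto
  finally show ?thesis .
qed

text \<open>
  By density it is enough to treat indicators of sets \<open>A\<close> of finite measure. With compact \<open>K \<subseteq> A\<close> and open \<open>U \<supseteq> K\<close>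
  such that \<open>A - K\<close> and \<open>U - K\<close> are small, a translation by less than the distance of \<open>K\<close> and the complement of
  \<open>U\<close> changes the indicator of \<open>A\<close> only on these two small sets and their translates.
\<close>

lemma translation_continuous_L1:
  fixes f :: "'a::euclidean_space \<Rightarrow> real"
  assumes "integrable lborel f" and "0 < e"
  shows "\<exists>d>0. \<forall>w. norm w < d \<longrightarrow> (\<integral>\<^sup>+ z. ennreal \<bar>f (z + w) - f z\<bar> \<partial>lborel) \<le> ennreal e"
proof -
  have approx: "(\<integral>\<^sup>+ z. ennreal \<bar>f (z + w) - f z\<bar> \<partial>lborel) \<le> 2 * ennreal a + b"
    if [measurable]: "f \<in> borel_measurable borel" "g \<in> borel_measurable borel"
      and a: "(\<integral>\<^sup>+ z. ennreal \<bar>f z - g z\<bar> \<partial>lborel) \<le> ennreal a"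
      and b: "(\<integral>\<^sup>+ z. ennreal \<bar>g (z + w) - g z\<bar> \<partial>lborel) \<le> b"
    for f g :: "'a \<Rightarrow> real" and w a b
  proof -
    have "(\<integral>\<^sup>+ z. ennreal \<bar>f (z + w) - f z\<bar> \<partial>lborel)
      \<le> (\<integral>\<^sup>+ z. ennreal \<bar>f (z + w) - g (z + w)\<bar> + ennreal \<bar>f z - g z\<bar> + ennreal \<bar>g (z + w) - g z\<bar> \<partial>lborel)"
    proof (intro nn_integral_mono)
      fix z
      have "ennreal \<bar>f (z + w) - f z\<bar>
        = ennreal \<bar>((f (z + w) - g (z + w)) + (g z - f z)) + (g (z + w) - g z)\<bar>" by simp
      also have "\<dots> \<le> ennreal \<bar>(f (z + w) - g (z + w)) + (g z - f z)\<bar> + ennreal \<bar>g (z + w) - g z\<bar>"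
        by (rule ennreal_abs_add_le)
      also have "\<dots> \<le> ennreal \<bar>f (z + w) - g (z + w)\<bar> + ennreal \<bar>g z - f z\<bar> + ennreal \<bar>g (z + w) - g z\<bar>"
        by (intro add_right_mono ennreal_abs_add_le)
      also have "\<bar>g z - f z\<bar> = \<bar>f z - g z\<bar>" by (rule abs_minus_commute)
      finally show "ennreal \<bar>f (z + w) - f z\<bar>
        \<le> ennreal \<bar>f (z + w) - g (z + w)\<bar> + ennreal \<bar>f z - g z\<bar> + ennreal \<bar>g (z + w) - g z\<bar>" .
    qed
    also have "\<dots> = (\<integral>\<^sup>+ z. ennreal \<bar>f (z + w) - g (z + w)\<bar> \<partial>lborel)
        + (\<integral>\<^sup>+ z. ennreal \<bar>f z - g z\<bar> \<partial>lborel) + (\<integral>\<^sup>+ z. ennreal \<bar>g (z + w) - g z\<bar> \<partial>lborel)"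
      by (simp add: nn_integral_add)
    also have "(\<integral>\<^sup>+ z. ennreal \<bar>f (z + w) - g (z + w)\<bar> \<partial>lborel) = (\<integral>\<^sup>+ z. ennreal \<bar>f z - g z\<bar> \<partial>lborel)"
      by (rule nn_integral_lborel_translate[where g="\<lambda>z. ennreal \<bar>f z - g z\<bar>"]) measurable
    finally show ?thesis
      unfolding mult_2 by (rule order_trans) (intro add_mono a b)
  qed
  show ?thesis
    using assms
  proof (induction arbitrary: e rule: integrable_induct)
    case (base A c)
    have [measurable]: "A \<in> sets borel" using base by simp
    define r where "r = e / (4 * (\<bar>c\<bar> + 1))"
    have r: "0 < r" using base by (simp add: r_def)
    obtain K where K: "compact K" "K \<subseteq> A" "emeasure lborel (A - K) < ennreal r"
      using inner_compact_approx[of A r] base r by auto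
    have [measurable]: "K \<in> sets borel" using K by (simp add: borel_compact)
    obtain U where U: "open U" "K \<subseteq> U" "emeasure lebesgue (U - K) < ennreal r"
      using sets_lebesgue_outer_open[of K r] r by (metis \<open>K \<in> sets borel\<close> sets_completionI_sets sets_lborel)
    have [measurable]: "U \<in> sets borel" using U by simp
    have UK: "emeasure lborel (U - K) < ennreal r" using U(3) by simp
    have "\<exists>d>0. \<forall>x\<in>K. \<forall>y\<in>-U. d \<le> dist x y"
      by (rule separate_compact_closed) (use K U in auto)
    then obtain d where d: "d > 0" "\<And>x y. x \<in> K \<Longrightarrow> y \<notin> U \<Longrightarrow> d \<le> dist x y" by auto
    show ?case
    proof (intro exI[of _ d] conjI allI impI d)
      fix w :: 'a assume w: "norm w < d"
      have KU1: "z + w \<in> U" if "z \<in> K" for z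
        using d(2)[OF that, of "z + w"] w by (auto simp: dist_norm)
      have KU2: "z \<in> U" if "z + w \<in> K" for z
        using d(2)[OF that, of "z"] w by (auto simp: dist_norm)
      have "(\<integral>\<^sup>+ z. ennreal \<bar>indicator A (z + w) *\<^sub>R c - indicator A z *\<^sub>R c\<bar> \<partial>lborel)
        \<le> (\<integral>\<^sup>+ z. ennreal \<bar>c\<bar> * (indicator (A - K) (z + w) + indicator (A - K) z
              + indicator (U - K) (z + w) + indicator (U - K) z) \<partial>lborel)"
      proof (intro nn_integral_mono)
        fix z :: 'a
        have "ennreal \<bar>indicator A (z + w) *\<^sub>R c - indicator A z *\<^sub>R c\<bar>
          = ennreal \<bar>c\<bar> * (if z + w \<in> A \<longleftrightarrow> z \<in> A then 0 else 1)"
          by (cases "z + w \<in> A"; cases "z \<in> A") auto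
        also have "\<dots> \<le> ennreal \<bar>c\<bar> * (indicator (A - K) (z + w) + indicator (A - K) z
              + indicator (U - K) (z + w) + indicator (U - K) z)"
        proof (intro mult_left_mono)
          have "z + w \<in> A - K \<or> z \<in> A - K \<or> z + w \<in> U - K \<or> z \<in> U - K" if "(z + w \<in> A) \<noteq> (z \<in> A)"
            using that KU1[of z] KU2[of z] K(2) by blast
          then show "(if z + w \<in> A \<longleftrightarrow> z \<in> A then 0 else 1) \<le> (indicator (A - K) (z + w) + indicator (A - K) z
              + indicator (U - K) (z + w) + indicator (U - K) z :: ennreal)"
            by (auto simp: indicator_def simp del: Diff_iff)
        qed simp
        finally show "ennreal \<bar>indicator A (z + w) *\<^sub>R c - indicator A z *\<^sub>R c\<bar>
          \<le> ennreal \<bar>c\<bar> * (indicator (A - K) (z + w) + indicator (A - K) z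
              + indicator (U - K) (z + w) + indicator (U - K) z)" .
      qed
      also have "\<dots> = ennreal \<bar>c\<bar> * ((\<integral>\<^sup>+ z. indicator (A - K) (z + w) \<partial>lborel) + (\<integral>\<^sup>+ z. indicator (A - K) z \<partial>lborel)
              + (\<integral>\<^sup>+ z. indicator (U - K) (z + w) \<partial>lborel) + (\<integral>\<^sup>+ z. indicator (U - K) z \<partial>lborel))"
        by (simp add: nn_integral_add nn_integral_cmult)
      also have "\<dots> = ennreal \<bar>c\<bar> * (emeasure lborel (A - K) + emeasure lborel (A - K)
          + emeasure lborel (U - K) + emeasure lborel (U - K))"
        using nn_integral_lborel_translate[of "indicator (A - K)" w] nn_integral_lborel_translate[of "indicator (U - K)" w]
        by simp
      also have "\<dots> \<le> ennreal \<bar>c\<bar> * (ennreal r + ennreal r + ennreal r + ennreal r)"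
        using K(3) UK by (intro mult_left_mono add_mono) auto
      also have "\<dots> = ennreal (\<bar>c\<bar> * (4 * r))"
        using r by (simp add: ennreal_plus[symmetric] ennreal_mult[symmetric] del: ennreal_plus)
      also have "\<dots> \<le> ennreal e"
        using base by (intro ennreal_leI) (auto simp: r_def field_simps)
      finally show "(\<integral>\<^sup>+ z. ennreal \<bar>indicator A (z + w) *\<^sub>R c - indicator A z *\<^sub>R c\<bar> \<partial>lborel) \<le> ennreal e" .
    qed
  next
    case (add f g)
    have [measurable]: "f \<in> borel_measurable borel" "g \<in> borel_measurable borel"
      using add by auto
    obtain d1 where d1: "d1 > 0" "\<And>w. norm w < d1 \<Longrightarrow> (\<integral>\<^sup>+ z. ennreal \<bar>f (z + w) - f z\<bar> \<partial>lborel) \<le> ennreal (e/2)"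
      using add.IH(1)[of "e/2"] add.prems by auto
    obtain d2 where d2: "d2 > 0" "\<And>w. norm w < d2 \<Longrightarrow> (\<integral>\<^sup>+ z. ennreal \<bar>g (z + w) - g z\<bar> \<partial>lborel) \<le> ennreal (e/2)"
      using add.IH(2)[of "e/2"] add.prems by auto
    show ?case
    proof (intro exI[of _ "min d1 d2"] conjI allI impI)
      fix w :: 'a assume w: "norm w < min d1 d2"
      have "(\<integral>\<^sup>+ z. ennreal \<bar>f (z + w) + g (z + w) - (f z + g z)\<bar> \<partial>lborel)
        \<le> (\<integral>\<^sup>+ z. ennreal \<bar>f (z + w) - f z\<bar> + ennreal \<bar>g (z + w) - g z\<bar> \<partial>lborel)"
        using ennreal_abs_add_le[of "f (z + w) - f z" "g (z + w) - g z" for z]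
        by (intro nn_integral_mono) (simp add: algebra_simps)
      also have "\<dots> \<le> ennreal (e/2) + ennreal (e/2)"
        using w d1(2)[of w] d2(2)[of w] by (subst nn_integral_add) (auto intro: add_mono)
      also have "\<dots> = ennreal e" using \<open>0 < e\<close> by (simp add: ennreal_plus[symmetric] del: ennreal_plus)
      finally show "(\<integral>\<^sup>+ z. ennreal \<bar>f (z + w) + g (z + w) - (f z + g z)\<bar> \<partial>lborel) \<le> ennreal e" .
    qed (use d1 d2 in auto)
  next
    case (lim f s)
    have [measurable]: "f \<in> borel_measurable borel" "s i \<in> borel_measurable borel" for i
      using lim by auto
    have "(\<lambda>i. \<integral>\<^sup>+ z. ennreal \<bar>f z - s i z\<bar> \<partial>lborel) \<longlonglongrightarrow> (\<integral>\<^sup>+ z. 0 \<partial>(lborel :: 'a measure))"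
    proof (rule nn_integral_dominated_convergence[where u="\<lambda>i z. ennreal \<bar>f z - s i z\<bar>" and u'="\<lambda>z. 0" and w="\<lambda>z. ennreal (3 * \<bar>f z\<bar>)"])
      show "AE z in lborel. ennreal \<bar>f z - s j z\<bar> \<le> ennreal (3 * \<bar>f z\<bar>)" for j
        using lim.hyps(3)[of _ j] by (intro AE_I2 ennreal_leI) (smt (verit) real_norm_def)
      show "(\<integral>\<^sup>+ z. ennreal (3 * \<bar>f z\<bar>) \<partial>lborel) < \<infinity>"
        using lim.hyps(4) by (simp add: integrable_iff_bounded ennreal_mult nn_integral_cmult ennreal_mult_less_top)
      show "AE z in lborel. (\<lambda>i. ennreal \<bar>f z - s i z\<bar>) \<longlonglongrightarrow> 0"
      proof (intro AE_I2)
        fix z :: 'a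
        have "(\<lambda>i. ennreal \<bar>f z - s i z\<bar>) \<longlonglongrightarrow> ennreal \<bar>f z - f z\<bar>"
          using lim.hyps(2)[of z] by (intro tendsto_intros) auto
        then show "(\<lambda>i. ennreal \<bar>f z - s i z\<bar>) \<longlonglongrightarrow> 0" by simp
      qed
    qed auto
    then have "\<forall>\<^sub>F i in sequentially. (\<integral>\<^sup>+ z. ennreal \<bar>f z - s i z\<bar> \<partial>lborel) < ennreal (e/4)"
      using \<open>0 < e\<close> by (intro order_tendstoD(2)) auto
    then obtain i where i: "(\<integral>\<^sup>+ z. ennreal \<bar>f z - s i z\<bar> \<partial>lborel) \<le> ennreal (e/4)"
      by (auto simp: eventually_sequentially intro: less_imp_le)
    obtain d where d: "d > 0" "\<And>w. norm w < d \<Longrightarrow> (\<integral>\<^sup>+ z. ennreal \<bar>s i (z + w) - s i z\<bar> \<partial>lborel) \<le> ennreal (e/2)"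
      using lim.IH[of "e/2" i] \<open>0 < e\<close> by auto
    show ?case
    proof (intro exI[of _ d] conjI allI impI d)
      fix w :: 'a assume w: "norm w < d"
      have "(\<integral>\<^sup>+ z. ennreal \<bar>f (z + w) - f z\<bar> \<partial>lborel) \<le> 2 * ennreal (e/4) + ennreal (e/2)"
        by (rule approx[OF _ _ i d(2)[OF w]]) auto
      also have "\<dots> = ennreal e"
        using \<open>0 < e\<close> by (simp add: ennreal_plus[symmetric] mult_2 del: ennreal_plus)
      finally show "(\<integral>\<^sup>+ z. ennreal \<bar>f (z + w) - f z\<bar> \<partial>lborel) \<le> ennreal e" .
    qed
  qed
qed

lemma mollifier_minus: "mollifier n (x - y) = mollifier n (y - x)"
  by (simp add: mollifier_def bump_def algebra_simps inner_commute)

definition moll :: "nat \<Rightarrow> ('a::euclidean_space \<Rightarrow> real) \<Rightarrow> 'a \<Rightarrow> real" where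
  "moll n f z = (LINT y|lborel. f y * mollifier n (z - y))"

lemma moll_integrable:
  fixes f :: "'a::euclidean_space \<Rightarrow> real"
  assumes "0 < n" "integrable lborel f"
  shows "integrable lborel (\<lambda>y. f y * mollifier n (z - y))"
proof (rule Bochner_Integration.integrable_bound)
  let ?C = "inverse (LINT z|lborel. bump n (z::'a))"
  show "integrable lborel (\<lambda>y. f y * ?C)" using assms(2) by simp
  show "(\<lambda>y. f y * mollifier n (z - y)) \<in> borel_measurable lborel"
    using assms(2) by (auto intro!: borel_measurable_times measurable_compose[OF _ mollifier_measurable])
  have "\<bar>f y\<bar> * \<bar>mollifier n (z - y)\<bar> \<le> \<bar>f y\<bar> * \<bar>?C\<bar>" for y
    by (intro mult_left_mono order_trans[OF mollifier_bounded[OF assms(1), of "z - y"] abs_ge_self] abs_ge_zero)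
  then show "AE y in lborel. norm (f y * mollifier n (z - y)) \<le> norm (f y * ?C)"
    by (simp only: abs_mult real_norm_def AE_I2)
qed

lemma mollifier_translate:
  fixes z :: "'a::euclidean_space"
  assumes n: "0 < n"
  shows "integrable lborel (\<lambda>y. mollifier n (z - y))" "(LINT y|lborel. mollifier n (z - y)) = 1"
proof -
  have *: "(\<lambda>y. mollifier n (z - y)) = (\<lambda>y. mollifier n (- z + y))"
    by (simp add: mollifier_minus[of n z])
  have I: "integrable (distr lborel borel ((+) (- z))) (mollifier n :: 'a \<Rightarrow> real)"
    "(LINT y|distr lborel borel ((+) (- z)). mollifier n (y::'a)) = 1"
    using integrable_mollifier[OF n] integral_mollifier[OF n] by (simp_all add: lborel_distr_plus)
  show "integrable lborel (\<lambda>y. mollifier n (z - y))"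
    unfolding * by (rule integrable_distr[OF _ I(1)]) auto
  show "(LINT y|lborel. mollifier n (z - y)) = 1"
    using I(2) unfolding * by (subst (asm) integral_distr) auto
qed

lemma moll_measurable[measurable]:
  fixes f :: "'a::euclidean_space \<Rightarrow> real"
  assumes [measurable]: "f \<in> borel_measurable borel"
  shows "moll n f \<in> borel_measurable borel"
proof -
  have "(\<lambda>z. LINT y|lborel. f y * mollifier n (z - y)) \<in> borel_measurable lborel"
    by (rule lborel.borel_measurable_lebesgue_integral) measurable
  then show ?thesis by (simp add: moll_def[abs_def])
qed

text \<open>
  By Tonelli, the distance of \<open>f\<close> and its mollification is at most the mean, weighted with the mollifier, of
  the \<open>L_1\<close> distances of \<open>f\<close> and its translates by less than \<open>1 / n\<close>.
\<close>

theorem moll_tendsto_L1: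
  fixes f :: "'a::euclidean_space \<Rightarrow> real"
  assumes f: "integrable lborel f"
  shows "(\<lambda>n. \<integral>\<^sup>+ z. ennreal \<bar>moll n f z - f z\<bar> \<partial>lborel) \<longlonglongrightarrow> 0"
proof (rule order_tendstoI)
  show "\<forall>\<^sub>F n in sequentially. x < (\<integral>\<^sup>+ z. ennreal \<bar>moll n f z - f z\<bar> \<partial>lborel)" if "x < 0" for x :: ennreal
    using that by simp
next
  fix x :: ennreal assume "0 < x"
  then obtain e :: real where e: "0 < e" "ennreal e < x"
  proof (cases x)
    case (real r)
    then show thesis using \<open>0 < x\<close> that[of "r / 2"] by (auto simp: ennreal_less_iff)
  next
    case top
    then show thesis using that[of 1] by simp
  qed
  have [measurable]: "f \<in> borel_measurable borel" using f by auto
  obtain d where d: "d > 0" "\<And>w. norm w < d \<Longrightarrow> (\<integral>\<^sup>+ z. ennreal \<bar>f (z + w) - f z\<bar> \<partial>lborel) \<le> ennreal e"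
    using translation_continuous_L1[OF f e(1)] by blast
  obtain N :: nat where N: "0 < N" "1 / real N < d"
    using nat_approx_posE[OF d(1)] by (metis zero_less_Suc)
  have "(\<integral>\<^sup>+ z. ennreal \<bar>moll n f z - f z\<bar> \<partial>lborel) < x" if n: "n \<ge> N" for n
  proof -
    have n0: "0 < n" using n N by simp
    have nd: "1 / real n < d"
      using N n by (smt (verit) frac_le of_nat_0_less_iff of_nat_mono)
    have pt: "ennreal \<bar>moll n f z - f z\<bar> \<le> (\<integral>\<^sup>+ w. ennreal \<bar>f (z + w) - f z\<bar> * ennreal (mollifier n w) \<partial>lborel)" for z
    proof -
      have "moll n f z - f z = (LINT y|lborel. f y * mollifier n (z - y)) - (LINT y|lborel. f z * mollifier n (z - y))"
        using mollifier_translate[OF n0, of z] by (simp add: moll_def)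
      also have "\<dots> = (LINT y|lborel. f y * mollifier n (z - y) - f z * mollifier n (z - y))"
        using mollifier_translate[OF n0, of z] by (intro Bochner_Integration.integral_diff[symmetric] moll_integrable[OF n0 f]) auto
      finally have "ennreal \<bar>moll n f z - f z\<bar> \<le> (\<integral>\<^sup>+ y. ennreal (norm (f y * mollifier n (z - y) - f z * mollifier n (z - y))) \<partial>lborel)"
        using integral_norm_bound_ennreal[of lborel "\<lambda>y. f y * mollifier n (z - y) - f z * mollifier n (z - y)"]
          mollifier_translate[OF n0, of z] moll_integrable[OF n0 f, of z] by simp
      also have "\<dots> = (\<integral>\<^sup>+ y. ennreal \<bar>f y - f z\<bar> * ennreal (mollifier n (y - z)) \<partial>lborel)"
        by (intro nn_integral_cong)
          (simp add: left_diff_distrib[symmetric] abs_mult mollifier_nonneg[OF n0] ennreal_mult'[symmetric] mollifier_minus[of n z])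
      also have "\<dots> = (\<integral>\<^sup>+ w. ennreal \<bar>f (w + z) - f z\<bar> * ennreal (mollifier n (w + z - z)) \<partial>lborel)"
        by (rule nn_integral_lborel_translate[symmetric, where g="\<lambda>y. ennreal \<bar>f y - f z\<bar> * ennreal (mollifier n (y - z))"]) measurable
      finally show ?thesis by (simp add: add.commute)
    qed
    have "(\<integral>\<^sup>+ z. ennreal \<bar>moll n f z - f z\<bar> \<partial>lborel)
      \<le> (\<integral>\<^sup>+ z. (\<integral>\<^sup>+ w. ennreal \<bar>f (z + w) - f z\<bar> * ennreal (mollifier n w) \<partial>lborel) \<partial>lborel)"
      by (intro nn_integral_mono pt)
    also have "\<dots> = (\<integral>\<^sup>+ w. (\<integral>\<^sup>+ z. ennreal \<bar>f (z + w) - f z\<bar> * ennreal (mollifier n w) \<partial>lborel) \<partial>lborel)"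
      by (rule lborel_pair.Fubini') measurable
    also have "\<dots> \<le> (\<integral>\<^sup>+ w. ennreal e * ennreal (mollifier n (w::'a)) \<partial>lborel)"
    proof (intro nn_integral_mono)
      fix w :: 'a
      show "(\<integral>\<^sup>+ z. ennreal \<bar>f (z + w) - f z\<bar> * ennreal (mollifier n w) \<partial>lborel) \<le> ennreal e * ennreal (mollifier n w)"
      proof (cases "norm w < 1 / real n")
        case True
        then show ?thesis using nd by (auto simp: nn_integral_multc intro!: mult_right_mono d(2))
      next
        case False
        then show ?thesis by (simp add: mollifier_eq_0[OF n0])
      qed
    qed
    also have "\<dots> = ennreal e * (\<integral>\<^sup>+ w. ennreal (mollifier n (w::'a)) \<partial>lborel)"
      by (rule nn_integral_cmult) simp
    also have "(\<integral>\<^sup>+ w. ennreal (mollifier n (w::'a)) \<partial>lborel) = 1"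
      using integrable_mollifier[OF n0, where ?'a='a] integral_mollifier[OF n0, where ?'a='a] mollifier_nonneg[OF n0]
      by (subst nn_integral_eq_integral) auto
    finally show ?thesis using e(2) by simp
  qed
  then show "\<forall>\<^sub>F n in sequentially. (\<integral>\<^sup>+ z. ennreal \<bar>moll n f z - f z\<bar> \<partial>lborel) < x"
    by (auto simp: eventually_sequentially)
qed

text \<open>
  Convexity of the power: the tangent at \<open>m\<close> lies below the graph.
\<close>

lemma power_tangent_le:
  fixes x m :: real
  assumes "0 \<le> x" "0 \<le> m"
  shows "(real q + 1) * m ^ q * x - real q * m ^ (q + 1) \<le> x ^ (q + 1)"
proof (induction q)
  case (Suc q)
  have "0 \<le> m ^ q * (real q + 1) * (x - m)\<^sup>2" using assms by simp
  also have "\<dots> = x * ((real q + 1) * m ^ q * x - real q * m ^ (q + 1))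
      - ((real (Suc q) + 1) * m ^ Suc q * x - real (Suc q) * m ^ (Suc q + 1))"
    by (simp add: algebra_simps power2_eq_square)
  finally have "(real (Suc q) + 1) * m ^ Suc q * x - real (Suc q) * m ^ (Suc q + 1)
      \<le> x * ((real q + 1) * m ^ q * x - real q * m ^ (q + 1))" by simp
  also have "\<dots> \<le> x * x ^ (q + 1)" using Suc assms by (intro mult_left_mono) auto
  finally show ?case by simp
qed simp

lemma moll_nonneg:
  assumes "0 < n" "\<And>y. 0 \<le> s y"
  shows "0 \<le> moll n s z"
  unfolding moll_def using assms mollifier_nonneg[OF assms(1)] by (intro integral_nonneg_AE AE_I2 mult_nonneg_nonneg)

text \<open>
  Jensen's inequality for the probability density \<open>\<lambda>y. mollifier n (z - y)\<close>, from the tangent at the mean.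
\<close>

lemma moll_power_le:
  fixes s :: "'a::euclidean_space \<Rightarrow> real"
  assumes n: "0 < n" and s: "integrable lborel s" "\<And>y. 0 \<le> s y"
    and sp: "integrable lborel (\<lambda>y. s y ^ (q + 1))"
  shows "moll n s z ^ (q + 1) \<le> moll n (\<lambda>y. s y ^ (q + 1)) z"
proof -
  define m where "m = moll n s z"
  have m: "0 \<le> m" unfolding m_def by (rule moll_nonneg[OF n s(2)])
  have "m ^ (q + 1) = (real q + 1) * m ^ q * moll n s z - real q * m ^ (q + 1)"
    unfolding m_def[symmetric] by (simp add: algebra_simps)
  also have "\<dots> = (LINT y|lborel. (real q + 1) * m ^ q * (s y * mollifier n (z - y)) - real q * m ^ (q + 1) * mollifier n (z - y))"
    using mollifier_translate[OF n, of z] moll_integrable[OF n s(1), of z] by (simp add: moll_def)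
  also have "\<dots> \<le> moll n (\<lambda>y. s y ^ (q + 1)) z"
    unfolding moll_def
  proof (rule integral_mono)
    show "integrable lborel (\<lambda>y. s y ^ (q + 1) * mollifier n (z - y))"
      by (rule moll_integrable[OF n sp])
    show "integrable lborel (\<lambda>y. (real q + 1) * m ^ q * (s y * mollifier n (z - y)) - real q * m ^ (q + 1) * mollifier n (z - y))"
      using mollifier_translate[OF n, of z] moll_integrable[OF n s(1), of z] by simp
    fix y
    show "(real q + 1) * m ^ q * (s y * mollifier n (z - y)) - real q * m ^ (q + 1) * mollifier n (z - y)
        \<le> s y ^ (q + 1) * mollifier n (z - y)"
      using mult_right_mono[OF power_tangent_le[OF s(2) m, of q y] mollifier_nonneg[OF n, of "z - y"]]
      by (simp add: algebra_simps)
  qed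
  finally show ?thesis by (simp add: m_def)
qed

section \<open>Mollification and weak derivatives\<close>

text \<open>
  The integral runs over a fixed box, which lets differentiation under the integral sign
  apply to continuous \<open>f\<close>. Near points whose mollifier is supported in the box this is the usual
  convolution.
\<close>

definition conv :: "'a::euclidean_space \<Rightarrow> 'a \<Rightarrow> ('a \<Rightarrow> real) \<Rightarrow> ('a \<Rightarrow> real) \<Rightarrow> 'a \<Rightarrow> real" where
  "conv a b f K z = integral (cbox a b) (\<lambda>y. f y * K (z - y))"

lemma frechet_derivative_sum_Basis:
  assumes "smooth_fun K"
  shows "frechet_derivative K (at z) h = (\<Sum>e\<in>Basis. (h \<bullet> e) * pd e K z)"
proof -
  have l: "linear (frechet_derivative K (at z))"
    using has_derivative_linear[OF smooth_fun_frechet[OF assms]] .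
  have "frechet_derivative K (at z) h = frechet_derivative K (at z) (\<Sum>e\<in>Basis. (h \<bullet> e) *\<^sub>R e)"
    by (simp add: euclidean_representation)
  also have "\<dots> = (\<Sum>e\<in>Basis. (h \<bullet> e) * pd e K z)"
    by (simp add: linear_sum[OF l] linear_cmul[OF l])
  finally show ?thesis .
qed

lemma conv_integrable:
  assumes "continuous_on (cbox a b) f" "smooth_fun K"
  shows "(\<lambda>y. f y * K (z - y)) integrable_on cbox a b"
  by (intro integrable_continuous continuous_intros assms smooth_fun_continuous smooth_fun_reflect)

lemma conv_has_derivative:
  fixes f :: "'a::euclidean_space \<Rightarrow> real"
  assumes f: "continuous_on (cbox a b) f" and K: "smooth_fun K"
  shows "(conv a b f K has_derivative (\<lambda>h. \<Sum>e\<in>Basis. (h \<bullet> e) * conv a b f (pd e K) z)) (at z)"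
proof -
  define D :: "'a \<Rightarrow> 'a \<Rightarrow> 'a \<Rightarrow>\<^sub>L real" where
    "D z y = (\<Sum>e\<in>Basis. (f y * pd e K (z - y)) *\<^sub>R blinfun_inner_left e)" for z y
  have D: "blinfun_apply (D z y) h = (\<Sum>e\<in>Basis. (h \<bullet> e) * (f y * pd e K (z - y)))" for z y h
    by (simp add: D_def blinfun.sum_left blinfun.scaleR_left mult.commute)
  have cont: "continuous_on UNIV (pd e K)" for e
    by (intro smooth_fun_continuous smooth_fun_pd K)
  have "((\<lambda>x. integral (cbox a b) (\<lambda>y. f y * K (x - y))) has_derivative
      blinfun_apply (integral (cbox a b) (D z))) (at z within UNIV)"
  proof (rule leibniz_rule)
    fix x y :: 'a
    have "((\<lambda>x. x - y) has_derivative (\<lambda>h. h)) (at x)" by (auto intro!: derivative_eq_intros)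
    from has_derivative_mult_right[OF has_derivative_compose[OF this smooth_fun_frechet[OF K]], of "f y"]
    have "((\<lambda>x. f y * K (x - y)) has_derivative (\<lambda>h. f y * frechet_derivative K (at (x - y)) h)) (at x)" .
    also have "(\<lambda>h. f y * frechet_derivative K (at (x - y)) h) = blinfun_apply (D x y)"
    proof
      fix h
      show "f y * frechet_derivative K (at (x - y)) h = blinfun_apply (D x y) h"
        unfolding D frechet_derivative_sum_Basis[OF K, of "x - y" h] sum_distrib_left
        by (intro sum.cong refl) (simp only: mult_ac)
    qed
    finally show "((\<lambda>x. f y * K (x - y)) has_derivative blinfun_apply (D x y)) (at x within UNIV)" by simp
  next
    show "continuous_on (UNIV \<times> cbox a b) (\<lambda>(x, t). D x t)"
    proof -
      have "continuous_on (UNIV \<times> cbox a b) (\<lambda>p. f (snd p))"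
        by (rule continuous_on_compose2[OF f continuous_on_snd[OF continuous_on_id]]) auto
      moreover have "continuous_on (UNIV \<times> cbox a b) (\<lambda>p. pd e K (fst p - snd p))" for e
        by (rule continuous_on_compose2[OF cont]) (auto intro!: continuous_intros)
      ultimately show ?thesis
        unfolding D_def split_beta
        by (intro continuous_on_sum continuous_on_scaleR continuous_on_mult continuous_on_const) auto
    qed
  qed (auto intro: conv_integrable[OF f K])
  moreover have "blinfun_apply (integral (cbox a b) (D z)) = (\<lambda>h. \<Sum>e\<in>Basis. (h \<bullet> e) * conv a b f (pd e K) z)"
  proof
    fix h
    have "continuous_on (cbox a b) (D z)"
    proof -
      have "continuous_on (cbox a b) (\<lambda>y. pd e K (z - y))" for e
        by (rule continuous_on_compose2[OF cont]) (auto intro!: continuous_intros)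
      then show ?thesis
        unfolding D_def by (intro continuous_on_sum continuous_on_scaleR continuous_on_mult continuous_on_const f) auto
    qed
    then have "D z integrable_on cbox a b" by (rule integrable_continuous)
    then have "blinfun_apply (integral (cbox a b) (D z)) h = integral (cbox a b) (\<lambda>y. blinfun_apply (D z y) h)"
      using blinfun_apply_integral by blast
    also have "\<dots> = (\<Sum>e\<in>Basis. integral (cbox a b) (\<lambda>y. (h \<bullet> e) * (f y * pd e K (z - y))))"
      unfolding D
      by (intro integral_sum finite_Basis integrable_on_mult_right conv_integrable f smooth_fun_pd K)
    finally show "blinfun_apply (integral (cbox a b) (D z)) h = (\<Sum>e\<in>Basis. (h \<bullet> e) * conv a b f (pd e K) z)"
      by (simp add: conv_def)
  qed
  ultimately show ?thesis by (simp add: conv_def[abs_def])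
qed

lemma conv_continuous:
  assumes "continuous_on (cbox a b) f" and "smooth_fun K"
  shows "continuous_on S (conv a b f K)"
  using conv_has_derivative[OF assms] has_derivative_continuous continuous_at_imp_continuous_on by blast

lemma partials_eq_0_on_open:
  assumes "open S" "\<And>z. z \<in> S \<Longrightarrow> f z = 0" "z \<in> S"
  shows "partials es f z = 0"
  using assms(2,3)
proof (induction es arbitrary: f z)
  case (Cons e es)
  have "pd e f y = 0" if "y \<in> S" for y
  proof -
    have "((\<lambda>y. 0) has_derivative (\<lambda>h. 0)) (at y)" by simp
    then have "(f has_derivative (\<lambda>h. 0)) (at y)"
      by (rule has_derivative_transform_within_open[OF _ assms(1) that]) (simp add: Cons.prems)
    then have "frechet_derivative f (at y) = (\<lambda>h. 0)" using frechet_derivative_at by metis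
    then show ?thesis by simp
  qed
  then show ?case using Cons.IH[of "pd e f" z] Cons.prems by simp
qed simp

lemma partials_mollifier_eq_0:
  assumes "0 < n" "1 / real n < norm z"
  shows "partials es (mollifier n) z = 0"
proof (rule partials_eq_0_on_open[of "- cball 0 (1 / real n)"])
  fix y :: 'a assume "y \<in> - cball 0 (1 / real n)"
  then show "mollifier n y = 0" using assms(1) by (intro mollifier_eq_0) auto
qed (use assms in auto)

lemma conv_eq_lebesgue:
  assumes f: "continuous_on (cbox a b) f" and K: "smooth_fun K"
  shows "conv a b f K z = (LINT y:cbox a b|lebesgue. f y * K (z - y))"
proof -
  have "continuous_on (cbox a b) (\<lambda>y. f y * K (z - y))"
    by (intro continuous_intros assms smooth_fun_continuous smooth_fun_reflect)
  from set_lebesgue_integral_eq_integral(2)[OF absolutely_integrable_continuous[OF this]]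
  show ?thesis by (simp add: conv_def)
qed

text \<open>
  The derivatives of the mollified function are the mollified weak derivatives: derivatives fall on the
  mollifier, which as a function of the integration variable is a test function. The integrable
  version \<open>g'\<close> has to agree with the weak derivative only where the mollifier does not vanish.
\<close>

lemma conv_partials_mollifier:
  fixes f u :: "'a::euclidean_space \<Rightarrow> real"
  assumes f: "continuous_on (cbox a b) f" and n: "0 < n"
    and \<Omega>: "\<Omega> \<subseteq> cbox a b" "cball z (1 / real n) \<subseteq> \<Omega>" "\<And>y. y \<in> \<Omega> \<Longrightarrow> f y = u y"
    and u: "has_weak_deriv \<Omega> es u g"
    and g': "integrable lborel g'" "AE y in lebesgue. y \<in> cball z (1 / real n) \<longrightarrow> g' y = g y"
    and \<Omega>m: "\<Omega> \<in> sets lebesgue"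
  shows "conv a b f (partials es (mollifier n)) z = moll n g' z"
proof -
  have out: "partials es (mollifier n) (z - y) = 0" if "y \<notin> \<Omega>" for y es
    using that \<Omega>(2) by (intro partials_mollifier_eq_0 n) (auto simp: subset_eq dist_norm)
  have test: "(\<lambda>y. mollifier n (z - y)) \<in> test_functions \<Omega>"
  proof (rule smooth_fun_test_function[OF smooth_fun_reflect[OF smooth_fun_mollifier]])
    fix y assume "mollifier n (z - y) \<noteq> 0"
    then show "y \<in> cball z (1 / real n)"
      using mollifier_eq_0[OF n, of "z - y"] by (force simp: dist_norm)
  qed (use \<Omega> in auto)
  have "conv a b f (partials es (mollifier n)) z = (LINT y:cbox a b|lebesgue. f y * partials es (mollifier n) (z - y))"
    by (intro conv_eq_lebesgue f smooth_fun_partials smooth_fun_mollifier)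
  also have "\<dots> = (LINT y:\<Omega>|lebesgue. u y * partials es (mollifier n) (z - y))"
    unfolding set_lebesgue_integral_def
    using \<Omega> out by (intro Bochner_Integration.integral_cong) (auto simp: indicator_def)
  also have "\<dots> = (-1) ^ length es * (LINT y:\<Omega>|lebesgue. u y * partials es (\<lambda>y. mollifier n (z - y)) y)"
  proof -
    have "partials es (\<lambda>y. mollifier n (z - y)) y = (-1) ^ length es * partials es (mollifier n) (z - y)" for y
      using fun_cong[OF partials_reflect[OF smooth_fun_mollifier, of es 1 n z], of y] by simp
    then have "(LINT y:\<Omega>|lebesgue. u y * partials es (\<lambda>y. mollifier n (z - y)) y)
      = (LINT y:\<Omega>|lebesgue. (-1) ^ length es * (u y * partials es (mollifier n) (z - y)))"
      by (simp add: mult_ac)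
    also have "\<dots> = (-1) ^ length es * (LINT y:\<Omega>|lebesgue. u y * partials es (mollifier n) (z - y))"
      by (rule set_integral_mult_right)
    finally show ?thesis by (simp add: mult.assoc[symmetric] power_add[symmetric])
  qed
  also have "\<dots> = (-1) ^ length es * ((-1) ^ length es * (LINT y:\<Omega>|lebesgue. g y * mollifier n (z - y)))"
    using u test by (auto simp: has_weak_deriv_def)
  also have "\<dots> = (LINT y:\<Omega>|lebesgue. g y * mollifier n (z - y))"
    by (simp add: mult.assoc[symmetric] power_add[symmetric])
  also have "\<dots> = (LINT y|lebesgue. g' y * mollifier n (z - y))"
    unfolding set_lebesgue_integral_def
  proof (rule integral_cong_AE)
    have gm: "set_integrable lebesgue (cball z (1 / real n)) g"
      using u \<Omega> by (auto simp: has_weak_deriv_def locally_integrable_on_def)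
    have [measurable]: "(\<lambda>y. mollifier n (z - y)) \<in> borel_measurable lebesgue"
      by (intro measurable_completion) simp
    have eq: "indicator \<Omega> y *\<^sub>R (g y * mollifier n (z - y)) = (indicator (cball z (1 / real n)) y *\<^sub>R g y) * mollifier n (z - y)" for y
      using out[of y "[]"] \<Omega>(2) mollifier_eq_0[OF n, of "z - y"]
      by (auto simp: indicator_def dist_norm)
    show "(\<lambda>y. indicator \<Omega> y *\<^sub>R (g y * mollifier n (z - y))) \<in> borel_measurable lebesgue"
      unfolding eq using gm unfolding set_integrable_def by (intro borel_measurable_times) auto
    show "(\<lambda>y. g' y * mollifier n (z - y)) \<in> borel_measurable lebesgue"
      using g'(1) by (intro borel_measurable_times measurable_completion) auto
    show "AE y in lebesgue. indicator \<Omega> y *\<^sub>R (g y * mollifier n (z - y)) = g' y * mollifier n (z - y)"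
      using g'(2)
    proof eventually_elim
      case (elim y)
      then show ?case unfolding eq
        using mollifier_eq_0[OF n, of "z - y"] by (cases "y \<in> cball z (1 / real n)") (auto simp: dist_norm)
    qed
  qed
  also have "\<dots> = moll n g' z"
    unfolding moll_def using g'(1) by (intro integral_completion) auto
  finally show ?thesis .
qed

lemma conv_mollifier_near:
  fixes f :: "'a::euclidean_space \<Rightarrow> real"
  assumes f: "continuous_on (cbox a b) f" and n: "0 < n"
    and z: "cball z (1 / real n) \<subseteq> cbox a b"
    and e: "\<And>y. y \<in> cball z (1 / real n) \<Longrightarrow> \<bar>f y - f z\<bar> \<le> e"
  shows "\<bar>conv a b f (mollifier n) z - f z\<bar> \<le> e"
proof -
  have "0 \<le> e" using e[of z] by simp
  have 1: "((\<lambda>y. mollifier n (z - y)) has_integral 1) (cbox a b)"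
  proof -
    have "(LINT y:cbox a b|lborel. mollifier n (z - y)) = (LINT y|lborel. mollifier n (z - y))"
      unfolding set_lebesgue_integral_def
      using mollifier_eq_0[OF n, of "z - y" for y] z
      by (intro Bochner_Integration.integral_cong) (fastforce simp: indicator_def dist_norm subset_eq)+
    moreover have "set_integrable lborel (cbox a b) (\<lambda>y. mollifier n (z - y))"
      using mollifier_translate(1)[OF n, of z] unfolding set_integrable_def by (intro integrable_mult_indicator) auto
    ultimately show ?thesis
      using mollifier_translate(2)[OF n, of z] set_borel_integral_eq_integral[of "cbox a b" "\<lambda>y. mollifier n (z - y)"]
      by (simp add: has_integral_integral)
  qed
  have i: "(\<lambda>y. f y * mollifier n (z - y)) integrable_on cbox a b"
    by (intro conv_integrable f smooth_fun_mollifier)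
  have 2: "((\<lambda>y. (f y - f z) * mollifier n (z - y)) has_integral (conv a b f (mollifier n) z - f z)) (cbox a b)"
    using has_integral_diff[OF integrable_integral[OF i] has_integral_mult_right[OF 1, of "f z"]]
    by (simp add: conv_def left_diff_distrib)
  have b: "\<bar>(f y - f z) * mollifier n (z - y)\<bar> \<le> e * mollifier n (z - y)" for y
    using e[of y] mollifier_eq_0[OF n, of "z - y"] mollifier_nonneg[OF n, of "z - y"]
    by (cases "y \<in> cball z (1 / real n)") (auto simp: abs_mult dist_norm intro: mult_right_mono)
  have 3: "((\<lambda>y. e * mollifier n (z - y)) has_integral e) (cbox a b)"
    using has_integral_mult_right[OF 1, of e] by simp
  show ?thesis
    using has_integral_le[OF 2 3] has_integral_le[OF has_integral_neg[OF 3] 2] b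
    by (smt (verit))
qed

lemma borel_version_on:
  fixes g :: "'a::euclidean_space \<Rightarrow> real"
  assumes "set_integrable lebesgue K g"
  obtains g' where "integrable lborel g'" "AE z in lebesgue. z \<in> K \<longrightarrow> g' z = g z"
proof -
  have i: "integrable lebesgue (\<lambda>z. indicator K z * g z)" using assms by (simp add: set_integrable_def)
  then have "(\<lambda>z. indicator K z * g z) \<in> borel_measurable (completion lborel)" by auto
  from completion_ex_borel_measurable_real[OF this]
  obtain g' where g': "g' \<in> borel_measurable lborel" "AE z in lborel. indicator K z * g z = g' z" by blast
  have ae: "AE z in lebesgue. indicator K z * g z = g' z" by (rule AE_completion[OF g'(2)])
  have "integrable lebesgue g'"
    using i g'(1) ae by (subst integrable_cong_AE[of g' _ "\<lambda>z. indicator K z * g z"])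
      (auto intro: measurable_completion elim: eventually_mono)
  then have "integrable lborel g'" using g'(1) by (simp add: integrable_completion)
  moreover have "AE z in lebesgue. z \<in> K \<longrightarrow> g' z = g z"
    using ae by eventually_elim (auto simp: indicator_def)
  ultimately show ?thesis using that by blast
qed

lemma powr_Suc_eq_power: "\<bar>x\<bar> powr (real q + 1) = \<bar>x\<bar> ^ (q + 1)"
  using powr_realpow[of "\<bar>x\<bar>" "q + 1"] by (cases "x = 0") (auto simp: add.commute)

text \<open>
  Cutting off outside the bounded set \<open>S\<close> turns local \<open>L_p\<close> integrability into integrability on the whole space,
  and finiteness of the measure of \<open>S\<close> gives integrability of the function itself.
\<close>

lemma Lp_borel_version_on:
  fixes h :: "'a::euclidean_space \<Rightarrow> real"
  assumes S: "S \<in> sets borel" "emeasure lborel S < \<infinity>" and h: "h \<in> Lp_on (real q + 1) S"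
  obtains h' where "integrable lborel h'" "integrable lborel (\<lambda>z. \<bar>h' z\<bar> ^ (q + 1))"
    "AE z in lebesgue. z \<in> S \<longrightarrow> h' z = h z"
proof -
  have [measurable]: "S \<in> sets borel" by fact
  have SL: "S \<in> sets lebesgue" using S by simp
  have "(\<lambda>z. indicator S z *\<^sub>R h z) \<in> borel_measurable (completion lborel)"
    using h SL by (auto simp: Lp_on_def borel_measurable_restrict_space_iff)
  from completion_ex_borel_measurable_real[OF this]
  obtain g where g [measurable]: "g \<in> borel_measurable borel" and
    ae: "AE z in lborel. indicator S z *\<^sub>R h z = g z" by auto
  define h' where "h' z = indicator S z * g z" for z
  have [measurable]: "h' \<in> borel_measurable borel" unfolding h'_def by measurable
  have ae': "AE z in lebesgue. indicator S z * h z = h' z"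
    using AE_completion[OF ae] by eventually_elim (auto simp: h'_def indicator_def split: if_splits)
  have "integrable lebesgue (\<lambda>z. indicator S z * \<bar>h z\<bar> powr (real q + 1))"
    using h SL by (auto simp: Lp_on_def integrable_restrict_space)
  moreover have "AE z in lebesgue. indicator S z * \<bar>h z\<bar> powr (real q + 1) = \<bar>h' z\<bar> ^ (q + 1)"
    using ae' by eventually_elim (auto simp: powr_Suc_eq_power indicator_def split: if_splits)
  ultimately have "integrable lebesgue (\<lambda>z. \<bar>h' z\<bar> ^ (q + 1))"
    by (subst integrable_cong_AE[of _ _ "\<lambda>z. indicator S z * \<bar>h z\<bar> powr (real q + 1)"])
      (auto intro!: measurable_completion elim: eventually_mono)
  then have p: "integrable lborel (\<lambda>z. \<bar>h' z\<bar> ^ (q + 1))" by (subst (asm) integrable_completion) auto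
  have "integrable lborel h'"
  proof (rule Bochner_Integration.integrable_bound)
    show "integrable lborel (\<lambda>z. indicator S z + \<bar>h' z\<bar> ^ (q + 1))"
      using S p by (intro Bochner_Integration.integrable_add integrable_real_indicator) auto
    have "\<bar>h' z\<bar> \<le> indicator S z + \<bar>h' z\<bar> ^ (q + 1)" for z
    proof (cases "\<bar>h' z\<bar> \<le> 1")
      case True
      then have "\<bar>h' z\<bar> \<le> indicator S z" by (auto simp: h'_def indicator_def)
      moreover have "0 \<le> \<bar>h' z\<bar> ^ (q + 1)" by (rule zero_le_power) simp
      ultimately show ?thesis by (rule add_increasing2[rotated])
    next
      case False
      then have "\<bar>h' z\<bar> ^ 1 \<le> \<bar>h' z\<bar> ^ (q + 1)" by (intro power_increasing) auto
      then show ?thesis by (simp add: add_increasing)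
    qed
    moreover have "0 \<le> indicator S z + \<bar>h' z\<bar> ^ (q + 1)" for z by simp
    ultimately show "AE z in lborel. norm (h' z) \<le> norm (indicator S z + \<bar>h' z\<bar> ^ (q + 1))"
      by (intro AE_I2) (simp only: real_norm_def abs_of_nonneg)
  qed auto
  moreover have "AE z in lebesgue. z \<in> S \<longrightarrow> h' z = h z"
    using ae' by eventually_elim (auto simp: indicator_def)
  ultimately show ?thesis using p that by blast
qed

lemma compact_neighbourhood:
  fixes Q :: "'a::euclidean_space set"
  assumes "compact Q" "open \<Omega>" "Q \<subseteq> \<Omega>"
  obtains K r where "0 < r" "compact K" "K \<subseteq> \<Omega>" "\<And>z. z \<in> Q \<Longrightarrow> cball z r \<subseteq> K"
proof -
  have "\<exists>d>0. \<forall>x\<in>Q. \<forall>y\<in>-\<Omega>. d \<le> dist x y"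
    by (rule separate_compact_closed) (use assms in auto)
  then obtain d where d: "d > 0" "\<And>x y. x \<in> Q \<Longrightarrow> y \<notin> \<Omega> \<Longrightarrow> d \<le> dist x y" by auto
  define K where "K = {x + y | x y. x \<in> Q \<and> y \<in> cball (0::'a) (d/2)}"
  show ?thesis
  proof (rule that)
    show "compact K" unfolding K_def by (intro compact_sums assms compact_cball)
    show "K \<subseteq> \<Omega>"
    proof
      fix w assume "w \<in> K"
      then obtain x y where w: "w = x + y" "x \<in> Q" "norm y \<le> d/2" by (auto simp: K_def)
      then have "dist x w < d" using d(1) by (simp add: dist_norm)
      then show "w \<in> \<Omega>" using d(2)[OF w(2), of w] by force
    qed
    show "cball z (d/2) \<subseteq> K" if "z \<in> Q" for z
    proof
      fix w assume "w \<in> cball z (d/2)"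
      then have "w = z + (w - z) \<and> z \<in> Q \<and> w - z \<in> cball 0 (d/2)"
        using that by (simp add: dist_norm norm_minus_commute)
      then show "w \<in> K" unfolding K_def by blast
    qed
  qed (use d in auto)
qed

text \<open>
  On a compact set both versions have, for large \<open>n\<close>, the same mollifications, namely derivatives of the mollified
  \<open>u\<close>; these converge in \<open>L_1\<close> to either version.
\<close>

theorem weak_deriv_unique:
  fixes f u :: "'a::euclidean_space \<Rightarrow> real"
  assumes f: "continuous_on (cbox a b) f" and \<Omega>: "open \<Omega>" "\<Omega> \<subseteq> cbox a b" "\<And>y. y \<in> \<Omega> \<Longrightarrow> f y = u y"
    and g: "has_weak_deriv \<Omega> es u g1" "has_weak_deriv \<Omega> es u g2"
    and Q: "compact Q" "Q \<subseteq> \<Omega>"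
  shows "AE z in lebesgue. z \<in> Q \<longrightarrow> g1 z = g2 z"
proof -
  obtain K r where K: "0 < r" "compact K" "K \<subseteq> \<Omega>" "\<And>z. z \<in> Q \<Longrightarrow> cball z r \<subseteq> K"
    using compact_neighbourhood[OF Q(1) \<Omega>(1) Q(2)] by metis
  have "set_integrable lebesgue K g1" "set_integrable lebesgue K g2"
    using g K by (auto simp: has_weak_deriv_def locally_integrable_on_def)
  then obtain h1 h2 where h1: "integrable lborel h1" "AE z in lebesgue. z \<in> K \<longrightarrow> h1 z = g1 z"
    and h2: "integrable lborel h2" "AE z in lebesgue. z \<in> K \<longrightarrow> h2 z = g2 z"
    using borel_version_on by metis
  have [measurable]: "h1 \<in> borel_measurable borel" "h2 \<in> borel_measurable borel" using h1 h2 by auto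
  have QB [measurable]: "Q \<in> sets borel" using Q by (simp add: borel_compact)
  obtain N :: nat where N: "0 < N" "1 / real N < r"
    using nat_approx_posE[OF K(1)] by (metis zero_less_Suc)
  have eq: "moll n h1 z = moll n h2 z" if "n \<ge> N" "z \<in> Q" for n z
  proof -
    have n: "0 < n" using that N by simp
    have "1 / real n \<le> 1 / real N" using that N by (intro divide_left_mono) auto
    then have c: "cball z (1 / real n) \<subseteq> K" using K(4)[OF that(2)] N by force
    have c\<Omega>: "cball z (1 / real n) \<subseteq> \<Omega>" using c K(3) by blast
    have \<Omega>m: "\<Omega> \<in> sets lebesgue" using \<Omega>(1) by simp
    have "conv a b f (partials es (mollifier n)) z = moll n h1 z"
      by (rule conv_partials_mollifier[OF f n \<Omega>(2) c\<Omega> \<Omega>(3) g(1) h1(1) _ \<Omega>m])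
        (use h1(2) c in \<open>auto elim!: eventually_mono\<close>)
    moreover have "conv a b f (partials es (mollifier n)) z = moll n h2 z"
      by (rule conv_partials_mollifier[OF f n \<Omega>(2) c\<Omega> \<Omega>(3) g(2) h2(1) _ \<Omega>m])
        (use h2(2) c in \<open>auto elim!: eventually_mono\<close>)
    ultimately show ?thesis by simp
  qed
  have le: "(\<integral>\<^sup>+ z. ennreal \<bar>h1 z - h2 z\<bar> * indicator Q z \<partial>lborel)
    \<le> (\<integral>\<^sup>+ z. ennreal \<bar>moll n h1 z - h1 z\<bar> \<partial>lborel) + (\<integral>\<^sup>+ z. ennreal \<bar>moll n h2 z - h2 z\<bar> \<partial>lborel)"
    if "n \<ge> N" for n
  proof -
    have "(\<integral>\<^sup>+ z. ennreal \<bar>h1 z - h2 z\<bar> * indicator Q z \<partial>lborel)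
      \<le> (\<integral>\<^sup>+ z. ennreal \<bar>moll n h1 z - h1 z\<bar> + ennreal \<bar>moll n h2 z - h2 z\<bar> \<partial>lborel)"
    proof (intro nn_integral_mono)
      fix z
      show "ennreal \<bar>h1 z - h2 z\<bar> * indicator Q z \<le> ennreal \<bar>moll n h1 z - h1 z\<bar> + ennreal \<bar>moll n h2 z - h2 z\<bar>"
      proof (cases "z \<in> Q")
        case True
        have "h1 z - h2 z = - (moll n h1 z - h1 z) + (moll n h2 z - h2 z)" using eq[OF that True] by simp
        then have "ennreal \<bar>h1 z - h2 z\<bar> \<le> ennreal \<bar>- (moll n h1 z - h1 z)\<bar> + ennreal \<bar>moll n h2 z - h2 z\<bar>"
          using ennreal_abs_add_le[of "- (moll n h1 z - h1 z)" "moll n h2 z - h2 z"] by (simp only:)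
        then show ?thesis using True by (simp only: abs_minus_cancel indicator_simps mult_1_right)
      qed simp
    qed
    then show ?thesis by (simp add: nn_integral_add)
  qed
  have "(\<lambda>n. (\<integral>\<^sup>+ z. ennreal \<bar>moll n h1 z - h1 z\<bar> \<partial>lborel) + (\<integral>\<^sup>+ z. ennreal \<bar>moll n h2 z - h2 z\<bar> \<partial>lborel)) \<longlonglongrightarrow> 0 + 0"
    by (intro tendsto_add moll_tendsto_L1 h1 h2)
  then have "(\<integral>\<^sup>+ z. ennreal \<bar>h1 z - h2 z\<bar> * indicator Q z \<partial>lborel) \<le> 0 + 0"
    by (rule LIMSEQ_le_const) (use le in blast)
  then have "(\<integral>\<^sup>+ z. ennreal \<bar>h1 z - h2 z\<bar> * indicator Q z \<partial>lborel) = 0" by simp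
  then have "AE z in lborel. ennreal \<bar>h1 z - h2 z\<bar> * indicator Q z = 0"
    by (subst (asm) nn_integral_0_iff_AE) auto
  then have "AE z in lebesgue. ennreal \<bar>h1 z - h2 z\<bar> * indicator Q z = 0" by (rule AE_completion)
  moreover have QK: "z \<in> K" if "z \<in> Q" for z
    using K(1) subsetD[OF K(4)[OF that], of z] by simp
  ultimately show ?thesis
    using h1(2) h2(2)
  proof eventually_elim
    case (elim z)
    then show ?case using QK[of z] by (auto simp: indicator_def)
  qed
qed

section \<open>Determinants of positive semidefinite matrices\<close>

lemma quadratic_form_axis:
  fixes P :: "real^'n^'n"
  shows "axis i 1 \<bullet> (P *v axis j 1) = P $ i $ j"
  by (simp add: matrix_vector_mul_component inner_axis' inner_axis)

lemma psd_entry_le_trace: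
  fixes P :: "real^'n^'n"
  assumes psd: "nonneg_definite P" and sym: "transpose P = P"
  shows "\<bar>P $ i $ j\<bar> \<le> trace P"
proof -
  have d: "0 \<le> P $ k $ k" for k
    using psd quadratic_form_axis[of k P k] unfolding nonneg_definite_def by metis
  have tr: "P $ k $ k \<le> trace P" for k
    unfolding trace_def by (rule member_le_sum) (use d in auto)
  have s: "P $ j $ i = P $ i $ j"
    using arg_cong[OF sym, of "\<lambda>m. m $ i $ j"] by (simp add: transpose_def)
  have q: "0 \<le> P $ i $ i + c * c * P $ j $ j + 2 * c * P $ i $ j" for c
  proof -
    have "0 \<le> (axis i 1 + c *\<^sub>R axis j 1) \<bullet> (P *v (axis i 1 + c *\<^sub>R axis j 1))"
      using psd unfolding nonneg_definite_def by blast
    also have "\<dots> = P $ i $ i + c * P $ i $ j + c * P $ j $ i + c * c * P $ j $ j"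
      by (simp add: matrix_vector_right_distrib matrix_vector_mult_scaleR inner_add_left inner_add_right
          quadratic_form_axis algebra_simps)
    finally show ?thesis using s by simp
  qed
  show ?thesis using q[of 1] q[of "-1"] tr[of i] tr[of j] by simp
qed

lemma trace_nonneg: "nonneg_definite P \<Longrightarrow> 0 \<le> trace (P :: real^'n^'n)"
  unfolding trace_def nonneg_definite_def using quadratic_form_axis[of _ P]
  by (intro sum_nonneg) metis

text \<open>
  The Leibniz formula; the crude factor \<open>fact CARD('n)\<close> is harmless because only some constant is needed.
\<close>

lemma abs_det_le_entries:
  fixes P :: "real^'n^'n"
  assumes "\<And>i j. \<bar>P $ i $ j\<bar> \<le> b"
  shows "\<bar>det P\<bar> \<le> fact CARD('n) * b ^ CARD('n)"
proof -
  have "\<bar>det P\<bar> \<le> (\<Sum>p | p permutes (UNIV::'n set). \<bar>of_int (sign p) * (\<Prod>i\<in>UNIV. P $ i $ p i)\<bar>)"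
    unfolding det_def by (rule sum_abs)
  also have "\<dots> \<le> (\<Sum>p | p permutes (UNIV::'n set). b ^ CARD('n))"
  proof (rule sum_mono)
    fix p
    have "\<bar>\<Prod>i\<in>UNIV. P $ i $ p i\<bar> \<le> (\<Prod>i\<in>(UNIV::'n set). b)"
      unfolding abs_prod by (intro prod_mono) (simp add: assms)
    then show "\<bar>of_int (sign p) * (\<Prod>i\<in>UNIV. P $ i $ p i)\<bar> \<le> b ^ CARD('n)"
      by (simp add: abs_mult sign_def)
  qed
  also have "\<dots> = fact CARD('n) * b ^ CARD('n)"
    by (simp add: card_permutations)
  finally show ?thesis .
qed

lemma abs_det_le_trace_power:
  fixes P :: "real^'n^'n"
  assumes "nonneg_definite P" "transpose P = P"
  shows "\<bar>det P\<bar> \<le> fact CARD('n) * trace P ^ CARD('n)"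
  by (rule abs_det_le_entries[OF psd_entry_le_trace[OF assms]])

text \<open>
  A zero of a nonnegative quadratic form is a minimum, so the derivative there vanishes.
\<close>

lemma psd_kernel:
  fixes A :: "real^'n^'n"
  assumes psd: "nonneg_definite A" and sym: "transpose A = A" and 0: "\<xi> \<bullet> (A *v \<xi>) = 0"
  shows "A *v \<xi> = 0"
proof -
  define \<eta> where "\<eta> = A *v \<xi>"
  have sy: "\<xi> \<bullet> (A *v \<eta>) = \<eta> \<bullet> \<eta>"
    by (metis \<eta>_def dot_lmul_matrix sym transpose_matrix_vector vector_transpose_matrix)
  have q: "0 \<le> 2 * c * (\<eta> \<bullet> \<eta>) + c * c * (\<eta> \<bullet> (A *v \<eta>))" for c
  proof -
    have "0 \<le> (\<xi> + c *\<^sub>R \<eta>) \<bullet> (A *v (\<xi> + c *\<^sub>R \<eta>))"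
      using psd unfolding nonneg_definite_def by blast
    also have "\<dots> = \<xi> \<bullet> (A *v \<xi>) + c * (\<xi> \<bullet> (A *v \<eta>)) + c * (\<eta> \<bullet> (A *v \<xi>)) + c * c * (\<eta> \<bullet> (A *v \<eta>))"
      by (simp add: matrix_vector_right_distrib matrix_vector_mult_scaleR inner_add_left inner_add_right algebra_simps)
    finally show ?thesis using 0 sy by (simp add: \<eta>_def[symmetric])
  qed
  have B: "0 \<le> \<eta> \<bullet> (A *v \<eta>)" using psd unfolding nonneg_definite_def by blast
  define b where "b = \<eta> \<bullet> (A *v \<eta>)"
  define s where "s = \<eta> \<bullet> \<eta>"
  have s0: "0 \<le> s" by (simp add: s_def)
  have b0: "0 \<le> b" using B by (simp add: b_def)
  have "s = 0"
  proof (rule ccontr)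
    assume "s \<noteq> 0"
    then have sp: "0 < s" using s0 by simp
    define c where "c = s / (b + 1)"
    have c: "0 < c" using sp b0 by (simp add: c_def)
    have "0 \<le> (- c) * (2 * s - c * b)" using q[of "- c"] by (simp add: b_def s_def algebra_simps)
    then have "2 * s \<le> c * b" using c by (simp add: mult_le_0_iff zero_le_mult_iff)
    moreover have "c * b \<le> s" using sp b0 by (simp add: c_def field_simps)
    ultimately show False using sp by simp
  qed
  then show ?thesis by (simp add: s_def \<eta>_def)
qed

definition pos_definite :: "real^'n^'n \<Rightarrow> bool" where
  "pos_definite A \<longleftrightarrow> (\<forall>\<xi>. \<xi> \<noteq> 0 \<longrightarrow> 0 < \<xi> \<bullet> (A *v \<xi>))"

lemma psd_det_nonzero_imp_pos_definite:
  fixes A :: "real^'n^'n"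
  assumes "nonneg_definite A" "transpose A = A" "det A \<noteq> 0"
  shows "pos_definite A"
  unfolding pos_definite_def
proof (intro allI impI)
  fix \<xi> :: "real^'n" assume "\<xi> \<noteq> 0"
  have "A *v \<xi> \<noteq> 0"
    using \<open>\<xi> \<noteq> 0\<close> assms(3) by (metis invertible_det_nz invertible_left_inverse matrix_left_invertible_ker)
  then have "\<xi> \<bullet> (A *v \<xi>) \<noteq> 0" using psd_kernel[OF assms(1,2)] by blast
  then show "0 < \<xi> \<bullet> (A *v \<xi>)" using assms(1) unfolding nonneg_definite_def by (metis less_le)
qed

text \<open>
  Gram-Schmidt for the inner product given by \<open>A\<close>: as long as fewer than \<open>CARD('n)\<close> vectors have been chosen, their
  images under \<open>A\<close> do not span the space, and any vector orthogonal to these images can be added after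
  normalisation.
\<close>

lemma orthonormal_for_form:
  fixes A :: "real^'n^'n"
  assumes pd: "pos_definite A" and sym: "transpose A = A"
  shows "finite J \<Longrightarrow> card J \<le> CARD('n) \<Longrightarrow>
    \<exists>b :: 'k \<Rightarrow> real^'n. \<forall>i\<in>J. \<forall>j\<in>J. b i \<bullet> (A *v b j) = (if i = j then 1 else 0)"
proof (induction J rule: finite_induct)
  case (insert k J)
  then obtain b :: "'k \<Rightarrow> real^'n" where b: "\<And>i j. i \<in> J \<Longrightarrow> j \<in> J \<Longrightarrow> b i \<bullet> (A *v b j) = (if i = j then 1 else 0)"
    by auto
  have sy: "x \<bullet> (A *v y) = y \<bullet> (A *v x)" for x y
    by (metis dot_lmul_matrix inner_commute sym transpose_matrix_vector)
  have "dim ((\<lambda>i. A *v b i) ` J) < CARD('n)"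
    using insert by (intro le_less_trans[OF dim_le_card'] le_less_trans[OF card_image_le]) auto
  then have "span ((\<lambda>i. A *v b i) ` J) \<noteq> UNIV"
    by (metis dim_span dim_UNIV DIM_cart DIM_real mult.right_neutral less_irrefl)
  then obtain v where v: "v \<noteq> 0" "\<And>x. x \<in> span ((\<lambda>i. A *v b i) ` J) \<Longrightarrow> orthogonal v x"
    using span_not_UNIV_orthogonal[of "(\<lambda>i. A *v b i) ` J"] by (auto simp: orthogonal_def)
  define c where "c = v \<bullet> (A *v v)"
  have c: "0 < c" using pd v(1) by (simp add: pos_definite_def c_def)
  define b' where "b' = b(k := (1 / sqrt c) *\<^sub>R v)"
  have o: "v \<bullet> (A *v b i) = 0" if "i \<in> J" for i
    using v(2)[of "A *v b i"] that by (auto simp: orthogonal_def intro: span_base)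
  show ?case
  proof (intro exI[of _ b'] ballI)
    fix i j assume "i \<in> insert k J" "j \<in> insert k J"
    then show "b' i \<bullet> (A *v b' j) = (if i = j then 1 else 0)"
      using b o sy[of "b i" v] insert.hyps c
      by (auto simp: b'_def matrix_vector_mult_scaleR c_def[symmetric] real_div_sqrt divide_simps)
  qed
qed auto

lemma inner_transpose_mult: "x \<bullet> (transpose B *v y) = ((B::real^'n^'m) *v x) \<bullet> y"
  by (metis dot_lmul_matrix inner_commute transpose_matrix_vector)

lemma inner_mult_transpose: "x \<bullet> (C *v y) = (transpose (C::real^'n^'m) *v x) \<bullet> y"
  by (metis dot_lmul_matrix transpose_matrix_vector)

text \<open>
  If the columns of \<open>B\<close> are orthonormal for the form \<open>A\<close>, then \<open>transpose B ** A ** B\<close> is the identity, so \<open>C\<close> is the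
  inverse of \<open>B\<close>. This replaces the square root of \<open>A\<close> and avoids eigenvalues.
\<close>

lemma pos_definite_factor:
  fixes A :: "real^'n^'n"
  assumes pd: "pos_definite A" and sym: "transpose A = A"
  obtains C :: "real^'n^'n" where "A = transpose C ** C" "invertible C"
proof -
  obtain b :: "'n \<Rightarrow> real^'n" where b: "\<And>i j. b i \<bullet> (A *v b j) = (if i = j then 1 else 0)"
    using orthonormal_for_form[OF assms, of "UNIV :: 'n set"] by auto
  define B :: "real^'n^'n" where "B = (\<chi> i j. b j $ i)"
  have col: "B *v axis j 1 = b j" for j
    by (simp add: B_def matrix_vector_mult_basis column_def)
  have BAB: "transpose B ** A ** B = mat 1"
  proof -
    have "(transpose B ** A ** B) $ i $ j = (if i = j then 1 else 0)" for i j
    proof -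
      have "(transpose B ** A ** B) $ i $ j = axis i 1 \<bullet> ((transpose B ** A ** B) *v axis j 1)"
        by (rule quadratic_form_axis[symmetric])
      also have "\<dots> = (B *v axis i 1) \<bullet> (A *v (B *v axis j 1))"
        by (simp only: matrix_vector_mul_assoc[symmetric] inner_transpose_mult)
      finally show ?thesis using b col by simp
    qed
    then show ?thesis by (simp add: vec_eq_iff mat_def)
  qed
  have "invertible B"
    using BAB by (metis invertible_left_inverse)
  then obtain C where C: "B ** C = mat 1" "C ** B = mat 1"
    unfolding invertible_def by blast
  have t: "transpose C ** transpose B = mat 1"
    using C(1) by (metis matrix_transpose_mul transpose_mat)
  have "transpose C ** (transpose B ** A ** B) ** C = (transpose C ** transpose B) ** A ** (B ** C)"
    by (simp add: matrix_mul_assoc)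
  then have "transpose C ** C = A" using BAB t C by simp
  moreover have "invertible C" using C by (auto simp: invertible_def)
  ultimately show ?thesis using that by metis
qed

lemma psd_congruence:
  fixes H C :: "real^'n^'n"
  assumes "nonneg_definite H" "transpose H = H"
  shows "nonneg_definite (C ** H ** transpose C)" "transpose (C ** H ** transpose C) = C ** H ** transpose C"
proof -
  have "\<xi> \<bullet> ((C ** H ** transpose C) *v \<xi>) = (transpose C *v \<xi>) \<bullet> (H *v (transpose C *v \<xi>))" for \<xi>
    by (simp only: matrix_vector_mul_assoc[symmetric] inner_mult_transpose)
  then show "nonneg_definite (C ** H ** transpose C)"
    using assms(1) by (simp add: nonneg_definite_def)
  show "transpose (C ** H ** transpose C) = C ** H ** transpose C"
    by (simp add: matrix_transpose_mul assms(2) matrix_mul_assoc)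
qed

lemma trace_factor:
  fixes H C :: "real^'n^'n"
  shows "trace ((transpose C ** C) ** H) = trace (C ** H ** transpose C)"
proof -
  have "trace (transpose C ** C ** H) = trace (transpose C ** (C ** H))" by (simp only: matrix_mul_assoc)
  also have "\<dots> = trace (C ** H ** transpose C)" by (rule trace_mul_sym)
  finally show ?thesis .
qed

text \<open>
  Clear from the factorisation when \<open>A\<close> is definite; the general case follows by adding a small multiple of the
  identity.
\<close>

lemma trace_mult_psd_nonneg:
  fixes A H :: "real^'n^'n"
  assumes A: "nonneg_definite A" "transpose A = A" and H: "nonneg_definite H" "transpose H = H"
  shows "0 \<le> trace (A ** H)"
proof -
  have "0 \<le> trace (A ** H) + e * trace H" if "e > 0" for e
  proof -
    define E :: "real^'n^'n" where "E = A + e *\<^sub>R mat 1"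
    have Ev: "E *v x = A *v x + e *\<^sub>R x" for x
      by (simp add: E_def matrix_vector_mult_add_rdistrib scaleR_matrix_vector_assoc[symmetric])
    have "pos_definite E"
      unfolding pos_definite_def Ev
    proof (intro allI impI)
      fix x :: "real^'n" assume "x \<noteq> 0"
      then have "0 < e * (x \<bullet> x)" using that by simp
      moreover have "0 \<le> x \<bullet> (A *v x)" using A by (simp add: nonneg_definite_def)
      ultimately show "0 < x \<bullet> (A *v x + e *\<^sub>R x)" by (simp add: inner_add_right)
    qed
    moreover have "transpose E = E"
      using A(2) by (simp add: E_def transpose_def vec_eq_iff mat_def) 
    ultimately obtain C :: "real^'n^'n" where C: "E = transpose C ** C" using pos_definite_factor by metis
    have "trace (A ** H) + e * trace H = trace (E ** H)"
    proof -
      have "E ** H = A ** H + e *\<^sub>R H"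
        by (simp add: E_def vec_eq_iff matrix_matrix_mult_def mat_def ring_distribs sum.distrib sum_distrib_left
            if_distrib[of "\<lambda>x. x * _"] if_distrib[of "\<lambda>x. _ * x"] cong: if_cong)
      then show ?thesis by (simp add: trace_def sum.distrib sum_distrib_left)
    qed
    also have "\<dots> = trace (C ** H ** transpose C)" by (simp add: C trace_factor)
    also have "\<dots> \<ge> 0" by (intro trace_nonneg psd_congruence H)
    finally show ?thesis .
  qed
  then have "- trace (A ** H) \<le> e * trace H" if "e > 0" for e using that by fastforce
  moreover have "((\<lambda>e. e * trace H) \<longlongrightarrow> 0 * trace H) (at_right 0)"
    by (intro tendsto_intros)
  ultimately have "- trace (A ** H) \<le> 0 * trace H"
    by (intro tendsto_lowerbound[of _ _ "at_right 0"]) (auto simp: eventually_at_right_less intro: eventually_mono[OF eventually_at_right_less])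
  then show ?thesis by simp
qed

text \<open>
  A non-sharp form of the inequality between geometric and arithmetic means. After factoring \<open>A\<close>, the product of the
  determinants is the determinant of a single semidefinite matrix, whose entries are at most its trace.
\<close>

lemma det_mult_le_trace_power:
  fixes A H :: "real^'n^'n"
  assumes A: "nonneg_definite A" "transpose A = A" and H: "nonneg_definite H" "transpose H = H"
  shows "\<bar>det A * det H\<bar> \<le> fact CARD('n) * trace (A ** H) ^ CARD('n)"
proof (cases "det A = 0")
  case False
  obtain C :: "real^'n^'n" where C: "A = transpose C ** C"
    using pos_definite_factor[OF psd_det_nonzero_imp_pos_definite[OF A False] A(2)] by metis
  have "det A * det H = det (C ** H ** transpose C)" by (simp add: C det_mul algebra_simps)
  then show ?thesis
    using abs_det_le_trace_power[OF psd_congruence[OF H, of C]] by (simp add: C trace_factor)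
next
  case True
  then show ?thesis using trace_mult_psd_nonneg[OF A H] by simp
qed

lemma trace_mult_psd_eq_0:
  fixes A H :: "real^'n^'n"
  assumes A: "nonneg_definite A" "transpose A = A" and H: "nonneg_definite H" "transpose H = H"
    and 0: "trace (A ** H) = 0" and tr: "trace A \<noteq> 0"
  shows "det H = 0"
proof (rule ccontr)
  assume "det H \<noteq> 0"
  then obtain C :: "real^'n^'n" where C: "H = transpose C ** C" "invertible C"
    using pos_definite_factor[OF psd_det_nonzero_imp_pos_definite[OF H] H(2)] by metis
  have "trace (C ** A ** transpose C) = trace (H ** A)" by (simp add: C trace_factor)
  also have "\<dots> = 0" using 0 trace_mul_sym by metis
  finally have "\<bar>(C ** A ** transpose C) $ i $ j\<bar> \<le> 0" for i j
    using psd_entry_le_trace[OF psd_congruence[OF A, of C], of i j] by simp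
  then have z: "C ** A ** transpose C = 0" by (simp add: vec_eq_iff)
  obtain D where D: "C ** D = mat 1" "D ** C = mat 1" using C(2) by (auto simp: invertible_def)
  have "transpose C ** transpose D = mat 1" using D(2) by (metis matrix_transpose_mul transpose_mat)
  moreover have "D ** (C ** A ** transpose C) ** transpose D = (D ** C) ** A ** (transpose C ** transpose D)"
    by (simp only: matrix_mul_assoc)
  ultimately have "A = D ** (C ** A ** transpose C) ** transpose D"
    using D(2) by simp
  then have "A = 0" using z by simp
  then show False using tr by (simp add: trace_def)
qed

lemma abs_det_uminus: "\<bar>det (- A)\<bar> = \<bar>det (A :: real^'n^'n)\<bar>"
proof -
  have "- A = (- mat 1) ** A"
    by (metis matrix_mul_lid scalar_matrix_assoc scaleR_minus1_left)
  then have "det (- A) = det (- mat 1 :: real^'n^'n) * det A" by (simp add: det_mul)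
  moreover have "\<bar>det (- mat 1 :: real^'n^'n)\<bar> = 1"
    by (subst det_diagonal) (auto simp: mat_def abs_prod)
  ultimately show ?thesis by (simp add: abs_mult)
qed

text \<open>
  The inequality behind the right-hand side of the estimate: \<open>r * \<bar>\<tau>\<bar>\<close> and the trace of \<open>A ** (- D)\<close> are
  both nonnegative with sum \<open>\<bar>F\<bar>\<close>. When the denominator is 0 and \<open>F < 0\<close> the right-hand side is infinite; when
  \<open>F = 0\<close> both summands vanish, and since \<open>r\<close> and \<open>trace A\<close> are not both 0, either \<open>\<tau>\<close> or the determinant is 0.
\<close>

lemma abs_det_le_quotient:
  fixes A D :: "real^'n^'n"
  assumes A: "nonneg_definite A" "transpose A = A" and r: "0 \<le> r" "0 < r + trace A"
    and D: "nonneg_definite (- D)" "transpose D = D" and \<tau>: "\<tau> \<le> 0"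
    and F: "F = r * \<tau> + (\<Sum>i\<in>UNIV. \<Sum>j\<in>UNIV. A $ i $ j * D $ i $ j)"
  shows "ennreal \<bar>\<tau> * det D\<bar> \<le> ennreal (fact CARD('n)) *
    (ennreal (indicator {z. F < 0} z * \<bar>F\<bar> ^ (CARD('n) + 1)) / ennreal (r * det A))"
proof -
  define H where "H = - D"
  have H: "nonneg_definite H" "transpose H = H" using D by (auto simp: H_def transpose_def vec_eq_iff)
  have dH: "\<bar>det D\<bar> = \<bar>det H\<bar>" by (simp add: H_def abs_det_uminus)
  have sH: "H $ j $ i = H $ i $ j" for i j
    using arg_cong[OF H(2), of "\<lambda>m. m $ i $ j"] by (simp add: transpose_def)
  have "trace (A ** H) = (\<Sum>i\<in>UNIV. \<Sum>j\<in>UNIV. A $ i $ j * H $ j $ i)"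
    by (simp add: trace_def matrix_matrix_mult_def)
  also have "\<dots> = (\<Sum>i\<in>UNIV. \<Sum>j\<in>UNIV. A $ i $ j * H $ i $ j)"
    by (intro sum.cong refl arg_cong2[where f="(*)"] sH)
  also have "\<dots> = - (\<Sum>i\<in>UNIV. \<Sum>j\<in>UNIV. A $ i $ j * D $ i $ j)"
    by (simp add: H_def sum_negf)
  finally have F': "F = - (r * \<bar>\<tau>\<bar> + trace (A ** H))" using F \<tau> by simp
  have tn: "0 \<le> trace (A ** H)" by (rule trace_mult_psd_nonneg[OF A H])
  have rn: "0 \<le> r * \<bar>\<tau>\<bar>" using r by simp
  define X where "X = \<bar>F\<bar> ^ (CARD('n) + 1)"
  have X: "0 \<le> X" "F < 0 \<Longrightarrow> 0 < X" by (simp_all add: X_def del: power_Suc power_add)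
  consider "F < 0" "r * det A \<le> 0" | "F < 0" "0 < r * det A" | "F = 0" using F' tn rn by linarith
  then show ?thesis
  proof cases
    case 1
    have "ennreal (r * det A) = 0" using 1 by (simp add: ennreal_neg)
    moreover have "ennreal (indicator {z. F < 0} z * X) = ennreal X" "ennreal X \<noteq> 0"
      using 1 X(2) by simp_all
    ultimately show ?thesis
      unfolding X_def[symmetric] by (simp add: ennreal_divide_zero ennreal_mult_top)
  next
    case 3
    then have z: "r * \<bar>\<tau>\<bar> = 0" "trace (A ** H) = 0" using F' tn rn by linarith+
    have "\<tau> * det D = 0"
    proof (cases "\<tau> = 0")
      case False
      then have "r = 0" using z by simp
      then have "det H = 0" using trace_mult_psd_eq_0[OF A H z(2)] r by simp
      then show ?thesis using dH by simp
    qed simp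
    then show ?thesis by (simp only: abs_zero ennreal_0 zero_le)
  next
    case 2
    have "\<bar>\<tau> * det D\<bar> * (r * det A) \<le> (r * \<bar>\<tau>\<bar>) * \<bar>det A * det H\<bar>"
    proof -
      have "\<bar>\<tau> * det D\<bar> * (r * det A) = (r * (\<bar>\<tau>\<bar> * \<bar>det H\<bar>)) * det A"
        using dH by (simp add: abs_mult mult_ac)
      also have "\<dots> \<le> (r * (\<bar>\<tau>\<bar> * \<bar>det H\<bar>)) * \<bar>det A\<bar>"
        using r by (intro mult_left_mono) auto
      finally show ?thesis by (simp add: abs_mult mult_ac)
    qed
    also have "\<dots> \<le> \<bar>F\<bar> * (fact CARD('n) * \<bar>F\<bar> ^ CARD('n))"
    proof (intro mult_mono order_trans[OF det_mult_le_trace_power[OF A H]])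
      show "trace (A ** H) ^ CARD('n) \<le> \<bar>F\<bar> ^ CARD('n)"
        using F' tn rn by (intro power_mono) auto
    qed (use F' tn rn in auto)
    also have "\<dots> = fact CARD('n) * X" by (simp add: X_def)
    finally have "\<bar>\<tau> * det D\<bar> \<le> fact CARD('n) * (X / (r * det A))"
      using 2 by (simp add: pos_le_divide_eq)
    then have "ennreal \<bar>\<tau> * det D\<bar> \<le> ennreal (fact CARD('n) * (X / (r * det A)))"
      by (rule ennreal_leI)
    also have "\<dots> = ennreal (fact CARD('n)) * ennreal (X / (r * det A))"
      using 2 X by (intro ennreal_mult divide_nonneg_pos) auto
    also have "ennreal (X / (r * det A)) = ennreal X / ennreal (r * det A)"
      using 2 X by (intro divide_ennreal[symmetric]) auto
    also have "ennreal X = ennreal (indicator {z. F < 0} z * \<bar>F\<bar> ^ (CARD('n) + 1))"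
      using 2 by (simp add: X_def)
    finally show ?thesis .
  qed
qed

section \<open>The area inequality for the Legendre map\<close>

text \<open>
  An index type for the \<open>d + 1\<close> coordinates of space-time. The change of variables theorems are stated for
  vectors over well-ordered finite index types, so the type is ordered by an arbitrary enumeration of the
  spatial indices.
\<close>

datatype 'n st = Time | Space 'n

lemma UNIV_st: "UNIV = insert Time (range Space)"
  using st.exhaust by auto

lemma inj_Space: "inj Space"
  by (simp add: inj_on_def)

instance st :: (finite) finite
  by standard (simp add: UNIV_st)

primrec st_rank :: "'n::finite st \<Rightarrow> nat" where
  "st_rank Time = 0"
| "st_rank (Space i) = Suc (to_nat i)"

lemma st_rank_inject: "st_rank x = st_rank y \<longleftrightarrow> x = y"
  by (cases x; cases y) auto

instantiation st :: (finite) linorder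
begin
definition "x \<le> y \<longleftrightarrow> st_rank x \<le> st_rank y"
definition "x < y \<longleftrightarrow> st_rank x < st_rank y"
instance by standard (auto simp: less_eq_st_def less_st_def st_rank_inject)
end

instance st :: (finite) wellorder
proof
  fix P :: "'a st \<Rightarrow> bool" and x
  assume step: "\<And>x. (\<And>y. y < x \<Longrightarrow> P y) \<Longrightarrow> P x"
  show "P x"
    by (induction x rule: measure_induct_rule[of st_rank]) (auto intro: step simp: less_st_def)
qed

lemma sum_st: "(\<Sum>x\<in>UNIV. f x) = f Time + (\<Sum>i\<in>UNIV. f (Space (i::'n::finite)))"
  by (simp add: UNIV_st sum.reindex inj_Space image_iff)

lemma prod_st: "(\<Prod>x\<in>UNIV. f x) = f Time * (\<Prod>i\<in>UNIV. f (Space (i::'n::finite)))"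
  by (simp add: UNIV_st prod.reindex inj_Space image_iff)

text \<open>
  Only permutations that fix \<open>Time\<close> contribute, and these are the permutations of the spatial indices.
\<close>

lemma det_st_block:
  fixes M :: "real^'n::finite st^'n st"
  assumes 0: "\<And>j. M $ Time $ Space j = 0"
  shows "det M = M $ Time $ Time * det (\<chi> i j. M $ Space i $ Space j)"
proof -
  let ?t = "\<lambda>p. of_int (sign p) * (\<Prod>i\<in>UNIV. M $ i $ p i)"
  have bij: "bij_betw Space UNIV (range (Space :: 'n \<Rightarrow> _))"
    by (simp add: bij_betw_def inj_Space)
  have bij': "bij_betw (inv Space) (range (Space :: 'n \<Rightarrow> _)) UNIV"
    using bij_betw_inv_into[OF bij] .
  have "det M = (\<Sum>p | p permutes UNIV. ?t p)" by (simp add: det_def)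
  also have "\<dots> = (\<Sum>p | p permutes range (Space :: 'n \<Rightarrow> 'n st). ?t p)"
  proof (rule sum.mono_neutral_right)
    show "finite {p. p permutes (UNIV :: 'n st set)}" by (simp add: finite_permutations)
    show "{p. p permutes range (Space :: 'n \<Rightarrow> 'n st)} \<subseteq> {p. p permutes UNIV}"
      by (intro Collect_mono impI) (rule permutes_subset[OF _ subset_UNIV])
    show "\<forall>p\<in>{p. p permutes UNIV} - {p. p permutes range (Space :: 'n \<Rightarrow> 'n st)}. ?t p = 0"
    proof
      fix p assume p: "p \<in> {p. p permutes UNIV} - {p :: 'n st \<Rightarrow> 'n st. p permutes range Space}"
      have "p Time \<noteq> Time"
      proof
        assume "p Time = Time"
        then have "p permutes (UNIV - {Time})"
          using p by (rule_tac permutes_superset[of p UNIV]) auto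
        moreover have "UNIV - {Time} = range (Space :: 'n \<Rightarrow> _)" by (auto simp: UNIV_st)
        ultimately show False using p by simp
      qed
      then obtain j where "p Time = Space j" using st.exhaust by blast
      then show "?t p = 0" using 0 by (simp add: prod_st)
    qed
  qed
  also have "\<dots> = (\<Sum>q | q permutes (UNIV :: 'n set). M $ Time $ Time * (of_int (sign q) * (\<Prod>i\<in>UNIV. M $ Space i $ Space (q i))))"
  proof (rule sum.reindex_bij_witness[where i = "map_permutation UNIV Space" and j = "map_permutation (range Space) (inv Space)"])
    fix p assume p: "p \<in> {p. p permutes range (Space :: 'n \<Rightarrow> _)}"
    let ?q = "map_permutation (range Space) (inv Space) p"
    show pq: "map_permutation UNIV Space ?q = p"
      by (rule map_permutation_compose_inv[OF bij']) (use p in \<open>auto simp: inj_Space\<close>)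
    show q: "?q \<in> {q. q permutes UNIV}"
      using map_permutation_permutes[OF bij'] p by auto
    have "sign p = sign ?q"
      using sign_map_permutation[OF inj_Space, of ?q] q by (simp add: pq)
    moreover have "p (Space i) = Space (?q i)" for i
      using map_permutation_apply[OF inj_Space, of i ?q] by (simp add: pq)
    moreover have "p Time = Time" using p by (auto simp: permutes_def)
    ultimately show "M $ Time $ Time * (of_int (sign ?q) * (\<Prod>i\<in>UNIV. M $ Space i $ Space (?q i))) = ?t p"
      by (simp add: prod_st)
  next
    fix q assume q: "q \<in> {q. q permutes (UNIV :: 'n set)}"
    show "map_permutation (range Space) (inv Space) (map_permutation UNIV Space q) = q"
      by (rule map_permutation_compose_inv[OF bij]) (use q in \<open>auto simp: inj_Space\<close>)
    show "map_permutation UNIV Space q \<in> {p. p permutes range Space}"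
      using map_permutation_permutes[OF bij] q by auto
  qed
  also have "\<dots> = M $ Time $ Time * det (\<chi> i j. M $ Space i $ Space j)"
    by (simp add: det_def sum_distrib_left)
  finally show ?thesis .
qed

definition to_st :: "real \<times> (real^'n) \<Rightarrow> real^'n::finite st" where
  "to_st z = (\<chi> k. case k of Time \<Rightarrow> fst z | Space i \<Rightarrow> snd z $ i)"

definition of_st :: "real^'n::finite st \<Rightarrow> real \<times> (real^'n)" where
  "of_st w = (w $ Time, \<chi> i. w $ Space i)"

lemma to_st_nth [simp]: "to_st z $ Time = fst z" "to_st z $ Space i = snd z $ i"
  by (simp_all add: to_st_def)

lemma of_to_st [simp]: "of_st (to_st z) = z" 
  by (simp add: of_st_def prod_eq_iff vec_eq_iff)

lemma to_of_st [simp]: "to_st (of_st w) = w"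
  by (simp add: vec_eq_iff to_st_def of_st_def split: st.splits)

lemma linear_to_st: "linear to_st"
  by (rule linearI) (auto simp: vec_eq_iff to_st_def split: st.splits)

lemma linear_of_st: "linear of_st"
  by (rule linearI) (auto simp: vec_eq_iff of_st_def)

lemma inner_to_st: "w \<bullet> to_st z = of_st w \<bullet> z"
  by (simp add: inner_vec_def sum_st of_st_def inner_prod_def)

lemma to_st_axis: "to_st (1, 0) = axis Time 1" "to_st (0, axis i 1) = axis (Space i) 1"
  by (auto simp: vec_eq_iff to_st_def axis_def split: st.splits)

lemma Basis_vec_axis: "(Basis :: (real^'k) set) = range (\<lambda>i. axis i 1)"
  by (auto simp: Basis_vec_def)

lemma to_st_Basis: "to_st ` (Basis :: (real \<times> (real^'n::finite)) set) = Basis"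
proof -
  have "(Basis :: (real \<times> (real^'n)) set) = insert (1, 0) (range (\<lambda>i. (0, axis i 1)))"
    by (auto simp: Basis_prod_def Basis_vec_axis)
  then have "to_st ` (Basis :: (real \<times> (real^'n)) set) = to_st ` insert (1, 0) (range (\<lambda>i. (0, axis i 1)))"
    by (rule arg_cong)
  also have "\<dots> = insert (axis Time 1) (range (\<lambda>i. axis (Space i) 1))"
    unfolding image_insert image_image to_st_axis by (rule refl)
  also have "\<dots> = Basis" by (auto simp: Basis_vec_axis UNIV_st)
  finally show ?thesis .
qed

lemma continuous_to_st [continuous_intros]: "continuous_on S to_st"
  using linear_continuous_on[OF linear_conv_bounded_linear[THEN iffD1, OF linear_to_st]] .

lemma continuous_of_st [continuous_intros]: "continuous_on S of_st"
  using linear_continuous_on[OF linear_conv_bounded_linear[THEN iffD1, OF linear_of_st]] .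

lemma to_st_measurable [measurable]: "to_st \<in> borel_measurable borel"
  by (intro borel_measurable_continuous_onI continuous_to_st)

text \<open>
  \<open>to_st\<close> is a linear isometry that maps the basis to the basis, so it maps boxes to boxes of the same volume.
\<close>

lemma lborel_to_st: "distr lborel borel to_st = (lborel :: (real^'n::finite st) measure)"
proof (rule lborel_eqI[symmetric])
  fix l u :: "real^'n st" assume lu: "\<And>b. b \<in> Basis \<Longrightarrow> l \<bullet> b \<le> u \<bullet> b"
  have inj: "inj_on to_st (Basis :: (real \<times> (real^'n)) set)"
    by (metis inj_on_inverseI of_to_st)
  have le: "of_st l \<bullet> a \<le> of_st u \<bullet> a" if "a \<in> Basis" for a
    using lu[of "to_st a"] that to_st_Basis by (auto simp: inner_to_st)
  have "to_st -` box l u = box (of_st l) (of_st u)"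
    unfolding box_def by (subst to_st_Basis[symmetric])
      (auto simp: inner_to_st inner_commute[of "to_st _" "to_st _"])
  then have "emeasure (distr lborel borel to_st) (box l u) = emeasure lborel (box (of_st l) (of_st u))"
    by (simp add: emeasure_distr)
  also have "\<dots> = (\<Prod>a\<in>Basis. (of_st u - of_st l) \<bullet> a)"
    by (rule emeasure_lborel_box) (rule le)
  also have "\<dots> = (\<Prod>a\<in>Basis. (u - l) \<bullet> to_st a)"
    by (simp add: inner_to_st linear_diff[OF linear_of_st])
  also have "\<dots> = (\<Prod>b\<in>Basis. (u - l) \<bullet> b)"
    by (subst to_st_Basis[symmetric]) (simp add: prod.reindex[OF inj])
  finally show "emeasure (distr lborel borel to_st) (box l u) = (\<Prod>b\<in>Basis. (u - l) \<bullet> b)" .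
qed simp

text \<open>
  Adding multiples of the spatial rows to the \<open>Time\<close> row removes the entries produced by the term \<open>(x - x0) \<bullet> Dv\<close>;
  what remains is block triangular, and the mixed derivatives \<open>c\<close> drop out.
\<close>

lemma det_legendre_matrix:
  fixes H :: "real^'n^'n::finite"
  assumes M: "M $ Time $ Time = \<tau> - y \<bullet> c" "\<And>j. M $ Time $ Space j = - (\<Sum>k\<in>UNIV. y $ k * H $ k $ j)"
    "\<And>i. M $ Space i $ Time = c $ i" "\<And>i j. M $ Space i $ Space j = H $ i $ j"
  shows "det (M :: real^'n st^'n st) = \<tau> * det H"
proof -
  define M' :: "real^'n st^'n st" where
    "M' = (\<chi> k l. case k of Time \<Rightarrow> (case l of Time \<Rightarrow> \<tau> | Space j \<Rightarrow> 0) | Space i \<Rightarrow> M $ Space i $ l)"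
  define x where "x = (\<Sum>k\<in>UNIV. (- y $ k) *\<^sub>R row (Space k) M')"
  have "x \<in> vec.span {row j M' |j. j \<noteq> Time}"
    unfolding x_def scalar_mult_eq_scaleR[symmetric]
    by (intro vec.span_sum vec.span_scale vec.span_base) auto
  then have "det (\<chi> k. if k = Time then row Time M' + x else row k M') = det M'"
    by (rule det_row_span)
  also have "(\<chi> k. if k = Time then row Time M' + x else row k M') = M"
  proof -
    have "(if k = Time then row Time M' + x else row k M') $ l = M $ k $ l" for k l
      by (cases k; cases l) (simp_all add: row_def x_def M'_def M inner_vec_def sum_negf)
    then show ?thesis by (simp add: vec_eq_iff)
  qed
  also have "det M' = M' $ Time $ Time * det (\<chi> i j. M' $ Space i $ Space j)"
    by (rule det_st_block) (simp add: M'_def)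
  also have "\<dots> = \<tau> * det H" by (simp add: M'_def M)
  finally show ?thesis .
qed

text \<open>
  The map sends a point to the tangent plane of \<open>v\<close> there, described by its value at \<open>x0\<close> and its slope. By the
  row operation above its Jacobian determinant is \<open>\<tau> z * det (H z)\<close>, so this is the change of variables inequality,
  transported to vectors over the index type of space-time.
\<close>

theorem measure_legendre_image_le:
  fixes v :: "real \<times> (real^'n) \<Rightarrow> real" and g :: "real \<times> (real^'n) \<Rightarrow> real^'n"
  assumes S: "compact S"
    and v: "\<And>z. z \<in> S \<Longrightarrow> (v has_derivative (\<lambda>h. \<tau> z * fst h + g z \<bullet> snd h)) (at z)"
    and g: "\<And>z. z \<in> S \<Longrightarrow> (g has_derivative (\<lambda>h. fst h *\<^sub>R c z + H z *v snd h)) (at z)"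
    and \<tau>: "continuous_on S \<tau>" and H: "continuous_on S H"
  shows "emeasure lborel ((\<lambda>z. (v z - (snd z - x0) \<bullet> g z, g z)) ` S)
    \<le> (\<integral>\<^sup>+ z. ennreal \<bar>\<tau> z * det (H z)\<bar> * indicator S z \<partial>lborel)"
proof -
  define \<Phi> where "\<Phi> z = (v z - (snd z - x0) \<bullet> g z, g z)" for z
  define \<Phi>' where "\<Phi>' z h = (\<tau> z * fst h - (snd z - x0) \<bullet> (fst h *\<^sub>R c z + H z *v snd h),
      fst h *\<^sub>R c z + H z *v snd h)" for z h
  have d\<Phi>: "(\<Phi> has_derivative \<Phi>' z) (at z)" if "z \<in> S" for z
    unfolding \<Phi>_def[abs_def] \<Phi>'_def
    by (rule derivative_eq_intros v[OF that] g[OF that] refl)+ (simp add: algebra_simps inner_commute)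
  define F where "F w = to_st (\<Phi> (of_st w))" for w
  define F' where "F' w k = to_st (\<Phi>' (of_st w) (of_st k))" for w k
  define S' where "S' = to_st ` S"
  have of_S': "of_st w \<in> S" if "w \<in> S'" for w using that by (auto simp: S'_def)
  have S': "compact S'" unfolding S'_def by (intro compact_continuous_image continuous_to_st S)
  have dF: "(F has_derivative F' w) (at w within S')" if "w \<in> S'" for w
  proof -
    have "((\<lambda>w. \<Phi> (of_st w)) has_derivative (\<lambda>k. \<Phi>' (of_st w) (of_st k))) (at w)"
      using has_derivative_compose[OF linear_imp_has_derivative[OF linear_of_st] d\<Phi>[OF of_S'[OF that]]] .
    from has_derivative_compose[OF this linear_imp_has_derivative[OF linear_to_st]]
    show ?thesis unfolding F_def[abs_def] F'_def by (rule has_derivative_at_withinI)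
  qed
  have det: "det (matrix (F' w)) = \<tau> (of_st w) * det (H (of_st w))" for w
  proof (rule det_legendre_matrix)
    have a: "of_st (axis Time 1) = (1, 0)" "of_st (axis (Space j) 1) = (0, axis j 1)" for j
      by (simp_all flip: to_st_axis)
    let ?y = "snd (of_st w) - x0"
    show "matrix (F' w) $ Time $ Time = \<tau> (of_st w) - ?y \<bullet> c (of_st w)"
      by (simp add: matrix_def F'_def a \<Phi>'_def)
    show "matrix (F' w) $ Space i $ Time = c (of_st w) $ i" for i
      by (simp add: matrix_def F'_def a \<Phi>'_def)
    show "matrix (F' w) $ Space i $ Space j = H (of_st w) $ i $ j" for i j
      by (simp add: matrix_def F'_def a \<Phi>'_def matrix_vector_mult_basis column_def)
    show "matrix (F' w) $ Time $ Space j = - (\<Sum>k\<in>UNIV. ?y $ k * H (of_st w) $ k $ j)" for j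
      by (simp add: matrix_def F'_def a \<Phi>'_def matrix_vector_mult_basis column_def inner_vec_def)
  qed
  define k where "k z = \<bar>\<tau> z * det (H z)\<bar>" for z
  have kc: "continuous_on S k"
    unfolding k_def det_def
    by (intro continuous_intros \<tau> H)
  have k'c: "continuous_on S' (\<lambda>w. k (of_st w))"
    by (rule continuous_on_compose2[OF kc continuous_of_st]) (auto simp: of_S')
  have int: "set_integrable lborel S' (\<lambda>w. k (of_st w))"
    unfolding set_integrable_def by (rule borel_integrable_compact[OF S' k'c])
  have "F ` S' \<in> lmeasurable \<and> measure lebesgue (F ` S') \<le> integral S' (\<lambda>w. \<bar>det (matrix (F' w))\<bar>)"
  proof
    have L: "S' \<in> sets lebesgue" using S' by (simp add: borel_compact)
    have I: "(\<lambda>w. \<bar>det (matrix (F' w))\<bar>) integrable_on S'"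
      using set_borel_integral_eq_integral(1)[OF int] by (simp add: det k_def)
    show "F ` S' \<in> lmeasurable" by (rule measurable_differentiable_image[OF L dF I])
    show "measure lebesgue (F ` S') \<le> integral S' (\<lambda>w. \<bar>det (matrix (F' w))\<bar>)"
      by (rule measure_differentiable_image[OF L dF I])
  qed
  then have le: "emeasure lebesgue (F ` S') \<le> ennreal (integral S' (\<lambda>w. k (of_st w)))"
    by (simp add: det k_def emeasure_eq_measure2 ennreal_leI)
  have "continuous_on S \<Phi>"
    using d\<Phi> has_derivative_continuous continuous_at_imp_continuous_on by blast
  then have cP: "compact (\<Phi> ` S)" using S by (rule compact_continuous_image)
  have cF: "compact (to_st ` \<Phi> ` S)" by (rule compact_continuous_image[OF continuous_to_st cP])
  have FS: "F ` S' = to_st ` \<Phi> ` S" by (auto simp: F_def S'_def image_image)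
  have inj: "inj to_st" by (metis inj_on_inverseI of_to_st)
  have "emeasure lborel (\<Phi> ` S) = emeasure lborel (to_st -` (to_st ` \<Phi> ` S))"
    by (simp add: inj_vimage_image_eq inj)
  also have "\<dots> = emeasure (distr lborel borel to_st) (to_st ` \<Phi> ` S)"
    using cF by (subst emeasure_distr) (auto simp: borel_compact)
  also have "\<dots> = emeasure lebesgue (F ` S')"
    using cF by (simp add: lborel_to_st FS borel_compact)
  also have "\<dots> \<le> ennreal (integral S' (\<lambda>w. k (of_st w)))" by (rule le)
  also have "\<dots> = ennreal (LINT w|lborel. indicator S' w * k (of_st w))"
    using set_borel_integral_eq_integral(2)[OF int] by (simp add: set_lebesgue_integral_def)
  also have "\<dots> = (\<integral>\<^sup>+ w. ennreal (indicator S' w * k (of_st w)) \<partial>lborel)"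
    using int by (subst nn_integral_eq_integral) (auto simp: set_integrable_def k_def)
  also have "\<dots> = (\<integral>\<^sup>+ w. ennreal (indicator S' w * k (of_st w)) \<partial>distr lborel borel to_st)"
    by (simp add: lborel_to_st)
  also have "\<dots> = (\<integral>\<^sup>+ z. ennreal (indicator S' (to_st z) * k (of_st (to_st z))) \<partial>lborel)"
    using int by (subst nn_integral_distr) (auto simp: set_integrable_def)
  also have "\<dots> = (\<integral>\<^sup>+ z. ennreal (k z) * indicator S z \<partial>lborel)"
    by (intro nn_integral_cong) (auto simp: indicator_def S'_def inj_image_mem_iff[OF inj])
  finally show ?thesis by (simp add: \<Phi>_def[abs_def] k_def)
qed

section \<open>Touching planes\<close>

lemma has_derivative_along_line:
  fixes f :: "'a::real_normed_vector \<Rightarrow> real"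
  assumes "(f has_derivative f') (at (z + s *\<^sub>R e))"
  shows "((\<lambda>s. f (z + s *\<^sub>R e)) has_real_derivative f' e) (at s)"
proof -
  have "((\<lambda>s. z + s *\<^sub>R e) has_derivative (\<lambda>h. h *\<^sub>R e)) (at s)"
    by (auto intro!: derivative_eq_intros)
  from has_derivative_compose[OF this assms]
  have "((\<lambda>s. f (z + s *\<^sub>R e)) has_derivative (\<lambda>h. f' (h *\<^sub>R e))) (at s)" .
  then show ?thesis
    using linear_cmul[OF has_derivative_linear[OF assms]]
    by (simp add: has_field_derivative_def mult_commute_abs)
qed

text \<open>
  At the last time when \<open>v\<close> still reaches the plane, the spatial maximum of the difference is 0 and is attained in
  the interior, which gives the first and second order conditions in space. After this time the difference is
  negative, hence the sign of the time derivative.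
\<close>

theorem contact_point:
  fixes v :: "real \<times> (real^'n) \<Rightarrow> real" and g :: "real \<times> (real^'n) \<Rightarrow> real^'n"
  assumes vd: "\<And>z. (v has_derivative (\<lambda>h. \<tau> z * fst h + g z \<bullet> snd h)) (at z)"
    and gd: "\<And>z. (g has_derivative (\<lambda>h. fst h *\<^sub>R c z + H z *v snd h)) (at z)"
    and T: "t0 \<le> T1" and x0: "x0 \<in> cball 0 R"
    and above: "v0 < v (t0, x0)"
    and top: "\<And>x. x \<in> cball 0 R \<Longrightarrow> v (T1, x) < v0 + p \<bullet> (x - x0)"
    and side: "\<And>t x. t \<in> {t0..T1} \<Longrightarrow> x \<in> cball 0 R \<Longrightarrow> norm x = R \<or> psi x \<le> \<kappa> \<Longrightarrow> v (t, x) < v0 + p \<bullet> (x - x0)"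
  shows "\<exists>z\<in>{t0..T1} \<times> cball 0 R. v z = v0 + p \<bullet> (snd z - x0) \<and> g z = p \<and> \<tau> z \<le> 0
    \<and> nonneg_definite (- H z) \<and> \<kappa> < psi (snd z)"
proof -
  define w where "w z = v z - (v0 + p \<bullet> (snd z - x0))" for z
  have wd: "(w has_derivative (\<lambda>h. \<tau> z * fst h + (g z - p) \<bullet> snd h)) (at z)" for z
    unfolding w_def[abs_def]
    by (rule derivative_eq_intros vd refl)+ (simp add: algebra_simps)
  have wc: "continuous_on X w" for X
    using wd has_derivative_continuous continuous_at_imp_continuous_on by blast
  define Q where "Q = {t0..T1} \<times> cball (0 :: real^'n) R"
  have "compact Q" unfolding Q_def by (intro compact_Times compact_Icc compact_cball)
  define A where "A = {z \<in> Q. 0 \<le> w z}"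
  have "A = Q \<inter> w -` {0..}" by (auto simp: A_def)
  moreover have "closed (w -` {0..})"
    by (rule continuous_closed_vimage[OF closed_atLeast]) (rule has_derivative_continuous[OF wd])
  ultimately have "compact A" using \<open>compact Q\<close> by (simp add: compact_Int_closed)
  have "(t0, x0) \<in> A" using above x0 T by (simp add: A_def Q_def w_def)
  then have "A \<noteq> {}" by blast
  moreover have "continuous_on A fst" by (intro continuous_on_fst continuous_on_id)
  ultimately have "\<exists>z\<in>A. \<forall>y\<in>A. fst y \<le> fst z"
    by (rule continuous_attains_sup[OF \<open>compact A\<close>])
  \<comment> \<open>The last time at which the function still reaches the plane.\<close>
  then obtain zs where zs: "zs \<in> A" "\<And>z. z \<in> A \<Longrightarrow> fst z \<le> fst zs" by blast
  obtain ts xs where z: "zs = (ts, xs)" by fastforce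
  have ts: "t0 \<le> ts" "ts \<le> T1" and xs: "norm xs \<le> R" and w0: "0 \<le> w (ts, xs)"
    using zs(1) by (auto simp: A_def Q_def z)
  have "ts \<noteq> T1" using top[of xs] w0 xs by (auto simp: w_def)
  then have tsT: "ts < T1" using ts by simp
  have xsR: "norm xs < R" and \<kappa>: "\<kappa> < psi xs"
  proof -
    have "\<not> (norm xs = R \<or> psi xs \<le> \<kappa>)"
      using side[of ts xs] w0 xs ts by (auto simp: w_def)
    then show "norm xs < R" "\<kappa> < psi xs" using xs by auto
  qed
  have later: "w (t, x) < 0" if "ts < t" "t \<le> T1" "norm x \<le> R" for t x
    using zs(2)[of "(t, x)"] that ts by (force simp: A_def Q_def z)
  have now: "w (ts, x) \<le> 0" if "norm x \<le> R" for x
  proof (rule ccontr)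
    assume "\<not> w (ts, x) \<le> 0"
    have "continuous_on UNIV (\<lambda>s. w (ts + s, x))"
      by (rule continuous_on_compose2[OF wc[of UNIV]]) (auto intro!: continuous_intros)
    then have "isCont (\<lambda>s. w (ts + s, x)) 0" by (simp add: continuous_on_eq_continuous_at)
    then have "((\<lambda>s. w (ts + s, x)) \<longlongrightarrow> w (ts, x)) (at 0)" by (simp add: isCont_def)
    then have "((\<lambda>s. w (ts + s, x)) \<longlongrightarrow> w (ts, x)) (at_right 0)"
      by (rule tendsto_mono[rotated]) (simp add: at_le)
    then have "\<forall>\<^sub>F s in at_right 0. 0 < w (ts + s, x)"
      using \<open>\<not> w (ts, x) \<le> 0\<close> by (intro order_tendstoD(1)) auto
    moreover have "\<forall>\<^sub>F s in at_right 0. s < T1 - ts"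
      using tsT eventually_at_right_less by (intro eventually_at_rightI[of 0 "T1 - ts"]) auto
    moreover have "\<forall>\<^sub>F s in at_right (0::real). 0 < s" by (simp add: eventually_at_right_less)
    ultimately have "\<forall>\<^sub>F s in at_right (0::real). False"
    proof eventually_elim
      case (elim s)
      then show ?case using later[of "ts + s" x] that by simp
    qed
    then show False by simp
  qed
  have wz: "w (ts, xs) = 0" using w0 now[of xs] xs by simp
  let ?d = "R - norm xs"
  have line: "w (ts, xs + s *\<^sub>R \<xi>) \<le> 0" if "\<bar>s\<bar> * norm \<xi> \<le> ?d" for s \<xi>
    using that norm_triangle_ineq[of xs "s *\<^sub>R \<xi>"] by (intro now) auto
  have dl: "((\<lambda>s. w (ts, xs + s *\<^sub>R \<xi>)) has_real_derivative (g (ts, xs + s *\<^sub>R \<xi>) - p) \<bullet> \<xi>) (at s)" for s \<xi>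
    using has_derivative_along_line[where z="(ts, xs)" and s=s and e="(0, \<xi>)", OF wd] by simp
  have grad: "g (ts, xs) = p"
  proof -
    define \<xi> where "\<xi> = g (ts, xs) - p"
    have "(g (ts, xs + 0 *\<^sub>R \<xi>) - p) \<bullet> \<xi> = 0"
    proof (rule DERIV_local_max[OF dl])
      have "0 < ?d / (norm \<xi> + 1)" using xsR by (simp add: divide_pos_pos add_nonneg_pos)
      then show "0 < ?d / (norm \<xi> + 1)" .
      show "\<forall>y. \<bar>0 - y\<bar> < ?d / (norm \<xi> + 1) \<longrightarrow> w (ts, xs + y *\<^sub>R \<xi>) \<le> w (ts, xs + 0 *\<^sub>R \<xi>)"
      proof (intro allI impI)
        fix y assume "\<bar>0 - y\<bar> < ?d / (norm \<xi> + 1)"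
        then have "\<bar>y\<bar> * (norm \<xi> + 1) < ?d"
          by (simp add: pos_less_divide_eq add_nonneg_pos)
        moreover have "\<bar>y\<bar> * norm \<xi> \<le> \<bar>y\<bar> * (norm \<xi> + 1)" by (intro mult_left_mono) auto
        ultimately show "w (ts, xs + y *\<^sub>R \<xi>) \<le> w (ts, xs + 0 *\<^sub>R \<xi>)"
          using line[of y \<xi>] wz by simp
      qed
    qed
    then show ?thesis by (simp add: \<xi>_def)
  qed
  have hess: "\<xi> \<bullet> (H (ts, xs) *v \<xi>) \<le> 0" for \<xi>
  proof (rule ccontr)
    assume pos: "\<not> \<xi> \<bullet> (H (ts, xs) *v \<xi>) \<le> 0"
    have ip: "((\<lambda>z. (g z - p) \<bullet> \<xi>) has_derivative (\<lambda>h. (fst h *\<^sub>R c z + H z *v snd h) \<bullet> \<xi>)) (at z)" for z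
      by (rule derivative_eq_intros gd refl)+ simp
    have "((\<lambda>s. (g (ts, xs + s *\<^sub>R \<xi>) - p) \<bullet> \<xi>) has_real_derivative (H (ts, xs) *v \<xi>) \<bullet> \<xi>) (at 0)"
      using has_derivative_along_line[where z="(ts, xs)" and s=0 and e="(0, \<xi>)", OF ip] by simp
    moreover have "0 < (H (ts, xs) *v \<xi>) \<bullet> \<xi>" using pos by (simp add: inner_commute)
    ultimately obtain d where d: "d > 0"
      "\<And>h. 0 < h \<Longrightarrow> h < d \<Longrightarrow> (g (ts, xs + 0 *\<^sub>R \<xi>) - p) \<bullet> \<xi> < (g (ts, xs + (0 + h) *\<^sub>R \<xi>) - p) \<bullet> \<xi>"
      using DERIV_pos_inc_right[of "\<lambda>s. (g (ts, xs + s *\<^sub>R \<xi>) - p) \<bullet> \<xi>"] by blast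
    define h where "h = min (d / 2) (?d / (norm \<xi> + 1))"
    have h: "0 < h" "h < d" using d xsR by (auto simp: h_def divide_pos_pos add_nonneg_pos)
    have "h * norm \<xi> \<le> (?d / (norm \<xi> + 1)) * (norm \<xi> + 1)"
      using h by (intro mult_mono) (auto simp: h_def)
    also have "\<dots> = ?d" by (simp add: add_nonneg_eq_0_iff)
    finally have "w (ts, xs + h *\<^sub>R \<xi>) \<le> 0" using h by (intro line) auto
    moreover have "\<exists>s>0. s < h \<and>
      w (ts, xs + h *\<^sub>R \<xi>) - w (ts, xs + 0 *\<^sub>R \<xi>) = (h - 0) * ((g (ts, xs + s *\<^sub>R \<xi>) - p) \<bullet> \<xi>)"
      by (rule MVT2[OF h(1)]) (rule dl)
    then obtain s where s: "0 < s" "s < h"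
      "w (ts, xs + h *\<^sub>R \<xi>) - w (ts, xs + 0 *\<^sub>R \<xi>) = (h - 0) * ((g (ts, xs + s *\<^sub>R \<xi>) - p) \<bullet> \<xi>)"
      by blast
    moreover have "0 < (g (ts, xs + s *\<^sub>R \<xi>) - p) \<bullet> \<xi>"
      using d(2)[of s] s h grad by simp
    ultimately show False using h wz s(3) by (simp add: mult_le_0_iff)
  qed
  have time: "\<tau> (ts, xs) \<le> 0"
  proof (rule ccontr)
    assume pos: "\<not> \<tau> (ts, xs) \<le> 0"
    have "((\<lambda>s. w (ts + s, xs)) has_real_derivative \<tau> (ts, xs)) (at 0)"
      using has_derivative_along_line[where z="(ts, xs)" and s=0 and e="(1, 0)", OF wd] by simp
    then obtain d where d: "d > 0" "\<And>h. 0 < h \<Longrightarrow> h < d \<Longrightarrow> w (ts + 0, xs) < w (ts + (0 + h), xs)"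
      using DERIV_pos_inc_right[of "\<lambda>s. w (ts + s, xs)"] pos by (metis not_le)
    define h where "h = min (d / 2) (T1 - ts)"
    have "0 < h" "h < d" "ts + h \<le> T1" using d tsT by (auto simp: h_def)
    then show False using d(2)[of h] later[of "ts + h" xs] xs wz by simp
  qed
  have nd: "nonneg_definite (- H (ts, xs))"
  proof -
    have "(- H (ts, xs)) *v \<xi> = - (H (ts, xs) *v \<xi>)" for \<xi>
      by (simp add: vec_eq_iff matrix_vector_mult_def sum_negf)
    then show ?thesis using hess by (simp add: nonneg_definite_def)
  qed
  show ?thesis
  proof (rule bexI[of _ "(ts, xs)"], intro conjI)
    show "v (ts, xs) = v0 + p \<bullet> (snd (ts, xs) - x0)" using wz by (simp add: w_def)
  qed (use grad time nd \<kappa> ts xs in auto)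
qed

text \<open>
  Pairs of the value \<open>v0\<close> at \<open>x0\<close> and the slope \<open>p\<close>. The slopes fill a tube around a segment in direction
  \<open>x0\<close>: near the boundary of the ball, slopes of size \<open>M / psi x0\<close> are possible in the normal direction, but only
  \<open>M / sqrt (psi x0)\<close> in tangential directions.
\<close>

definition planes :: "real \<Rightarrow> (real^'n) \<Rightarrow> (real \<times> (real^'n)) set" where
  "planes M x0 = {(v0, p). 3/4 * M \<le> v0 \<and> v0 \<le> 7/8 * M \<and>
     (\<exists>\<theta>\<in>{1/2..3/4}. norm (p + (\<theta> * (M / psi x0)) *\<^sub>R x0) \<le> M / (4 * sqrt (psi x0)))}"

lemma psi_pos: "x \<in> ball 0 1 \<Longrightarrow> 0 < psi x"
  by (simp add: psi_def abs_square_less_1)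

lemma planes_lower_bound:
  assumes pl: "(v0, p) \<in> planes M x0" and x0: "x0 \<in> ball 0 1" and x: "x \<in> cball 0 1" and M: "0 < M"
  shows "M / 8 \<le> v0 + p \<bullet> (x - x0)"
proof -
  define \<delta> where "\<delta> = psi x0"
  have \<delta>: "0 < \<delta>" using psi_pos[OF x0] by (simp add: \<delta>_def)
  obtain \<theta> where \<theta>: "1/2 \<le> \<theta>" "\<theta> \<le> 3/4" "norm (p + (\<theta> * (M / \<delta>)) *\<^sub>R x0) \<le> M / (4 * sqrt \<delta>)"
    using pl by (auto simp: planes_def \<delta>_def)
  have v0: "3/4 * M \<le> v0" using pl by (auto simp: planes_def)
  define q where "q = p + (\<theta> * (M / \<delta>)) *\<^sub>R x0"
  define y where "y = norm (x - x0) / sqrt \<delta>"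
  \<comment> \<open>\<open>l\<close> is the affine function that is 1 at \<open>x0\<close>, with slope \<open>- x0 / \<delta>\<close>. On the unit ball
    \<open>2 * l\<close> is at least \<open>1 + y\<^sup>2\<close>, so it absorbs perturbations of size \<open>y\<close>.\<close>
  define l where "l = 1 - (x0 \<bullet> (x - x0)) / \<delta>"
  have y2: "y\<^sup>2 = (norm (x - x0))\<^sup>2 / \<delta>" using \<delta> by (simp add: y_def power_divide)
  have "x \<bullet> x \<le> 1" using x by (simp add: power2_norm_eq_inner[symmetric] abs_square_le_1)
  then have "2 * (\<delta> - x0 \<bullet> (x - x0)) \<ge> \<delta> + (norm (x - x0))\<^sup>2"
    by (simp add: \<delta>_def psi_def power2_norm_eq_inner inner_diff_left inner_diff_right inner_commute)
  then have "(\<delta> + (norm (x - x0))\<^sup>2) / \<delta> \<le> 2 * (\<delta> - x0 \<bullet> (x - x0)) / \<delta>"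
    using \<delta> by (intro divide_right_mono) auto
  then have l: "1 + y\<^sup>2 \<le> 2 * l"
    using \<delta> by (simp add: l_def y2 field_simps)
  have "2 * y \<le> 1 + y\<^sup>2" using sum_squares_bound[of y 1] by simp
  then have yl: "y \<le> l" using l by simp
  have "1 \<le> 2 * l" by (rule order_trans[OF _ l]) simp
  then have l0: "1/2 \<le> l" by simp
  have "\<bar>q \<bullet> (x - x0)\<bar> \<le> norm q * norm (x - x0)" by (rule Cauchy_Schwarz_ineq2)
  also have "\<dots> \<le> (M / (4 * sqrt \<delta>)) * norm (x - x0)"
    using \<theta>(3) by (intro mult_right_mono) (auto simp: q_def)
  also have "\<dots> = M / 4 * y" by (simp add: y_def)
  also have "\<dots> \<le> M / 4 * l" using yl M by (intro mult_left_mono) auto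
  finally have q: "- (M / 4 * l) \<le> q \<bullet> (x - x0)" by simp
  have "v0 + p \<bullet> (x - x0) = (v0 - \<theta> * M) + \<theta> * M * l + q \<bullet> (x - x0)"
    by (simp add: q_def l_def inner_add_left field_simps)
  moreover have "\<theta> * M \<le> v0" using mult_right_mono[OF \<theta>(2), of M] M v0 by linarith
  moreover have "1/2 * M * l \<le> \<theta> * M * l"
    using \<theta>(1) M l0 by (intro mult_right_mono) auto
  moreover have "M / 4 * (1/2) \<le> M / 4 * l" using l0 M by (intro mult_left_mono) auto
  ultimately show ?thesis using q by linarith
qed

definition ball_constant :: "nat \<Rightarrow> real" where
  "ball_constant d = unit_ball_vol (real d) / (24 * 4 ^ d)"

lemma ball_constant_pos: "0 < ball_constant d"
  by (simp add: ball_constant_def)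

text \<open>
  The values contribute a factor \<open>M / 8\<close>. The tube of slopes has radius of order \<open>M / sqrt (psi x0)\<close> and, by packing
  with disjoint balls, contains at least \<open>1 / (3 * sqrt (psi x0))\<close> balls of that radius, also when \<open>x0\<close> is close to the
  centre and one ball suffices. Packing avoids computing the volume of the tube.
\<close>

theorem planes_volume:
  fixes x0 :: "real^'n"
  assumes x0: "x0 \<in> ball 0 1" and M: "0 < M" and Y: "Y \<in> sets borel" "planes M x0 \<subseteq> Y"
  shows "ennreal (ball_constant CARD('n) * (M / sqrt (psi x0)) ^ (CARD('n) + 1)) \<le> emeasure lborel Y"
proof -
  define \<delta> where "\<delta> = psi x0"
  have \<delta>: "0 < \<delta>" using psi_pos[OF x0] by (simp add: \<delta>_def)
  define \<rho> where "\<rho> = M / (4 * sqrt \<delta>)"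
  have \<rho>: "0 < \<rho>" using M \<delta> by (simp add: \<rho>_def)
  \<comment> \<open>The admissible slopes contain a tube of radius \<open>\<rho>\<close> around a segment of length
    \<open>M * norm x0 / (4 * \<delta>)\<close>, which holds about \<open>L\<close> disjoint balls of radius \<open>\<rho>\<close>.\<close>
  define L where "L = norm x0 / (2 * sqrt \<delta>)"
  have L: "0 \<le> L" using \<delta> by (simp add: L_def)
  define m where "m = Suc (nat \<lfloor>L\<rfloor>)"
  define \<theta> where "\<theta> k = 1/2 + real k * (sqrt \<delta> / (2 * norm x0))" for k
  define c where "c k = - ((\<theta> k * (M / \<delta>)) *\<^sub>R x0)" for k
  have mL: "L \<le> real m" using L by (simp add: m_def) linarith
  have kL: "real k \<le> L" if "k < m" for k
  proof -
    have "k \<le> nat \<lfloor>L\<rfloor>" using that by (simp add: m_def)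
    then show ?thesis using L by (simp add: le_nat_floor nat_le_iff le_floor_iff le_nat_iff)
  qed
  have \<theta>: "\<theta> k \<in> {1/2..3/4}" if "k < m" for k
  proof -
    have "real k * (sqrt \<delta> / (2 * norm x0)) \<le> L * (sqrt \<delta> / (2 * norm x0))"
      using kL[OF that] \<delta> by (intro mult_right_mono) auto
    also have "\<dots> \<le> 1/4" using \<delta> by (cases "x0 = 0") (simp_all add: L_def)
    finally show ?thesis using \<delta> by (simp add: \<theta>_def)
  qed
  have step: "2 * \<rho> \<le> dist (c k) (c l)" if "k < l" "l < m" for k l
  proof -
    have "1 \<le> L" using kL[OF that(2)] that by linarith
    then have "x0 \<noteq> 0" by (auto simp: L_def)
    have "dist (c k) (c l) = norm ((\<theta> l * (M / \<delta>)) *\<^sub>R x0 - (\<theta> k * (M / \<delta>)) *\<^sub>R x0)"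
      by (simp add: c_def dist_norm)
    also have "\<dots> = \<bar>\<theta> l - \<theta> k\<bar> * (M / \<delta>) * norm x0"
      using M \<delta> by (simp add: scaleR_left_diff_distrib[symmetric] left_diff_distrib[symmetric] diff_divide_distrib[symmetric] abs_mult)
    also have "\<theta> l - \<theta> k = (real l - real k) * (sqrt \<delta> / (2 * norm x0))"
      by (simp add: \<theta>_def algebra_simps diff_divide_distrib)
    also have "\<bar>(real l - real k) * (sqrt \<delta> / (2 * norm x0))\<bar> * (M / \<delta>) * norm x0 = (real l - real k) * (2 * \<rho>)"
    proof -
      define s where "s = sqrt \<delta>"
      have s: "0 < s" "\<delta> = s * s" using \<delta> by (simp_all add: s_def)
      have "\<bar>(real l - real k) * (s / (2 * norm x0))\<bar> = (real l - real k) * (s / (2 * norm x0))"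
        using that s by (intro abs_of_nonneg mult_nonneg_nonneg) auto
      then have "\<bar>(real l - real k) * (s / (2 * norm x0))\<bar> * (M / (s * s)) * norm x0
        = (real l - real k) * ((s / (2 * norm x0)) * (M / (s * s)) * norm x0)"
        by (simp only: mult.assoc)
      also have "(s / (2 * norm x0)) * (M / (s * s)) * norm x0 = 2 * (M / (4 * s))"
        using s(1) \<open>x0 \<noteq> 0\<close> by (simp add: field_simps)
      finally show ?thesis by (simp add: \<rho>_def s_def[symmetric] s(2)[symmetric])
    qed
    finally have "dist (c k) (c l) = (real l - real k) * (2 * \<rho>)" .
    moreover have "1 * (2 * \<rho>) \<le> (real l - real k) * (2 * \<rho>)"
      using that \<rho> by (intro mult_right_mono) auto
    ultimately show ?thesis by simp
  qed
  define U where "U = (\<Union>k<m. ball (c k) \<rho>)"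
  have disj: "disjoint_family_on (\<lambda>k. ball (c k) \<rho>) {..<m}"
  proof (unfold disjoint_family_on_def, intro ballI impI)
    fix k l assume kl: "k \<in> {..<m}" "l \<in> {..<m}" "k \<noteq> l"
    have "2 * \<rho> \<le> dist (c k) (c l)"
    proof (cases "k < l")
      case True then show ?thesis using step kl by simp
    next
      case False then show ?thesis using step[of l k] kl by (simp add: dist_commute)
    qed
    then have "\<not> (dist (c k) x < \<rho> \<and> dist (c l) x < \<rho>)" for x
      using dist_triangle2[of "c k" "c l" x] by (simp add: dist_commute) 
    then show "ball (c k) \<rho> \<inter> ball (c l) \<rho> = {}" by auto
  qed
  have [measurable]: "U \<in> sets borel" by (simp add: U_def)
  define b where "b = unit_ball_vol (real CARD('n))"
  have b: "0 < b" by (simp add: b_def)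
  have "emeasure lborel U = (\<Sum>k<m. emeasure lborel (ball (c k) \<rho>))"
    unfolding U_def by (rule sum_emeasure[symmetric]) (use disj in auto)
  also have "\<dots> = (\<Sum>k<m. ennreal (b * \<rho> ^ CARD('n)))"
    using \<rho> by (simp add: emeasure_ball b_def)
  also have "\<dots> = ennreal (real m * (b * \<rho> ^ CARD('n)))"
    using b \<rho> by (simp add: ennreal_of_nat_eq_real_of_nat ennreal_mult)
  finally have U: "emeasure lborel U = ennreal (real m * (b * \<rho> ^ CARD('n)))" .
  have sub: "{3/4 * M..7/8 * M} \<times> U \<subseteq> planes M x0"
  proof
    fix z assume "z \<in> {3/4 * M..7/8 * M} \<times> U"
    then obtain v0 p k where z: "z = (v0, p)" "3/4 * M \<le> v0" "v0 \<le> 7/8 * M" "k < m" "dist (c k) p < \<rho>"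
      by (auto simp: U_def)
    have "norm (p + (\<theta> k * (M / \<delta>)) *\<^sub>R x0) = dist (c k) p"
      by (simp add: c_def dist_norm norm_minus_commute[of _ p])
    then show "z \<in> planes M x0"
      using z \<theta>[OF z(4)] by (auto simp: planes_def \<delta>_def[symmetric] \<rho>_def[symmetric] intro!: bexI[of _ "\<theta> k"])
  qed
  have mb: "1 / (3 * sqrt \<delta>) \<le> real m"
  proof (cases "2/3 \<le> norm x0")
    case True
    have "1 / (3 * sqrt \<delta>) \<le> L" using True \<delta> by (simp add: L_def field_simps)
    then show ?thesis using mL by simp
  next
    case False
    have "(norm x0)\<^sup>2 \<le> (2/3)\<^sup>2" using False by (intro power_mono) auto
    then have "(1/3)\<^sup>2 \<le> \<delta>" by (simp add: \<delta>_def psi_def power2_eq_square)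
    then have "1/3 \<le> sqrt \<delta>" by (rule real_le_rsqrt)
    then have "1 / (3 * sqrt \<delta>) \<le> 1" using \<delta> by (simp add: field_simps)
    then show ?thesis by (simp add: m_def)
  qed
  have "b / (24 * 4 ^ CARD('n)) * (M / sqrt \<delta>) ^ (CARD('n) + 1) = M / 8 * (1 / (3 * sqrt \<delta>) * (b * \<rho> ^ CARD('n)))"
    by (simp add: \<rho>_def power_divide power_mult_distrib field_simps)
  also have "\<dots> \<le> M / 8 * (real m * (b * \<rho> ^ CARD('n)))"
    using mb M b \<rho> by (intro mult_left_mono mult_right_mono) auto
  finally have "ennreal (b / (24 * 4 ^ CARD('n)) * (M / sqrt \<delta>) ^ (CARD('n) + 1))
    \<le> ennreal (M / 8 * (real m * (b * \<rho> ^ CARD('n))))" by (rule ennreal_leI)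
  also have "\<dots> = ennreal (M / 8) * emeasure lborel U"
    unfolding U using M b \<rho> by (intro ennreal_mult) auto
  also have "\<dots> = emeasure (lborel \<Otimes>\<^sub>M lborel) ({3/4 * M..7/8 * M} \<times> U)"
    using M by (subst lborel.emeasure_pair_measure_Times) auto
  also have "\<dots> \<le> emeasure lborel Y"
    unfolding lborel_prod using sub Y by (intro emeasure_mono) auto
  finally show ?thesis by (simp add: ball_constant_def b_def \<delta>_def)
qed

lemma dir_Basis: "(Basis :: (real \<times> (real^'n)) set) = insert dir_t (range dir_x)"
  by (auto simp: Basis_prod_def Basis_vec_axis dir_t_def dir_x_def[abs_def])

lemma sum_dir_Basis: "(\<Sum>e\<in>Basis. \<phi> e) = \<phi> dir_t + (\<Sum>i\<in>UNIV. \<phi> (dir_x (i::'n::finite)))"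
proof -
  have "inj (dir_x :: 'n \<Rightarrow> _)" by (auto simp: inj_on_def dir_x_def axis_eq_axis)
  moreover have "dir_t \<notin> range (dir_x :: 'n \<Rightarrow> _)" by (auto simp: dir_t_def dir_x_def)
  ultimately show ?thesis by (simp add: dir_Basis sum.reindex)
qed

lemma inner_dir: "h \<bullet> dir_t = fst h" "h \<bullet> dir_x i = snd h $ i"
  by (simp_all add: dir_t_def dir_x_def inner_prod_def inner_axis)

text \<open>
  Symmetry of the Hessian of the mollified function, and hence of the limit, comes from the kernel.
\<close>

lemma mollifier_pd_commute: "pd e (pd e' (mollifier n)) = pd e' (pd e (mollifier n))"
proof -
  define q where "q z = 1 - (real n)\<^sup>2 * (z \<bullet> z)" for z :: 'a
  define C where "C = inverse (LINT z|lborel. bump n (z::'a))"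
  have m: "mollifier n = (\<lambda>z. C * flat 0 (q z))"
    by (simp add: fun_eq_iff mollifier_def bump_def C_def q_def)
  have qd: "(q has_derivative (\<lambda>h. - (2 * (real n)\<^sup>2 * (z \<bullet> h)))) (at z)" for z
    unfolding q_def[abs_def] by (auto intro!: derivative_eq_intros simp: inner_commute algebra_simps)
  have fd: "((\<lambda>z. flat k (q z)) has_derivative (\<lambda>h. (flat (k + 2) (q z) - real k * flat (k + 1) (q z)) * (- (2 * (real n)\<^sup>2 * (z \<bullet> h))))) (at z)" for k z
    using has_derivative_compose[OF qd flat_has_real_derivative[unfolded has_field_derivative_def]] by simp
  have 1: "pd e (mollifier n) = (\<lambda>z. C * (flat 2 (q z) * (- (2 * (real n)\<^sup>2 * (z \<bullet> e)))))" for e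
  proof
    fix z
    have "(mollifier n has_derivative (\<lambda>h. C * ((flat (0 + 2) (q z) - real 0 * flat (0 + 1) (q z)) * (- (2 * (real n)\<^sup>2 * (z \<bullet> h)))))) (at z)"
      unfolding m by (intro has_derivative_mult_right fd)
    from frechet_derivative_at[OF this, symmetric]
    show "pd e (mollifier n) z = C * (flat 2 (q z) * (- (2 * (real n)\<^sup>2 * (z \<bullet> e))))"
      by (simp add: numeral_2_eq_2)
  qed
  have 2: "pd e (pd e' (mollifier n)) z = C * (flat 2 (q z) * (- (2 * (real n)\<^sup>2 * (e \<bullet> e')))
    + (flat 4 (q z) - 2 * flat 3 (q z)) * (- (2 * (real n)\<^sup>2 * (z \<bullet> e))) * (- (2 * (real n)\<^sup>2 * (z \<bullet> e'))))" for e e' z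
  proof -
    have "(pd e' (mollifier n) has_derivative (\<lambda>h. C * (flat 2 (q z) * (- (2 * (real n)\<^sup>2 * (h \<bullet> e')))
      + (flat (2 + 2) (q z) - real 2 * flat (2 + 1) (q z)) * (- (2 * (real n)\<^sup>2 * (z \<bullet> h))) * (- (2 * (real n)\<^sup>2 * (z \<bullet> e')))))) (at z)"
      unfolding 1 by (intro has_derivative_mult_right has_derivative_mult fd) (auto intro!: derivative_eq_intros)
    from frechet_derivative_at[OF this, symmetric] show ?thesis by simp
  qed
  show ?thesis
    by (rule ext) (simp add: 2 inner_commute[of e e'])
qed

text \<open>
  For the smooth function \<open>conv a b f K - s\<close> every plane of the family is tangent at a contact point, hence the family
  lies in the image of the contact set under the Legendre map. Compactness of the contact set makes
  this image Borel.
\<close>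

theorem
  fixes f :: "real \<times> (real^'n) \<Rightarrow> real"
  assumes f: "continuous_on (cbox a b) f" and K: "smooth_fun K"
    and T: "t0 \<le> T1" and R: "R < 1" and x0: "x0 \<in> cball 0 R" and M: "0 < M"
    and above: "s + 7/8 * M < conv a b f K (t0, x0)"
    and top: "\<And>x. x \<in> cball 0 R \<Longrightarrow> conv a b f K (T1, x) < s + M / 8"
    and side: "\<And>t x. t \<in> {t0..T1} \<Longrightarrow> x \<in> cball 0 R \<Longrightarrow> norm x = R \<or> psi x \<le> \<kappa> \<Longrightarrow> conv a b f K (t, x) < s + M / 8"
  defines "\<tau> \<equiv> conv a b f (partials [dir_t] K)"
    and "H \<equiv> \<lambda>z. (\<chi> i j. conv a b f (partials [dir_x i, dir_x j] K) z)"
  defines "S \<equiv> {z \<in> {t0..T1} \<times> cball (0 :: real^'n) R. \<kappa> \<le> psi (snd z) \<and> \<tau> z \<le> 0 \<and> nonneg_definite (- H z)}"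
  shows compact_contact_set: "compact S"
    and planes_le_contact_integral: "ennreal (ball_constant CARD('n) * (M / sqrt (psi x0)) ^ (CARD('n) + 1))
    \<le> (\<integral>\<^sup>+ z. ennreal \<bar>\<tau> z * det (H z)\<bar> * indicator S z \<partial>lborel)"
proof -
  define v where "v z = conv a b f K z - s" for z
  define g where "g z = (\<chi> i. conv a b f (pd (dir_x i) K) z)" for z
  define c where "c z = (\<chi> i. conv a b f (pd dir_t (pd (dir_x i) K)) z)" for z
  have D: "(conv a b f K has_derivative (\<lambda>h. fst h * conv a b f (pd dir_t K) z
      + (\<Sum>i\<in>UNIV. snd h $ i * conv a b f (pd (dir_x i) K) z))) (at z)" if "smooth_fun K" for K z
    using conv_has_derivative[OF f that, of z] by (simp add: sum_dir_Basis inner_dir)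
  have vd: "(v has_derivative (\<lambda>h. \<tau> z * fst h + g z \<bullet> snd h)) (at z)" for z
  proof -
    have "(v has_derivative (\<lambda>h. (fst h * conv a b f (pd dir_t K) z
      + (\<Sum>i\<in>UNIV. snd h $ i * conv a b f (pd (dir_x i) K) z)) - 0)) (at z)"
      unfolding v_def[abs_def] by (intro has_derivative_diff D K has_derivative_const)
    then show ?thesis by (simp add: \<tau>_def g_def inner_vec_def mult.commute)
  qed
  have gd: "(g has_derivative (\<lambda>h. fst h *\<^sub>R c z + H z *v snd h)) (at z)" for z
  proof -
    have "((\<lambda>z. \<Sum>i\<in>UNIV. conv a b f (pd (dir_x i) K) z *\<^sub>R axis i 1) has_derivative
      (\<lambda>h. \<Sum>i\<in>UNIV. (fst h * conv a b f (pd dir_t (pd (dir_x i) K)) z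
        + (\<Sum>j\<in>UNIV. snd h $ j * conv a b f (pd (dir_x j) (pd (dir_x i) K)) z)) *\<^sub>R (axis i 1 :: real^'n))) (at z)"
      by (intro has_derivative_sum has_derivative_scaleR_left D smooth_fun_pd K)
    moreover have "g = (\<lambda>z. \<Sum>i\<in>UNIV. conv a b f (pd (dir_x i) K) z *\<^sub>R axis i 1)"
      by (simp add: fun_eq_iff vec_eq_iff g_def axis_def if_distrib cong: if_cong)
    moreover have "(\<lambda>h. fst h *\<^sub>R c z + H z *v snd h) = (\<lambda>h. \<Sum>i\<in>UNIV. (fst h * conv a b f (pd dir_t (pd (dir_x i) K)) z
        + (\<Sum>j\<in>UNIV. snd h $ j * conv a b f (pd (dir_x j) (pd (dir_x i) K)) z)) *\<^sub>R (axis i 1 :: real^'n))"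
      by (simp add: fun_eq_iff vec_eq_iff c_def H_def axis_def if_distrib matrix_vector_mult_def mult.commute cong: if_cong)
    ultimately show ?thesis by simp
  qed
  have \<tau>c: "continuous_on X \<tau>" for X
    unfolding \<tau>_def by (intro conv_continuous f smooth_fun_partials K)
  have Hc: "continuous_on X H" for X
    unfolding H_def by (intro continuous_on_vec_lambda conv_continuous f smooth_fun_partials K)
  have "S = ({t0..T1} \<times> cball 0 R) \<inter> ({z. \<kappa> \<le> psi (snd z)} \<inter> {z. \<tau> z \<le> 0} \<inter> (\<Inter>\<xi>. {z. 0 \<le> \<xi> \<bullet> ((- H z) *v \<xi>)}))"
    by (auto simp: S_def nonneg_definite_def)
  moreover have "closed ({z. \<kappa> \<le> psi (snd z)} \<inter> {z. \<tau> z \<le> 0} \<inter> (\<Inter>\<xi>. {z. 0 \<le> \<xi> \<bullet> ((- H z) *v \<xi>)}))"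
  proof (intro closed_Int closed_INT ballI closed_Collect_le)
    show "continuous_on UNIV (\<lambda>z. \<xi> \<bullet> ((- H z) *v \<xi>))" for \<xi>
      unfolding matrix_vector_mult_def using Hc[of UNIV]
      by (intro continuous_intros) auto
  qed (auto simp: psi_def intro!: continuous_intros \<tau>c)
  ultimately have S: "compact S" by (simp add: compact_Times compact_Int_closed)
  then show "compact S" .
  define \<Phi> where "\<Phi> = (\<lambda>z. (v z - (snd z - x0) \<bullet> g z, g z))"
  have "continuous_on S v" "continuous_on S g"
    by (intro continuous_at_imp_continuous_on ballI has_derivative_continuous[OF vd] has_derivative_continuous[OF gd])+
  then have "continuous_on S \<Phi>"
    unfolding \<Phi>_def by (intro continuous_intros)
  then have "compact (\<Phi> ` S)" using S by (rule compact_continuous_image)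
  moreover have "planes M x0 \<subseteq> \<Phi> ` S"
  proof clarify
    fix v0 p assume pl: "(v0, p) \<in> planes M x0"
    have x0': "x0 \<in> ball 0 1" using x0 R by simp
    have lb: "M / 8 \<le> v0 + p \<bullet> (x - x0)" if "x \<in> cball 0 R" for x
      using planes_lower_bound[OF pl x0' _ M, of x] that R by simp
    have "v0 \<le> 7/8 * M" using pl by (simp add: planes_def)
    have "\<exists>z\<in>{t0..T1} \<times> cball 0 R. v z = v0 + p \<bullet> (snd z - x0) \<and> g z = p \<and> \<tau> z \<le> 0
        \<and> nonneg_definite (- H z) \<and> \<kappa> < psi (snd z)"
    proof (rule contact_point[OF vd gd T x0])
      show "v0 < v (t0, x0)" using above \<open>v0 \<le> 7/8 * M\<close> by (simp add: v_def)
      show "v (T1, x) < v0 + p \<bullet> (x - x0)" if "x \<in> cball 0 R" for x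
        using top[OF that] lb[OF that] by (simp add: v_def)
      show "v (t, x) < v0 + p \<bullet> (x - x0)" if "t \<in> {t0..T1}" "x \<in> cball 0 R" "norm x = R \<or> psi x \<le> \<kappa>" for t x
        using side[OF that] lb[OF that(2)] by (simp add: v_def)
    qed
    then obtain z where z: "z \<in> {t0..T1} \<times> cball 0 R" "v z = v0 + p \<bullet> (snd z - x0)" "g z = p" "\<tau> z \<le> 0"
      "nonneg_definite (- H z)" "\<kappa> < psi (snd z)" by blast
    then have "z \<in> S" by (auto simp: S_def)
    moreover have "\<Phi> z = (v0, p)" using z by (simp add: \<Phi>_def inner_commute)
    ultimately show "(v0, p) \<in> \<Phi> ` S" by (metis imageI)
  qed
  ultimately have "ennreal (ball_constant CARD('n) * (M / sqrt (psi x0)) ^ (CARD('n) + 1))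
    \<le> emeasure lborel (\<Phi> ` S)"
    using x0 R M by (intro planes_volume) (auto simp: borel_compact)
  also have "\<dots> \<le> (\<integral>\<^sup>+ z. ennreal \<bar>\<tau> z * det (H z)\<bar> * indicator S z \<partial>lborel)"
    unfolding \<Phi>_def by (rule measure_legendre_image_le[OF S vd gd \<tau>c Hc])
  finally show "ennreal (ball_constant CARD('n) * (M / sqrt (psi x0)) ^ (CARD('n) + 1))
    \<le> (\<integral>\<^sup>+ z. ennreal \<bar>\<tau> z * det (H z)\<bar> * indicator S z \<partial>lborel)" .
qed

section \<open>The contact estimate for Sobolev functions\<close>

lemma sum_power_le:
  fixes x :: "'k \<Rightarrow> real"
  assumes "finite A" "A \<noteq> {}" "\<And>k. k \<in> A \<Longrightarrow> 0 \<le> x k"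
  shows "(\<Sum>k\<in>A. x k) ^ q \<le> real (card A) ^ q * (\<Sum>k\<in>A. x k ^ q)"
proof -
  define m where "m = Max (x ` A)"
  have "m \<in> x ` A" unfolding m_def by (rule Max_in) (use assms in auto)
  then obtain k where k: "k \<in> A" "x k = m" by auto
  have "(\<Sum>k\<in>A. x k) \<le> (\<Sum>k\<in>A. m)"
    using assms by (intro sum_mono) (auto simp: m_def)
  then have "(\<Sum>k\<in>A. x k) ^ q \<le> (real (card A) * m) ^ q"
    using assms by (intro power_mono sum_nonneg) auto
  also have "\<dots> = real (card A) ^ q * m ^ q" by (simp add: power_mult_distrib)
  also have "m ^ q \<le> (\<Sum>k\<in>A. x k ^ q)"
    using member_le_sum[of k A "\<lambda>k. x k ^ q"] k assms by auto
  finally show ?thesis by (simp add: mult_left_mono)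
qed

text \<open>
  The sum of the finitely many \<open>L_1\<close> distances tends to 0, so one subsequence serves all functions.
\<close>

lemma moll_AE_subsequence:
  fixes h :: "'k::finite \<Rightarrow> 'a::euclidean_space \<Rightarrow> real"
  assumes h: "\<And>k. integrable lborel (h k)"
  obtains r :: "nat \<Rightarrow> nat" where "strict_mono r"
    "AE z in lborel. \<forall>k. (\<lambda>n. moll (r n) (h k) z) \<longlonglongrightarrow> h k z"
proof -
  have [measurable]: "h k \<in> borel_measurable borel" for k using h[of k] by auto
  define X where "X n z = (\<Sum>k\<in>UNIV. \<bar>moll n (h k) z - h k z\<bar>)" for n z
  have [measurable]: "X n \<in> borel_measurable borel" for n unfolding X_def by measurable
  have X0: "0 \<le> X n z" for n z by (simp add: X_def sum_nonneg)
  have "(\<lambda>n. \<Sum>k\<in>UNIV. \<integral>\<^sup>+ z. ennreal \<bar>moll n (h k) z - h k z\<bar> \<partial>lborel) \<longlonglongrightarrow> (\<Sum>k\<in>(UNIV::'k set). 0)"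
    by (intro tendsto_sum moll_tendsto_L1 h)
  moreover have "(\<Sum>k\<in>UNIV. \<integral>\<^sup>+ z. ennreal \<bar>moll n (h k) z - h k z\<bar> \<partial>lborel) = (\<integral>\<^sup>+ z. ennreal (X n z) \<partial>lborel)" for n
    unfolding X_def by (subst nn_integral_sum[symmetric]) (auto simp: sum_ennreal)
  ultimately have lim: "(\<lambda>n. \<integral>\<^sup>+ z. ennreal (X n z) \<partial>lborel) \<longlonglongrightarrow> 0" by simp
  then have "\<forall>\<^sub>F n in sequentially. (\<integral>\<^sup>+ z. ennreal (X n z) \<partial>lborel) < 1"
    by (rule order_tendstoD(2)) simp
  then obtain N where N: "\<And>n. n \<ge> N \<Longrightarrow> (\<integral>\<^sup>+ z. ennreal (X n z) \<partial>lborel) < 1"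
    by (auto simp: eventually_sequentially)
  have fin: "(\<integral>\<^sup>+ z. ennreal (X (n + N) z) \<partial>lborel) < \<infinity>" for n
  proof -
    have "(\<integral>\<^sup>+ z. ennreal (X (n + N) z) \<partial>lborel) < 1" by (rule N) simp
    also have "(1 :: ennreal) < \<infinity>" by simp
    finally show ?thesis .
  qed
  have int: "integrable lborel (X (n + N))" for n
    by (rule integrableI_nonneg) (use X0 fin in auto)
  have "(\<integral>\<^sup>+ z. ennreal (X (n + N) z) \<partial>lborel) = ennreal (LINT z|lborel. norm (X (n + N) z))" for n
    using X0 by (subst nn_integral_eq_integral[OF int]) auto
  moreover have "(\<lambda>n. \<integral>\<^sup>+ z. ennreal (X (n + N) z) \<partial>lborel) \<longlonglongrightarrow> ennreal 0"
    using LIMSEQ_ignore_initial_segment[OF lim, of N] by simp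
  ultimately have "(\<lambda>n. ennreal (LINT z|lborel. norm (X (n + N) z))) \<longlonglongrightarrow> ennreal 0" by simp
  then have "(\<lambda>n. LINT z|lborel. norm (X (n + N) z)) \<longlonglongrightarrow> 0"
    by (subst (asm) tendsto_ennreal_iff) auto
  from tendsto_L1_AE_subseq[OF int this]
  obtain r :: "nat \<Rightarrow> nat" where r: "strict_mono r" "AE z in lborel. (\<lambda>n. X (r n + N) z) \<longlonglongrightarrow> 0" by blast
  show ?thesis
  proof (rule that[of "\<lambda>n. r n + N"])
    show "strict_mono (\<lambda>n. r n + N)" using r(1) by (simp add: strict_mono_def)
    show "AE z in lborel. \<forall>k. (\<lambda>n. moll (r n + N) (h k) z) \<longlonglongrightarrow> h k z"
      using r(2)
    proof eventually_elim
      case (elim z)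
      show ?case
      proof
        fix k
        have "(\<lambda>n. moll (r n + N) (h k) z - h k z) \<longlonglongrightarrow> 0"
        proof (rule Lim_null_comparison[OF _ elim])
          have "\<bar>moll m (h k) z - h k z\<bar> \<le> X m z" for m
            unfolding X_def by (rule member_le_sum) auto
          then show "\<forall>\<^sub>F n in sequentially. norm (moll (r n + N) (h k) z - h k z) \<le> X (r n + N) z" by simp
        qed
        then show "(\<lambda>n. moll (r n + N) (h k) z) \<longlonglongrightarrow> h k z" by (rule Lim_null[THEN iffD2])
      qed
    qed
  qed
qed

text \<open>
  A reverse Fatou lemma for dominating functions that vary with \<open>n\<close> but converge in \<open>L_1\<close>: cutting \<open>G n\<close> off at
  \<open>C * w z\<close> costs at most \<open>C\<close> times the \<open>L_1\<close> distance of \<open>w\<close> and its mollification, and then the fixed bound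
  \<open>C * w\<close> allows the usual argument.
\<close>

lemma le_nn_integral_limit_mollified_bound:
  fixes w :: "'a::euclidean_space \<Rightarrow> real"
  assumes w: "integrable lborel w" "\<And>z. 0 \<le> w z" and C: "0 \<le> C"
    and G: "\<And>n. G n \<in> borel_measurable borel" "\<And>n z. n \<ge> N \<Longrightarrow> G n z \<le> ennreal (C * moll n w z)"
    and c: "\<And>n. n \<ge> N \<Longrightarrow> c \<le> (\<integral>\<^sup>+ z. G n z \<partial>lborel)"
    and r: "strict_mono r" and lim: "AE z in lborel. limsup (\<lambda>n. G (r n) z) \<le> g z"
  shows "c \<le> (\<integral>\<^sup>+ z. g z \<partial>lborel)"
proof -
  have [measurable]: "w \<in> borel_measurable borel" "G n \<in> borel_measurable borel" for n using w G by auto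
  define A where "A n z = min (G n z) (ennreal (C * w z))" for n z
  have [measurable]: "A n \<in> borel_measurable borel" for n unfolding A_def by measurable
  define b where "b n = (\<integral>\<^sup>+ z. ennreal \<bar>moll n w z - w z\<bar> \<partial>lborel)" for n
  have wfin: "(\<integral>\<^sup>+ z. ennreal (C * w z) \<partial>lborel) < \<infinity>"
    using w C by (simp add: nn_integral_eq_integral)
  have split: "c \<le> (\<integral>\<^sup>+ z. A n z \<partial>lborel) + ennreal C * b n" if n: "n \<ge> N" for n
  proof -
    have "G n z \<le> A n z + ennreal C * ennreal \<bar>moll n w z - w z\<bar>" for z
    proof (cases "G n z \<le> ennreal (C * w z)")
      case False
      have "C * moll n w z \<le> C * w z + C * \<bar>moll n w z - w z\<bar>"
        using C by (simp add: distrib_left[symmetric] mult_left_mono)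
      then have "G n z \<le> ennreal (C * w z + C * \<bar>moll n w z - w z\<bar>)"
        using G(2)[OF n, of z] by (meson ennreal_leI order_trans)
      also have "\<dots> = ennreal (C * w z) + ennreal C * ennreal \<bar>moll n w z - w z\<bar>"
        using C w by (simp add: ennreal_mult)
      finally show ?thesis using False by (simp add: A_def min_def)
    qed (simp add: A_def min_def)
    then have "(\<integral>\<^sup>+ z. G n z \<partial>lborel) \<le> (\<integral>\<^sup>+ z. A n z + ennreal C * ennreal \<bar>moll n w z - w z\<bar> \<partial>lborel)"
      by (intro nn_integral_mono)
    also have "\<dots> = (\<integral>\<^sup>+ z. A n z \<partial>lborel) + ennreal C * b n"
      by (simp add: nn_integral_add nn_integral_cmult b_def)
    finally show ?thesis using c[OF n] by simp
  qed
  have b0: "(\<lambda>n. ennreal C * b (r n)) \<longlonglongrightarrow> 0"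
  proof -
    have "b \<longlonglongrightarrow> 0" unfolding b_def by (rule moll_tendsto_L1[OF w(1)])
    then have "(\<lambda>n. b (r n)) \<longlonglongrightarrow> 0" using r LIMSEQ_subseq_LIMSEQ[of b 0 r] by (simp add: o_def)
    then have "(\<lambda>n. ennreal C * b (r n)) \<longlonglongrightarrow> ennreal C * 0"
      by (intro ennreal_tendsto_cmult) auto
    then show ?thesis by simp
  qed
  define L where "L = limsup (\<lambda>n. \<integral>\<^sup>+ z. A (r n) z \<partial>lborel)"
  have "L \<le> (\<integral>\<^sup>+ z. limsup (\<lambda>n. A (r n) z) \<partial>lborel)"
    unfolding L_def by (rule nn_integral_limsup[OF _ _ _ wfin]) (auto simp: A_def)
  also have "\<dots> \<le> (\<integral>\<^sup>+ z. g z \<partial>lborel)"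
  proof (rule nn_integral_mono_AE)
    show "AE z in lborel. limsup (\<lambda>n. A (r n) z) \<le> g z"
      using lim
    proof eventually_elim
      case (elim z)
      have "limsup (\<lambda>n. A (r n) z) \<le> limsup (\<lambda>n. G (r n) z)"
        by (intro Limsup_mono always_eventually) (auto simp: A_def)
      then show ?case using elim by (rule order_trans)
    qed
  qed
  finally have Lg: "L \<le> (\<integral>\<^sup>+ z. g z \<partial>lborel)" .
  have "c \<le> L"
  proof (rule ennreal_le_epsilon)
    fix e :: real assume e: "L < top" "0 < e"
    have "L < L + ennreal (e / 2)"
    proof (cases L)
      case (real l)
      then show ?thesis using e by (simp add: ennreal_lessI flip: ennreal_plus)
    qed (use e in simp)
    then have "\<forall>\<^sub>F n in sequentially. (\<integral>\<^sup>+ z. A (r n) z \<partial>lborel) < L + ennreal (e / 2)"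
      unfolding L_def by (rule Limsup_lessD)
    moreover have "\<forall>\<^sub>F n in sequentially. ennreal C * b (r n) < ennreal (e / 2)"
      using b0 e by (intro order_tendstoD(2)) auto
    moreover have "\<forall>\<^sub>F n in sequentially. N \<le> r n"
      using eventually_ge_at_top[of N] by eventually_elim (use seq_suble[OF r] order_trans in blast)
    ultimately have "\<forall>\<^sub>F n in sequentially. c \<le> L + ennreal e"
    proof eventually_elim
      case (elim n)
      have "c \<le> (L + ennreal (e / 2)) + ennreal (e / 2)"
        using split[OF elim(3)] elim(1,2) by (meson add_mono less_imp_le order_trans)
      also have "\<dots> = L + ennreal (e / 2 + e / 2)"
        using e by (subst ennreal_plus) (auto simp: add.assoc)
      finally show ?case by simp
    qed
    then show "c \<le> L + ennreal e" by simp
  qed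
  then show ?thesis using Lg by simp
qed

lemma tendsto_det:
  fixes B :: "'i \<Rightarrow> real^'n^'n"
  assumes "\<And>i j. ((\<lambda>n. B n $ i $ j) \<longlongrightarrow> \<beta> $ i $ j) F"
  shows "((\<lambda>n. det (B n)) \<longlongrightarrow> det \<beta>) F"
  unfolding det_def by (intro tendsto_intros assms)

text \<open>
  The conditions on \<open>A n\<close> and \<open>B n\<close> are closed, so where they hold infinitely often they hold in the limit; elsewhere
  the terms are eventually 0. Symmetry of the limit is inherited from the \<open>B n\<close>.
\<close>

lemma contact_limsup_le:
  fixes A :: "nat \<Rightarrow> real" and B :: "nat \<Rightarrow> real^'n^'n"
  assumes A: "A \<longlonglongrightarrow> \<alpha>" and B: "\<And>i j. (\<lambda>n. B n $ i $ j) \<longlonglongrightarrow> \<beta> $ i $ j"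
    and sym: "\<And>n. transpose (B n) = B n"
  shows "limsup (\<lambda>n. ennreal \<bar>A n * det (B n)\<bar> * (if A n \<le> 0 \<and> nonneg_definite (- B n) then 1 else 0))
    \<le> ennreal \<bar>\<alpha> * det \<beta>\<bar> * (if \<alpha> \<le> 0 \<and> nonneg_definite (- \<beta>) \<and> transpose \<beta> = \<beta> then 1 else 0)"
    (is "limsup ?l \<le> _")
proof -
  have symb: "transpose \<beta> = \<beta>"
  proof -
    have "\<beta> $ j $ i = \<beta> $ i $ j" for i j
    proof (rule LIMSEQ_unique[OF B])
      have "B n $ j $ i = B n $ i $ j" for n
        using arg_cong[OF sym[of n], of "\<lambda>m. m $ i $ j"] by (simp add: transpose_def)
      then show "(\<lambda>n. B n $ j $ i) \<longlonglongrightarrow> \<beta> $ i $ j" using B[of i j] by simp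
    qed
    then show ?thesis by (simp add: transpose_def vec_eq_iff)
  qed
  show ?thesis
  proof (cases "\<alpha> \<le> 0 \<and> nonneg_definite (- \<beta>)")
    case True
    have "limsup ?l \<le> limsup (\<lambda>n. ennreal \<bar>A n * det (B n)\<bar>)"
      by (intro Limsup_mono always_eventually) auto
    also have "\<dots> = ennreal \<bar>\<alpha> * det \<beta>\<bar>"
      by (intro lim_imp_Limsup tendsto_ennrealI tendsto_rabs tendsto_mult A tendsto_det B) auto
    finally show ?thesis using True symb by simp
  next
    case False
    have "\<forall>\<^sub>F n in sequentially. \<not> (A n \<le> 0 \<and> nonneg_definite (- B n))"
    proof (cases "\<alpha> \<le> 0")
      case True
      then obtain \<xi> where \<xi>: "\<xi> \<bullet> ((- \<beta>) *v \<xi>) < 0"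
        using False by (auto simp: nonneg_definite_def not_le)
      have "(\<lambda>n. \<xi> \<bullet> ((- B n) *v \<xi>)) \<longlonglongrightarrow> \<xi> \<bullet> ((- \<beta>) *v \<xi>)"
        unfolding matrix_vector_mult_def inner_vec_def
        by (simp, intro tendsto_intros B)
      then have "\<forall>\<^sub>F n in sequentially. \<xi> \<bullet> ((- B n) *v \<xi>) < 0"
        using \<xi> by (rule order_tendstoD(2))
      then show ?thesis by eventually_elim (auto simp: nonneg_definite_def not_le)
    next
      case False
      then have "\<forall>\<^sub>F n in sequentially. 0 < A n" using A by (intro order_tendstoD(1)) auto
      then show ?thesis by eventually_elim auto
    qed
    then have "\<forall>\<^sub>F n in sequentially. ?l n \<le> 0" by eventually_elim auto
    then have "limsup ?l \<le> 0" by (rule Limsup_bounded)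
    then show ?thesis by simp
  qed
qed

lemma moll_abs_le:
  fixes h s :: "'a::euclidean_space \<Rightarrow> real"
  assumes n: "0 < n" and h: "integrable lborel h" and s: "integrable lborel s" and le: "\<And>y. \<bar>h y\<bar> \<le> s y"
  shows "\<bar>moll n h z\<bar> \<le> moll n s z"
proof -
  have "norm (moll n h z) \<le> (LINT y|lborel. norm (h y * mollifier n (z - y)))"
    unfolding moll_def by (rule integral_norm_bound)
  also have "\<dots> \<le> moll n s z"
    unfolding moll_def
    by (intro integral_mono integrable_norm moll_integrable[OF n] h s)
      (simp add: abs_mult mollifier_nonneg[OF n] mult_right_mono le)
  finally show ?thesis by simp
qed

lemma interior_cylinder: "interior (cylinder T) = {0<..<T} \<times> ball (0 :: real^'n) 1"
  by (simp add: cylinder_def interior_Times)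

lemma closure_cylinder: "0 < T \<Longrightarrow> closure (cylinder T) = {0..T} \<times> cball (0 :: real^'n) 1"
  by (simp add: cylinder_def closure_Times)

text \<open>
  The mollified function is an integral over a box that contains the cylinder. Composing with the nearest point
  projection onto the convex closure of the cylinder provides continuous values on the rest of the box.
\<close>

lemma continuous_extension_cylinder:
  fixes u :: "real \<times> (real^'n) \<Rightarrow> real"
  assumes "0 < T" and u: "continuous_on (closure (cylinder T)) u"
  obtains f where "\<And>X. continuous_on X f" "\<And>z. z \<in> closure (cylinder T) \<Longrightarrow> f z = u z"
proof -
  let ?CL = "closure (cylinder T :: (real \<times> (real^'n)) set)"
  have cCL: "convex ?CL" "closed ?CL" "?CL \<noteq> {}"
    using \<open>0 < T\<close> by (auto simp: closure_cylinder intro!: convex_Times closed_Times)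
  define f where "f z = u (closest_point ?CL z)" for z
  have "continuous_on X f" for X
    unfolding f_def
    by (rule continuous_on_compose2[OF u continuous_on_closest_point[OF cCL]])
      (use closest_point_in_set[OF cCL(2,3)] in auto)
  moreover have "f z = u z" if "z \<in> ?CL" for z
    using closest_point_self[OF that] by (simp add: f_def)
  ultimately show ?thesis using that by blast
qed

text \<open>
  The time derivative and all second spatial derivatives are treated as one finite family, indexed by an option
  type, with \<open>None\<close> for time.
\<close>

fun dirs :: "('n \<times> 'n) option \<Rightarrow> (real \<times> (real^'n)) list" where
  "dirs None = [dir_t]"
| "dirs (Some (i, j)) = [dir_x i, dir_x j]"

definition hessian :: "(('n::finite \<times> 'n) option \<Rightarrow> 'z \<Rightarrow> real) \<Rightarrow> 'z \<Rightarrow> real^'n^'n" where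
  "hessian h z = (\<chi> i j. h (Some (i, j)) z)"

definition contact_set :: "(('n::finite \<times> 'n) option \<Rightarrow> 'z \<Rightarrow> real) \<Rightarrow> 'z set" where
  "contact_set h = {z. h None z \<le> 0 \<and> nonneg_definite (- hessian h z) \<and> transpose (hessian h z) = hessian h z}"

text \<open>
  The contact estimate for the mollifications of \<open>u\<close> has the same left-hand side for every large \<open>n\<close>. The
  hypotheses leave the slack between \<open>M / 16\<close> and \<open>M / 8\<close>, and between \<open>7 / 8 * M\<close> and \<open>M\<close>, for the uniform distance
  of \<open>u\<close> and its mollification.
\<close>

theorem planes_le_sobolev_contact_integral:
  fixes u :: "real \<times> (real^'n) \<Rightarrow> real" and h :: "('n \<times> 'n) option \<Rightarrow> real \<times> (real^'n) \<Rightarrow> real"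
  assumes T: "0 < t0" "t0 \<le> T1" "T1 < T" and R: "R < 1" and x0: "x0 \<in> cball 0 R" and M: "0 < M"
    and u: "continuous_on (closure (cylinder T)) u"
    and h: "\<And>k. has_weak_deriv (interior (cylinder T)) (dirs k) u (h k)"
    and hL: "\<And>k. h k \<in> Lp_loc_cylinder (real CARD('n) + 1) T"
    and above: "s + M \<le> u (t0, x0)"
    and top: "\<And>x. x \<in> cball 0 R \<Longrightarrow> u (T1, x) \<le> s"
    and side: "\<And>t x. t \<in> {t0..T1} \<Longrightarrow> norm x = R \<Longrightarrow> u (t, x) \<le> s"
    and near: "\<And>t x. t \<in> {t0..T1} \<Longrightarrow> x \<in> cball 0 R \<Longrightarrow> psi x \<le> \<kappa> \<Longrightarrow> u (t, x) \<le> s + M / 16"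
  shows "ennreal (ball_constant CARD('n) * (M / sqrt (psi x0)) ^ (CARD('n) + 1))
    \<le> (\<integral>\<^sup>+ z. ennreal \<bar>h None z * det (hessian h z)\<bar> *
        indicator ({z \<in> {t0..T1} \<times> cball 0 R. \<kappa> \<le> psi (snd z)} \<inter> contact_set h) z \<partial>lebesgue)"
    (is "?c \<le> _")
proof -
  let ?\<Omega> = "interior (cylinder T :: (real \<times> (real^'n)) set)"
  let ?CL = "closure (cylinder T :: (real \<times> (real^'n)) set)"
  define Q where "Q = {t0..T1} \<times> cball (0 :: real^'n) R"
  have "0 < T" using T by simp
  note \<Omega> = interior_cylinder[of T, where 'n='n]
  have Q\<Omega>: "Q \<subseteq> ?\<Omega>" unfolding \<Omega> using T R by (auto simp: Q_def)
  have \<Omega>CL: "?\<Omega> \<subseteq> ?CL" using interior_subset closure_subset by blast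

  obtain f where fc: "\<And>X. continuous_on X f" and fu: "\<And>z. z \<in> ?CL \<Longrightarrow> f z = u z"
    using continuous_extension_cylinder[OF \<open>0 < T\<close> u] by blast
  have "bounded ?\<Omega>" unfolding \<Omega> by (intro bounded_Times) auto
  then obtain b where b: "?\<Omega> \<subseteq> cbox (- b) b" using bounded_subset_cbox_symmetric by blast

  \<comment> \<open>For all small \<open>\<epsilon>\<close> the derivatives are in \<open>L_p\<close> on \<open>S \<epsilon>\<close>. The second condition on \<open>\<epsilon>\<close> leaves room
    for the supports of the mollifiers centred at points of \<open>Q\<close>.\<close>
  define S where "S \<epsilon> = {\<epsilon>..<T - \<epsilon>} \<times> ball (0 :: real^'n) (1 - \<epsilon>)" for \<epsilon>
  have "\<forall>\<^sub>F \<epsilon> in at_right 0. \<forall>k. h k \<in> Lp_on (real CARD('n) + 1) (S \<epsilon>)"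
    using hL by (intro eventually_all_finite) (auto simp: Lp_loc_cylinder_def S_def)
  moreover have "\<forall>\<^sub>F \<epsilon> in at_right 0. \<epsilon> < min (t0 / 2) (min ((T - T1) / 2) ((1 - R) / 2))"
    using T R by (intro eventually_at_rightI[of 0 "min (t0 / 2) (min ((T - T1) / 2) ((1 - R) / 2))"]) auto
  moreover have "\<forall>\<^sub>F \<epsilon> in at_right (0::real). 0 < \<epsilon>" by (simp add: eventually_at_right_less)
  ultimately have "\<forall>\<^sub>F \<epsilon> in at_right (0::real). (\<forall>k. h k \<in> Lp_on (real CARD('n) + 1) (S \<epsilon>)) \<and>
      \<epsilon> < min (t0 / 2) (min ((T - T1) / 2) ((1 - R) / 2)) \<and> 0 < \<epsilon>"
    by eventually_elim auto
  then obtain \<epsilon> where \<epsilon>: "\<And>k. h k \<in> Lp_on (real CARD('n) + 1) (S \<epsilon>)" "\<epsilon> < t0 / 2" "\<epsilon> < (T - T1) / 2"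
    "\<epsilon> < (1 - R) / 2" "0 < \<epsilon>"
    using eventually_happens'[OF trivial_limit_at_right_real[of 0]] by auto
  have SB: "S \<epsilon> \<in> sets borel" unfolding S_def by (intro borel_Times) auto
  have "bounded (S \<epsilon>)" unfolding S_def by (intro bounded_Times) auto
  then have Sfin: "emeasure lborel (S \<epsilon>) < \<infinity>" by (rule emeasure_bounded_finite)
  have nbh: "cball z \<rho> \<subseteq> S \<epsilon> \<inter> ?\<Omega>" if "z \<in> Q" "\<rho> < \<epsilon>" for z \<rho>
  proof
    fix y assume y: "y \<in> cball z \<rho>"
    have "dist (fst z) (fst y) \<le> \<rho>" using y dist_fst_le[of z y] by simp
    moreover have "norm (snd y) \<le> norm (snd z) + \<rho>"
      using y dist_snd_le[of z y] norm_triangle_ineq[of "snd z" "snd y - snd z"]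
      by (simp add: dist_norm norm_minus_commute)
    ultimately show "y \<in> S \<epsilon> \<inter> ?\<Omega>"
      using that \<epsilon>(2-5) unfolding \<Omega> by (cases y) (auto simp: Q_def S_def dist_real_def)
  qed

  have "\<exists>h'. integrable lborel h' \<and> integrable lborel (\<lambda>z. \<bar>h' z\<bar> ^ (CARD('n) + 1)) \<and>
      (AE z in lebesgue. z \<in> S \<epsilon> \<longrightarrow> h' z = h k z)" for k
    by (rule Lp_borel_version_on[OF SB Sfin \<epsilon>(1)[of k]]) blast
  then have "\<exists>h'. \<forall>k. integrable lborel (h' k) \<and> integrable lborel (\<lambda>z. \<bar>h' k z\<bar> ^ (CARD('n) + 1)) \<and>
      (AE z in lebesgue. z \<in> S \<epsilon> \<longrightarrow> h' k z = h k z)"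
    by (intro choice allI)
  then obtain h' where h': "\<And>k. integrable lborel (h' k)" "\<And>k. integrable lborel (\<lambda>z. \<bar>h' k z\<bar> ^ (CARD('n) + 1))"
    "\<And>k. AE z in lebesgue. z \<in> S \<epsilon> \<longrightarrow> h' k z = h k z"
    by blast
  \<comment> \<open>\<open>\<sigma>\<close> bounds all derivatives at once, so its mollification bounds all mollified derivatives,
    and \<open>w\<close> will dominate the products of \<open>d + 1\<close> of them.\<close>
  define \<sigma> where "\<sigma> z = (\<Sum>k\<in>UNIV. \<bar>h' k z\<bar>)" for z
  have \<sigma>0: "0 \<le> \<sigma> z" for z by (simp add: \<sigma>_def sum_nonneg)
  have \<sigma>i: "integrable lborel \<sigma>" unfolding \<sigma>_def by (intro Bochner_Integration.integrable_sum integrable_abs h')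
  define w where "w z = \<sigma> z ^ (CARD('n) + 1)" for z
  have w0: "0 \<le> w z" for z using \<sigma>0 by (simp add: w_def del: power_Suc power_add)
  have wi: "integrable lborel w"
  proof (rule Bochner_Integration.integrable_bound)
    let ?m = "real CARD(('n \<times> 'n) option)"
    let ?b = "\<lambda>z. ?m ^ (CARD('n) + 1) * (\<Sum>k\<in>UNIV. \<bar>h' k z\<bar> ^ (CARD('n) + 1))"
    show "integrable lborel ?b"
      by (intro integrable_mult_right Bochner_Integration.integrable_sum h')
    show "w \<in> borel_measurable lborel" unfolding w_def using \<sigma>i by measurable
    have "norm (w z) \<le> norm (?b z)" for z
    proof -
      have "w z \<le> ?b z" unfolding w_def \<sigma>_def by (rule sum_power_le) auto
      also have "\<dots> \<le> norm (?b z)" unfolding real_norm_def by (rule abs_ge_self)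
      finally show ?thesis using w0[of z] by (simp only: real_norm_def abs_of_nonneg)
    qed
    then show "AE z in lborel. norm (w z) \<le> norm (?b z)" by (intro AE_I2)
  qed

  define D where "D n k z = conv (- b) b f (partials (dirs k) (mollifier n)) z" for n k z
  obtain N1 :: nat where N1: "0 < N1" "1 / real N1 < \<epsilon>"
    using nat_approx_posE[OF \<epsilon>(5)] by (metis zero_less_Suc)
  have "uniformly_continuous_on (cbox (- b) b) f"
    by (intro compact_uniformly_continuous fc compact_cbox)
  then obtain d where d: "0 < d" "\<And>y z. y \<in> cbox (- b) b \<Longrightarrow> z \<in> cbox (- b) b \<Longrightarrow> dist y z < d \<Longrightarrow> dist (f y) (f z) < M / 32"
    unfolding uniformly_continuous_on_def
    by (elim allE[of _ "M / 32"]) (use M in \<open>auto simp: dist_commute\<close>)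
  obtain N2 :: nat where N2: "0 < N2" "1 / real N2 < d"
    using nat_approx_posE[OF d(1)] by (metis zero_less_Suc)
  define N where "N = max N1 N2"
  have Nn: "0 < n" "1 / real n < \<epsilon>" "1 / real n < d" if "n \<ge> N" for n
  proof -
    show n: "0 < n" using that N1 by (simp add: N_def)
    have "1 / real n \<le> 1 / real N1" "1 / real n \<le> 1 / real N2"
      using that N1 N2 n by (auto simp: N_def intro!: divide_left_mono)
    then show "1 / real n < \<epsilon>" "1 / real n < d" using N1 N2 by auto
  qed
  have Dmoll: "D n k z = moll n (h' k) z" if "n \<ge> N" "z \<in> Q" for n k z
    unfolding D_def
  proof (rule conv_partials_mollifier[OF fc Nn(1)[OF that(1)] b])
    have c: "cball z (1 / real n) \<subseteq> S \<epsilon> \<inter> ?\<Omega>" by (rule nbh[OF that(2) Nn(2)[OF that(1)]])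
    then show "cball z (1 / real n) \<subseteq> ?\<Omega>" by simp
    show "f y = u y" if "y \<in> ?\<Omega>" for y using fu \<Omega>CL that by blast
    show "AE y in lebesgue. y \<in> cball z (1 / real n) \<longrightarrow> h' k y = h k y"
      using h'(3)[of k] c by (auto elim!: eventually_mono)
  qed (use h h' in auto)
  have close: "\<bar>conv (- b) b f (mollifier n) z - u z\<bar> \<le> M / 32" if "n \<ge> N" "z \<in> Q" for n z
  proof -
    have c: "cball z (1 / real n) \<subseteq> cbox (- b) b" using nbh[OF that(2) Nn(2)[OF that(1)]] b by blast
    have "z \<in> ?CL" using that Q\<Omega> \<Omega>CL by blast
    then have "f z = u z" by (rule fu)
    moreover have "\<bar>conv (- b) b f (mollifier n) z - f z\<bar> \<le> M / 32"
    proof (rule conv_mollifier_near[OF fc Nn(1)[OF that(1)] c])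
      fix y assume y: "y \<in> cball z (1 / real n)"
      have "z \<in> cball z (1 / real n)" by simp
      then have "dist (f y) (f z) < M / 32"
        using y c Nn(3)[OF that(1)] by (intro d(2)) (auto simp: dist_commute)
      then show "\<bar>f y - f z\<bar> \<le> M / 32" by (simp add: dist_real_def)
    qed
    ultimately show ?thesis by simp
  qed

  define P where "P n = {z \<in> Q. \<kappa> \<le> psi (snd z) \<and> D n None z \<le> 0 \<and> nonneg_definite (- hessian (D n) z)}" for n
  define G where "G n z = ennreal \<bar>D n None z * det (hessian (D n) z)\<bar> * indicator (P n) z" for n z
  have Dc: "continuous_on UNIV (D n k)" for n k
    unfolding D_def by (intro conv_continuous fc smooth_fun_partials smooth_fun_mollifier)
  have main: "compact (P n) \<and> ?c \<le> (\<integral>\<^sup>+ z. G n z \<partial>lborel)" if n: "n \<ge> N" for n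
  proof -
    have in_Q: "(t, x) \<in> Q" if "t \<in> {t0..T1}" "x \<in> cball 0 R" for t x using that by (simp add: Q_def)
    have a: "s + 7/8 * M < conv (- b) b f (mollifier n) (t0, x0)"
      using close[OF n in_Q[of t0 x0]] above T x0 M unfolding abs_le_iff by simp
    have t: "conv (- b) b f (mollifier n) (T1, x) < s + M / 8" if "x \<in> cball 0 R" for x
      using close[OF n in_Q[of T1 x]] top[OF that] T that M unfolding abs_le_iff by simp
    have sd: "conv (- b) b f (mollifier n) (t, x) < s + M / 8"
      if "t \<in> {t0..T1}" "x \<in> cball 0 R" "norm x = R \<or> psi x \<le> \<kappa>" for t x
    proof -
      have "u (t, x) \<le> s + M / 16" using side[of t x] near[of t x] that M by fastforce
      then show ?thesis using close[OF n in_Q[OF that(1,2)]] M unfolding abs_le_iff by simp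
    qed
    show ?thesis
      using compact_contact_set[OF fc smooth_fun_mollifier T(2) R x0 M a t sd]
        planes_le_contact_integral[OF fc smooth_fun_mollifier T(2) R x0 M a t sd]
      unfolding P_def G_def D_def hessian_def Q_def by simp
  qed

  obtain r :: "nat \<Rightarrow> nat" where r: "strict_mono r"
    "AE z in lborel. \<forall>k. (\<lambda>n. moll (r n) (h' k) z) \<longlonglongrightarrow> h' k z"
    by (rule moll_AE_subsequence[of h', OF h'(1)]) blast
  define g where "g z = ennreal \<bar>h' None z * det (hessian h' z)\<bar> *
    indicator ({z \<in> Q. \<kappa> \<le> psi (snd z)} \<inter> contact_set h') z" for z
  have symD: "transpose (hessian (D n) z) = hessian (D n) z" for n z
  proof -
    have "D n (Some (i, j)) z = D n (Some (j, i)) z" for i j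
      using mollifier_pd_commute[where e="dir_x j" and e'="dir_x i" and n=n] by (simp add: D_def)
    then show ?thesis by (simp add: transpose_def hessian_def vec_eq_iff)
  qed
  have "AE z in lborel. limsup (\<lambda>n. G (r (n + N)) z) \<le> g z"
    using r(2)
  proof eventually_elim
    case (elim z)
    show ?case
    proof (cases "z \<in> Q \<and> \<kappa> \<le> psi (snd z)")
      case True
      have rN: "N \<le> r (n + N)" for n using seq_suble[OF r(1), of "n + N"] by simp
      have "(\<lambda>n. moll (r (n + N)) (h' k) z) \<longlonglongrightarrow> h' k z" for k
        using LIMSEQ_ignore_initial_segment[of "\<lambda>n. moll (r n) (h' k) z" _ N] elim by simp
      then have lim: "(\<lambda>n. D (r (n + N)) k z) \<longlonglongrightarrow> h' k z" for k
        using Dmoll[OF rN, of z] True by simp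
      have "limsup (\<lambda>n. ennreal \<bar>D (r (n + N)) None z * det (hessian (D (r (n + N))) z)\<bar> *
          (if D (r (n + N)) None z \<le> 0 \<and> nonneg_definite (- hessian (D (r (n + N))) z) then 1 else 0))
        \<le> ennreal \<bar>h' None z * det (hessian h' z)\<bar> *
          (if h' None z \<le> 0 \<and> nonneg_definite (- hessian h' z) \<and> transpose (hessian h' z) = hessian h' z then 1 else 0)"
        by (rule contact_limsup_le) (auto simp: symD lim, simp add: hessian_def lim)
      then show ?thesis
        using True by (simp add: G_def g_def P_def contact_set_def indicator_def of_bool_def)
    next
      case False
      then have "G n z = 0" for n by (auto simp: G_def P_def)
      then show ?thesis by (simp add: Limsup_const)
    qed
  qed
  note lim = this
  have Gle: "G n z \<le> ennreal (fact CARD('n) * moll n w z)" if n: "n \<ge> N" for n z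
  proof (cases "z \<in> P n")
    case False
    then show ?thesis by (simp add: G_def)
  next
    case True
    then have zQ: "z \<in> Q" by (simp add: P_def)
    have le: "\<bar>D n k z\<bar> \<le> moll n \<sigma> z" for k
      unfolding Dmoll[OF n zQ]
      by (rule moll_abs_le[OF Nn(1)[OF n] h'(1) \<sigma>i]) (auto simp: \<sigma>_def intro: member_le_sum)
    have "\<bar>det (hessian (D n) z)\<bar> \<le> fact CARD('n) * moll n \<sigma> z ^ CARD('n)"
      by (rule abs_det_le_entries) (simp add: hessian_def le)
    then have "\<bar>D n None z * det (hessian (D n) z)\<bar> \<le> moll n \<sigma> z * (fact CARD('n) * moll n \<sigma> z ^ CARD('n))"
      unfolding abs_mult by (rule mult_mono[OF le]) (use order_trans[OF abs_ge_zero le[of None]] in auto)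
    also have "\<dots> = fact CARD('n) * moll n \<sigma> z ^ (CARD('n) + 1)" by simp
    also have "\<dots> \<le> fact CARD('n) * moll n w z"
      unfolding w_def
      by (intro mult_left_mono moll_power_le[OF Nn(1)[OF n] \<sigma>i \<sigma>0] wi[unfolded w_def[abs_def]]) simp
    finally show ?thesis using True by (simp add: G_def ennreal_leI)
  qed
  \<comment> \<open>Below index \<open>N\<close> the mollifiers may reach beyond \<open>S \<epsilon>\<close> and nothing is known about \<open>P n\<close>; setting the
    integrand to 0 there makes it measurable for every index.\<close>
  define G' where "G' n z = (if n \<ge> N then G n z else 0)" for n z
  have rm: "strict_mono (\<lambda>n. r (n + N))" using r(1) by (simp add: strict_mono_def)
  have rN: "N \<le> r (n + N)" for n using seq_suble[OF r(1), of "n + N"] by simp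
  have "?c \<le> (\<integral>\<^sup>+ z. g z \<partial>lborel)"
  proof (rule le_nn_integral_limit_mollified_bound[OF wi w0 _ _ _ _ rm])
    show "G' n \<in> borel_measurable borel" for n
    proof (cases "n \<ge> N")
      case True
      have [measurable]: "P n \<in> sets borel" using main[OF True] by (simp add: borel_compact)
      have [measurable]: "D n k \<in> borel_measurable borel" for k
        by (rule borel_measurable_continuous_onI[OF Dc])
      have "G n \<in> borel_measurable borel"
        unfolding G_def det_def hessian_def by simp measurable
      then show ?thesis using True by (simp add: G'_def[abs_def])
    qed (simp add: G'_def[abs_def])
    show "G' n z \<le> ennreal (fact CARD('n) * moll n w z)" if "n \<ge> N" for n z
      using Gle[OF that] that by (simp add: G'_def)
    show "?c \<le> (\<integral>\<^sup>+ z. G' n z \<partial>lborel)" if "n \<ge> N" for n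
      using main[OF that] that by (simp add: G'_def)
    show "AE z in lborel. limsup (\<lambda>n. G' (r (n + N)) z) \<le> g z"
      using lim by (simp add: G'_def rN)
  qed simp
  also have "\<dots> = (\<integral>\<^sup>+ z. g z \<partial>lebesgue)" by (simp add: nn_integral_completion)
  also have "\<dots> = (\<integral>\<^sup>+ z. ennreal \<bar>h None z * det (hessian h z)\<bar> *
        indicator ({z \<in> {t0..T1} \<times> cball 0 R. \<kappa> \<le> psi (snd z)} \<inter> contact_set h) z \<partial>lebesgue)"
  proof (rule nn_integral_cong_AE)
    have "AE z in lebesgue. \<forall>k. z \<in> S \<epsilon> \<longrightarrow> h' k z = h k z"
      by (intro AE_all_countable[THEN iffD2] allI h'(3))
    then show "AE z in lebesgue. g z = ennreal \<bar>h None z * det (hessian h z)\<bar> *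
        indicator ({z \<in> {t0..T1} \<times> cball 0 R. \<kappa> \<le> psi (snd z)} \<inter> contact_set h) z"
    proof eventually_elim
      case (elim z)
      show ?case
      proof (cases "z \<in> Q")
        case True
        have "z \<in> S \<epsilon>" using nbh[OF True, of 0] \<epsilon>(5) by auto
        then have "h' k z = h k z" for k using elim by simp
        then show ?thesis by (simp add: g_def Q_def contact_set_def hessian_def indicator_def)
      next
        case False
        then show ?thesis by (simp add: g_def Q_def indicator_def)
      qed
    qed
  qed
  finally show ?thesis .
qed

section \<open>The weighted estimate\<close>

text \<open>
  This direction holds for arbitrary integrands: dividing a simple function below \<open>k * f\<close> by \<open>k\<close> gives a
  measurable function below \<open>f\<close>.
\<close>

lemma nn_integral_cmult_le:
  assumes "0 < k"
  shows "(\<integral>\<^sup>+ z. ennreal k * f z \<partial>M) \<le> ennreal k * (\<integral>\<^sup>+ z. f z \<partial>M)"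
  unfolding nn_integral_def[of M "\<lambda>z. ennreal k * f z"]
proof (rule SUP_least, clarify)
  fix g assume g: "simple_function M g" "g \<le> (\<lambda>z. ennreal k * f z)"
  have [measurable]: "g \<in> borel_measurable M" using g(1) by (rule borel_measurable_simple_function)
  have inv: "ennreal k * (ennreal (1 / k) * y) = y" "ennreal (1 / k) * (ennreal k * y) = y" for y
    using assms by (simp_all add: mult.assoc[symmetric] ennreal_mult[symmetric])
  have "integral\<^sup>S M g = (\<integral>\<^sup>+ z. ennreal k * (ennreal (1 / k) * g z) \<partial>M)"
    using nn_integral_eq_simple_integral[OF g(1)] by (simp add: inv)
  also have "\<dots> = ennreal k * (\<integral>\<^sup>+ z. ennreal (1 / k) * g z \<partial>M)"
    by (rule nn_integral_cmult) measurable
  also have "\<dots> \<le> ennreal k * (\<integral>\<^sup>+ z. f z \<partial>M)"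
  proof (intro mult_left_mono nn_integral_mono)
    fix z
    have "ennreal (1 / k) * g z \<le> ennreal (1 / k) * (ennreal k * f z)"
      using g(2) by (intro mult_left_mono) (auto simp: le_fun_def)
    then show "ennreal (1 / k) * g z \<le> f z" by (simp add: inv)
  qed simp
  finally show "integral\<^sup>S M g \<le> ennreal k * (\<integral>\<^sup>+ z. f z \<partial>M)" .
qed

text \<open>
  \<open>(1 / 16) powr (1 / \<beta>)\<close> is the number whose power with exponent \<open>\<beta>\<close> is \<open>1 / 16\<close>; contact points satisfy
  \<open>psi x \<ge> (1 / 16) powr (1 / \<beta>) * psi x0\<close>. The remaining factors are those of the determinant inequality and of the
  volume bound.
\<close>

definition estimate_constant :: "nat \<Rightarrow> real \<Rightarrow> real \<Rightarrow> real" where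
  "estimate_constant d \<alpha> \<beta> =
     (fact d * ((1 / 16) powr (1 / \<beta>)) powr (- \<alpha>) / ball_constant d) powr (1 / (real d + 1))"

lemma estimate_constant_pos: "0 < estimate_constant d \<alpha> \<beta>"
  using ball_constant_pos[of d] by (simp add: estimate_constant_def)

text \<open>
  The contact estimate is applied at the point where \<open>(u - s) / psi powr \<beta>\<close> is largest. Cylinders that stay away
  from the boundary have a positive \<open>psi\<close>, so the quotient is continuous up to the boundary and attains its maximum.
\<close>

theorem interior_weighted_estimate:
  fixes u :: "real \<times> (real^'n) \<Rightarrow> real" and h :: "('n \<times> 'n) option \<Rightarrow> real \<times> (real^'n) \<Rightarrow> real"
    and a :: "real \<times> (real^'n) \<Rightarrow> real^'n^'n"
  assumes \<alpha>: "0 \<le> \<alpha>" "\<alpha> < (real CARD('n) + 1) / 2"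
    and \<beta>: "\<beta> = 1 / 2 - \<alpha> / (real CARD('n) + 1)"
    and T: "0 < ta" "ta \<le> T1" "T1 < T" and R: "R < 1"
    and a: "\<And>z. z \<in> cylinder T \<Longrightarrow> transpose (a z) = a z \<and> nonneg_definite (a z)"
    and r: "\<And>z. z \<in> cylinder T \<Longrightarrow> 0 \<le> r z" "\<And>z. z \<in> cylinder T \<Longrightarrow> 0 < r z + trace (a z)"
    and u: "continuous_on (closure (cylinder T)) u"
    and h: "\<And>k. has_weak_deriv (interior (cylinder T)) (dirs k) u (h k)"
    and hL: "\<And>k. h k \<in> Lp_loc_cylinder (real CARD('n) + 1) T"
    and ut: "has_weak_deriv (interior (cylinder T)) [dir_t] u ut"
    and D2u: "\<And>i j. has_weak_deriv (interior (cylinder T)) [dir_x i, dir_x j] u (D2u i j)"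
    and top: "\<And>x. x \<in> cball 0 R \<Longrightarrow> u (T1, x) \<le> s"
    and side: "\<And>t x. t \<in> {ta..T1} \<Longrightarrow> norm x = R \<Longrightarrow> u (t, x) \<le> s"
    and I: "weighted_integral \<alpha> T r a (L0 r a ut D2u) = ennreal I" "0 \<le> I"
    and tx: "t \<in> {ta..T1}" "x \<in> cball 0 R"
  shows "u (t, x) \<le> s + estimate_constant CARD('n) \<alpha> \<beta> * psi x powr \<beta> * I powr (1 / (real CARD('n) + 1))"
proof -
  let ?d = "real CARD('n) + 1"
  let ?N = "estimate_constant CARD('n) \<alpha> \<beta>"
  have \<beta>0: "0 < \<beta>" using \<alpha>(2) unfolding \<beta> by (simp add: field_simps)
  define Q where "Q = {ta..T1} \<times> cball (0 :: real^'n) R"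
  have Qc: "compact Q" unfolding Q_def by (intro compact_Times compact_Icc compact_cball)
  have "0 < T" using T by simp
  have Q\<Omega>: "Q \<subseteq> interior (cylinder T)" unfolding interior_cylinder using T R by (auto simp: Q_def)
  have Qcyl: "Q \<subseteq> cylinder T" using Q\<Omega> interior_subset by blast
  have psiQ: "0 < psi (snd z)" if "z \<in> Q" for z
    using that R by (intro psi_pos) (auto simp: Q_def)
  have uQ: "continuous_on Q u"
    using u Qcyl closure_subset by (meson continuous_on_subset order_trans)
  define \<phi> where "\<phi> z = (u z - s) / psi (snd z) powr \<beta>" for z
  have "continuous_on Q (\<lambda>z. psi (snd z))" unfolding psi_def by (intro continuous_intros)
  then have "continuous_on Q \<phi>"
    unfolding \<phi>_def
    by (intro continuous_on_divide continuous_on_diff continuous_on_powr continuous_on_const uQ) (use psiQ in fastforce)+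
  moreover have "(t, x) \<in> Q" using tx by (simp add: Q_def)
  then have "Q \<noteq> {}" by blast
  ultimately obtain zm where zm: "zm \<in> Q" "\<And>z. z \<in> Q \<Longrightarrow> \<phi> z \<le> \<phi> zm"
    using continuous_attains_sup[OF Qc] by blast
  \<comment> \<open>All of the estimate is applied at the one point where the quotient is largest.\<close>
  define K where "K = \<phi> zm"
  have uK: "u z \<le> s + K * psi (snd z) powr \<beta>" if "z \<in> Q" for z
    using zm(2)[OF that] psiQ[OF that] by (simp add: \<phi>_def K_def pos_divide_le_eq)
  have KI: "K \<le> ?N * I powr (1 / ?d)"
  proof (cases "K \<le> 0")
    case True
    have "0 \<le> ?N * I powr (1 / ?d)" using estimate_constant_pos[of "CARD('n)" \<alpha> \<beta>] by simp
    then show ?thesis using True by simp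
  next
    case False
    then have K: "0 < K" by simp
    obtain t0 x0 where z0: "zm = (t0, x0)" by fastforce
    have t0: "ta \<le> t0" "t0 \<le> T1" and x0: "x0 \<in> cball 0 R" using zm(1) by (auto simp: Q_def z0)
    define \<delta> where "\<delta> = psi x0"
    have \<delta>: "0 < \<delta>" using psiQ[OF zm(1)] by (simp add: \<delta>_def z0)
    define M where "M = K * \<delta> powr \<beta>"
    have M: "0 < M" using K \<delta> by (simp add: M_def)
    \<comment> \<open>Where \<open>psi x \<le> c0 * \<delta>\<close>, the bound by the quotient gives \<open>u - s \<le> M / 16\<close>, below the planes.\<close>
    define c0 where "c0 = (1 / 16) powr (1 / \<beta>)"
    have c0: "0 < c0" by (simp add: c0_def)
    have c0\<beta>: "c0 powr \<beta> = 1 / 16" using \<beta>0 by (simp add: c0_def powr_powr)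
    have "u (t0, x0) = s + M" using \<delta> by (simp add: M_def K_def \<phi>_def z0 \<delta>_def)
    then have above: "s + M \<le> u (t0, x0)" by simp
    have near: "u (t, x) \<le> s + M / 16" if "t \<in> {t0..T1}" "x \<in> cball 0 R" "psi x \<le> c0 * \<delta>" for t x
    proof -
      have zQ: "(t, x) \<in> Q" using that t0 by (auto simp: Q_def)
      have "psi x powr \<beta> \<le> (c0 * \<delta>) powr \<beta>"
        using that(3) psiQ[OF zQ] \<beta>0 by (intro powr_mono2) auto
      also have "\<dots> = \<delta> powr \<beta> / 16" using c0 \<delta> by (simp add: powr_mult c0\<beta>)
      finally have "K * psi x powr \<beta> \<le> M / 16" using K by (simp add: M_def)
      then show ?thesis using uK[OF zQ] by simp
    qed
    have lower: "ennreal (ball_constant CARD('n) * (M / sqrt \<delta>) ^ (CARD('n) + 1))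
      \<le> (\<integral>\<^sup>+ z. ennreal \<bar>h None z * det (hessian h z)\<bar> *
        indicator ({z \<in> {t0..T1} \<times> cball 0 R. c0 * \<delta> \<le> psi (snd z)} \<inter> contact_set h) z \<partial>lebesgue)"
      unfolding \<delta>_def
    proof (rule planes_le_sobolev_contact_integral[OF _ t0(2) T(3) R x0 M u h hL above top])
      show "0 < t0" using T t0 by simp
      show "u (t, x) \<le> s" if "t \<in> {t0..T1}" "norm x = R" for t x
        using side[of t x] that t0 by auto
      show "u (t, x) \<le> s + M / 16" if "t \<in> {t0..T1}" "x \<in> cball 0 R" "psi x \<le> c0 * psi x0" for t x
        using near[of t x] that by (simp add: \<delta>_def)
    qed
    let ?F = "L0 r a ut D2u"
    let ?q = "\<lambda>z. ennreal (psi (snd z) powr \<alpha>) *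
            (ennreal (indicator {z. ?F z < 0} z * \<bar>?F z\<bar> ^ (CARD('n) + 1)) / ennreal (r z * det (a z)))"
    define k where "k = fact CARD('n) * (c0 * \<delta>) powr (- \<alpha>)"
    have k: "0 < k" using c0 \<delta> by (simp add: k_def)
    obtain f where f: "\<And>X. continuous_on X f" "\<And>z. z \<in> closure (cylinder T) \<Longrightarrow> f z = u z"
      using continuous_extension_cylinder[OF \<open>0 < T\<close> u] by blast
    have "bounded (interior (cylinder T :: (real \<times> (real^'n)) set))"
      unfolding interior_cylinder by (intro bounded_Times) auto
    then obtain b where b: "interior (cylinder T :: (real \<times> (real^'n)) set) \<subseteq> cbox (- b) b"
      using bounded_subset_cbox_symmetric by blast
    have fu: "f y = u y" if "y \<in> interior (cylinder T)" for y
      using f(2) that interior_subset closure_subset by blast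
    have "AE z in lebesgue. z \<in> Q \<longrightarrow> h None z = ut z"
      by (rule weak_deriv_unique[OF f(1) open_interior b fu _ ut Qc Q\<Omega>]) (use h[of None] in auto)
    moreover have "AE z in lebesgue. \<forall>i. \<forall>j. z \<in> Q \<longrightarrow> h (Some (i, j)) z = D2u i j z"
    proof (intro AE_all_countable[THEN iffD2] allI)
      fix i j
      show "AE z in lebesgue. z \<in> Q \<longrightarrow> h (Some (i, j)) z = D2u i j z"
        by (rule weak_deriv_unique[OF f(1) open_interior b fu _ D2u Qc Q\<Omega>]) (use h[of "Some (i, j)"] in auto)
    qed
    ultimately have ae: "AE z in lebesgue. ennreal \<bar>h None z * det (hessian h z)\<bar> *
        indicator ({z \<in> {t0..T1} \<times> cball 0 R. c0 * \<delta> \<le> psi (snd z)} \<inter> contact_set h) z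
      \<le> ennreal k * (?q z * indicator (cylinder T) z)"
    proof eventually_elim
      case (elim z)
      show ?case
      proof (cases "z \<in> {z \<in> {t0..T1} \<times> cball 0 R. c0 * \<delta> \<le> psi (snd z)} \<inter> contact_set h")
        case True
        then have zQ: "z \<in> Q" and \<psi>: "c0 * \<delta> \<le> psi (snd z)" and con: "z \<in> contact_set h"
          using t0 by (auto simp: Q_def)
        have zc: "z \<in> cylinder T" using zQ Qcyl by blast
        let ?e = "ennreal (indicator {z. ?F z < 0} z * \<bar>?F z\<bar> ^ (CARD('n) + 1)) / ennreal (r z * det (a z))"
        have eq: "h None z = ut z" "\<And>i j. h (Some (i, j)) z = D2u i j z" using elim zQ by auto
        have "?F z = r z * h None z + (\<Sum>i\<in>UNIV. \<Sum>j\<in>UNIV. a z $ i $ j * hessian h z $ i $ j)"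
          by (simp add: L0_def hessian_def eq)
        note F = this
        have con': "h None z \<le> 0" "nonneg_definite (- hessian h z)" "transpose (hessian h z) = hessian h z"
          using con by (simp_all add: contact_set_def)
        have "indicator {z. ?F z < 0} z = (indicator {z'. ?F z < 0} z :: real)"
          by (simp add: indicator_def)
        then have 1: "ennreal \<bar>h None z * det (hessian h z)\<bar> \<le> ennreal (fact CARD('n)) * ?e"
          using abs_det_le_quotient[OF conjunct2[OF a[OF zc]] conjunct1[OF a[OF zc]] r(1)[OF zc] r(2)[OF zc] con'(2,3,1) F, of z]
          by simp
        \<comment> \<open>Since \<open>\<alpha> \<ge> 0\<close>, the weight at a contact point is at least its value where \<open>psi = c0 * \<delta>\<close>.\<close>
        have "(c0 * \<delta>) powr \<alpha> \<le> psi (snd z) powr \<alpha>"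
          using \<psi> c0 \<delta> \<alpha> by (intro powr_mono2) auto
        then have "1 \<le> (c0 * \<delta>) powr (- \<alpha>) * psi (snd z) powr \<alpha>"
          using c0 \<delta> by (simp add: powr_minus field_simps)
        then have "1 * ?e \<le> ennreal ((c0 * \<delta>) powr (- \<alpha>) * psi (snd z) powr \<alpha>) * ?e"
          by (intro mult_right_mono) (auto simp flip: ennreal_1 intro: ennreal_leI)
        then have "ennreal (fact CARD('n)) * ?e
          \<le> ennreal (fact CARD('n)) * (ennreal ((c0 * \<delta>) powr (- \<alpha>) * psi (snd z) powr \<alpha>) * ?e)"
          by (intro mult_left_mono) auto
        also have "\<dots> = ennreal k * ?q z"
          by (simp add: k_def ennreal_mult mult.assoc)
        finally show ?thesis using 1 True zc by simp
      qed simp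
    qed
    have "ennreal (ball_constant CARD('n) * (M / sqrt \<delta>) ^ (CARD('n) + 1))
      \<le> (\<integral>\<^sup>+ z. ennreal k * (?q z * indicator (cylinder T) z) \<partial>lebesgue)"
      using lower nn_integral_mono_AE[OF ae] by (rule order_trans)
    also have "\<dots> \<le> ennreal k * (\<integral>\<^sup>+ z. ?q z * indicator (cylinder T) z \<partial>lebesgue)"
      by (rule nn_integral_cmult_le[OF k])
    also have "(\<integral>\<^sup>+ z. ?q z * indicator (cylinder T) z \<partial>lebesgue) = weighted_integral \<alpha> T r a ?F"
    proof -
      have "cylinder T \<in> sets (borel :: (real \<times> (real^'n)) measure)"
        unfolding cylinder_def by (intro borel_Times) auto
      then show ?thesis
        unfolding weighted_integral_def by (subst nn_integral_restrict_space) auto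
    qed
    also have "ennreal k * weighted_integral \<alpha> T r a ?F = ennreal (k * I)"
      using k I by (simp add: ennreal_mult)
    finally have main: "ball_constant CARD('n) * (M / sqrt \<delta>) ^ (CARD('n) + 1) \<le> k * I"
      using k I by (subst (asm) ennreal_le_iff) auto
    have "(M / sqrt \<delta>) ^ (CARD('n) + 1) = K ^ (CARD('n) + 1) * \<delta> powr (- \<alpha>)"
    proof -
      have "M / sqrt \<delta> = K * \<delta> powr (\<beta> - 1 / 2)"
        using \<delta> by (simp add: M_def powr_diff powr_half_sqrt)
      moreover have "(\<delta> powr (\<beta> - 1 / 2)) ^ (CARD('n) + 1) = \<delta> powr ((\<beta> - 1 / 2) * ?d)"
      proof -
        have "(\<delta> powr (\<beta> - 1 / 2)) ^ (CARD('n) + 1) = (\<delta> powr (\<beta> - 1 / 2)) powr real (CARD('n) + 1)"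
          by (rule powr_realpow[symmetric]) (use \<delta> in simp)
        then show ?thesis by (simp only: powr_powr of_nat_add of_nat_1)
      qed
      moreover have "(\<beta> - 1 / 2) * ?d = - \<alpha>" unfolding \<beta> by (simp add: field_simps)
      ultimately show ?thesis by (simp only: power_mult_distrib)
    qed
    with main have "ball_constant CARD('n) * K ^ (CARD('n) + 1) * \<delta> powr (- \<alpha>)
        \<le> fact CARD('n) * c0 powr (- \<alpha>) * I * \<delta> powr (- \<alpha>)"
      using c0 \<delta> by (simp only: k_def powr_mult mult_ac)
    then have "ball_constant CARD('n) * K ^ (CARD('n) + 1) \<le> fact CARD('n) * c0 powr (- \<alpha>) * I"
      using \<delta> by (rule_tac mult_right_le_imp_le) auto
    then have KB: "K ^ (CARD('n) + 1) \<le> (fact CARD('n) * c0 powr (- \<alpha>) / ball_constant CARD('n)) * I"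
      using ball_constant_pos[of "CARD('n)"] by (simp add: field_simps)
    have "K = (K ^ (CARD('n) + 1)) powr (1 / ?d)"
    proof -
      have "K ^ (CARD('n) + 1) = K powr ?d" using K powr_realpow[of K "CARD('n) + 1"] by (simp add: add.commute)
      then show ?thesis using K by (simp only: powr_powr) simp
    qed
    also have "\<dots> \<le> ((fact CARD('n) * c0 powr (- \<alpha>) / ball_constant CARD('n)) * I) powr (1 / ?d)"
      using KB K by (intro powr_mono2) auto
    also have "\<dots> = ?N * I powr (1 / ?d)"
    proof -
      define B where "B = fact CARD('n) * c0 powr (- \<alpha>) / ball_constant CARD('n)"
      have "0 \<le> B" using ball_constant_pos[of "CARD('n)"] by (simp add: B_def)
      then have "(B * I) powr (1 / ?d) = B powr (1 / ?d) * I powr (1 / ?d)" using I by (simp add: powr_mult)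
      then show ?thesis by (simp only: B_def estimate_constant_def c0_def)
    qed
    finally show ?thesis .
  qed
  have zQ: "(t, x) \<in> Q" using tx by (simp add: Q_def)
  have "K * psi x powr \<beta> \<le> (?N * I powr (1 / ?d)) * psi x powr \<beta>"
    using KI by (intro mult_right_mono) auto
  then show ?thesis using uK[OF zQ] by (simp add: mult_ac)
qed

lemma parabolic_boundary_top: "0 < T \<Longrightarrow> norm x \<le> 1 \<Longrightarrow> (T, x) \<in> parabolic_boundary T"
  by (simp add: parabolic_boundary_def frontier_def closure_cylinder interior_cylinder)

lemma parabolic_boundary_side: "0 < t \<Longrightarrow> t \<le> T \<Longrightarrow> norm x = 1 \<Longrightarrow> (t, x) \<in> parabolic_boundary T"
  by (simp add: parabolic_boundary_def frontier_def closure_cylinder interior_cylinder)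

theorem theorem5p8:
  fixes \<alpha> \<beta> :: real
  assumes "CARD('n::finite) \<ge> 2"
    and "0 \<le> \<alpha>" and "\<alpha> < (real CARD('n) + 1) / 2"
    and "\<beta> = 1 / 2 - \<alpha> / (real CARD('n) + 1)"
  shows "\<exists>N::real. N > 0 \<and>
    (\<forall>(T::real) (r :: real \<times> (real^'n) \<Rightarrow> real) (a :: real \<times> (real^'n) \<Rightarrow> real^'n^'n)
       (u :: real \<times> (real^'n) \<Rightarrow> real) (ut :: real \<times> (real^'n) \<Rightarrow> real)
       (D2u :: 'n \<Rightarrow> 'n \<Rightarrow> real \<times> (real^'n) \<Rightarrow> real).
       0 < T \<longrightarrow>
       a \<in> borel_measurable (lebesgue_on (cylinder T)) \<longrightarrow>
       (\<forall>z\<in>cylinder T. transpose (a z) = a z \<and> nonneg_definite (a z)) \<longrightarrow>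
       r \<in> borel_measurable (lebesgue_on (cylinder T)) \<longrightarrow>
       (\<forall>z\<in>cylinder T. 0 \<le> r z) \<longrightarrow>
       (\<forall>z\<in>cylinder T. 0 < r z + trace (a z)) \<longrightarrow>
       u \<in> W12_loc (real CARD('n) + 1) T \<longrightarrow>
       continuous_on (closure (cylinder T)) u \<longrightarrow>
       has_weak_deriv (interior (cylinder T)) [dir_t] u ut \<longrightarrow>
       (\<forall>i j. has_weak_deriv (interior (cylinder T)) [dir_x i, dir_x j] u (D2u i j)) \<longrightarrow>
       (\<forall>x0\<in>ball 0 1.
          ereal (u (0, x0)) \<le>
            ereal (SUP z\<in>parabolic_boundary T. u z) +
            enn2ereal (ennreal (N * psi x0 powr \<beta>) *
              ennreal_powr (weighted_integral \<alpha> T r a (L0 r a ut D2u))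
                (1 / (real CARD('n) + 1)))))"
proof (intro exI[of _ "estimate_constant CARD('n) \<alpha> \<beta>"] conjI allI impI ballI estimate_constant_pos)
  fix T :: real and r u ut :: "real \<times> (real^'n) \<Rightarrow> real" and a :: "real \<times> (real^'n) \<Rightarrow> real^'n^'n"
    and D2u :: "'n \<Rightarrow> 'n \<Rightarrow> real \<times> (real^'n) \<Rightarrow> real" and x0 :: "real^'n"
  assume T: "0 < T"
    and a: "\<forall>z\<in>cylinder T. transpose (a z) = a z \<and> nonneg_definite (a z)"
    and r: "\<forall>z\<in>cylinder T. 0 \<le> r z" "\<forall>z\<in>cylinder T. 0 < r z + trace (a z)"
    and W: "u \<in> W12_loc (real CARD('n) + 1) T"
    and u: "continuous_on (closure (cylinder T)) u"
    and ut: "has_weak_deriv (interior (cylinder T)) [dir_t] u ut"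
    and D2u: "\<forall>i j. has_weak_deriv (interior (cylinder T)) [dir_x i, dir_x j] u (D2u i j)"
    and x0: "x0 \<in> ball 0 1"
  let ?d = "real CARD('n) + 1"
  let ?N = "estimate_constant CARD('n) \<alpha> \<beta>"
  let ?W = "weighted_integral \<alpha> T r a (L0 r a ut D2u)"
  let ?S = "SUP z\<in>parabolic_boundary T. u z"
  have Np: "0 < ?N * psi x0 powr \<beta>" using estimate_constant_pos[of "CARD('n)" \<alpha> \<beta>] psi_pos[OF x0] by simp
  show "ereal (u (0, x0)) \<le> ereal ?S + enn2ereal (ennreal (?N * psi x0 powr \<beta>) * ennreal_powr ?W (1 / ?d))"
  proof (cases ?W)
    case top
    have "ennreal (?N * psi x0 powr \<beta>) \<noteq> 0" using Np by (simp only: ennreal_eq_0_iff not_le)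
    then have "ennreal (?N * psi x0 powr \<beta>) * \<infinity> = \<infinity>" by (simp add: ennreal_mult_top)
    then show ?thesis using top by (simp add: ennreal_powr_def)
  next
    case (real I)
    have "u (0, x0) \<le> ?S + ?N * psi x0 powr \<beta> * I powr (1 / ?d)"
    proof (rule field_le_epsilon)
      fix e :: real assume e: "0 < e"
      let ?CL = "closure (cylinder T :: (real \<times> (real^'n)) set)"
      have CLc: "compact ?CL" unfolding closure_cylinder[OF T] by (intro compact_Times compact_Icc compact_cball)
      have "uniformly_continuous_on ?CL u" by (rule compact_uniformly_continuous[OF u CLc])
      then obtain d where d: "0 < d" "\<And>y z. y \<in> ?CL \<Longrightarrow> z \<in> ?CL \<Longrightarrow> dist y z < d \<Longrightarrow> dist (u y) (u z) < e / 2"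
        unfolding uniformly_continuous_on_def
        by (elim allE[of _ "e / 2"]) (use e in \<open>auto simp: dist_commute\<close>)
      have "bdd_above (u ` ?CL)"
        using compact_continuous_image[OF u CLc] by (intro bounded_imp_bdd_above compact_imp_bounded)
      moreover have "parabolic_boundary T \<subseteq> ?CL" by (auto simp: parabolic_boundary_def frontier_def)
      ultimately have bdd: "bdd_above (u ` parabolic_boundary T)" by (meson bdd_above_mono image_mono)
      have uS: "u z \<le> ?S" if "z \<in> parabolic_boundary T" for z
        by (rule cSUP_upper[OF that bdd])
      define m where "m = min (d / 2) (T / 4)"
      have m: "0 < m" "m < d" "m < T - m" using d T by (auto simp: m_def)
      define R where "R = max (norm x0) (1 - min (d / 2) (1 / 2))"
      have R: "0 < R" "R < 1" "norm x0 \<le> R" "1 - R < d" using x0 d by (auto simp: R_def)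
      have CLI: "(t, x) \<in> ?CL" if "0 \<le> t" "t \<le> T" "norm x \<le> 1" for t x
        using that by (simp add: closure_cylinder[OF T])
      obtain ut0 where ut0: "ut0 \<in> Lp_loc_cylinder ?d T" "has_weak_deriv (interior (cylinder T)) [dir_t] u ut0"
        using W by (auto simp: W12_loc_def)
      have "\<forall>i j. \<exists>uij\<in>Lp_loc_cylinder ?d T. has_weak_deriv (interior (cylinder T)) [dir_x i, dir_x j] u uij"
        using W by (simp add: W12_loc_def)
      then obtain D0 where D0: "\<And>i j. D0 i j \<in> Lp_loc_cylinder ?d T"
        "\<And>i j. has_weak_deriv (interior (cylinder T)) [dir_x i, dir_x j] u (D0 i j)"
        by metis
      define h where "h k = (case k of None \<Rightarrow> ut0 | Some (i, j) \<Rightarrow> D0 i j)" for k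
      have hw: "has_weak_deriv (interior (cylinder T)) (dirs k) u (h k)" for k
        using ut0 D0 by (cases k rule: dirs.cases) (auto simp: h_def)
      have hL: "h k \<in> Lp_loc_cylinder ?d T" for k
        using ut0 D0 by (cases k rule: dirs.cases) (auto simp: h_def)
      have "u (m, x0) \<le> (?S + e / 2) + ?N * psi x0 powr \<beta> * I powr (1 / ?d)"
      proof (rule interior_weighted_estimate[OF assms(2-4) m(1) less_imp_le[OF m(3)] _ R(2) _ _ _ u hw hL ut])
        show "T - m < T" using m by simp
        show "transpose (a z) = a z \<and> nonneg_definite (a z)" "0 \<le> r z" "0 < r z + trace (a z)"
          if "z \<in> cylinder T" for z using that a r by auto
        show "has_weak_deriv (interior (cylinder T)) [dir_x i, dir_x j] u (D2u i j)" for i j using D2u by blast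
        show "u (T - m, x) \<le> ?S + e / 2" if "x \<in> cball 0 R" for x
        proof -
          have "dist (u (T - m, x)) (u (T, x)) < e / 2"
            using that R m T by (intro d(2) CLI) (auto simp: dist_Pair_Pair dist_real_def)
          moreover have "u (T, x) \<le> ?S"
            using that R by (intro uS parabolic_boundary_top T) auto
          ultimately show ?thesis unfolding dist_real_def abs_less_iff by linarith
        qed
        show "u (t, x) \<le> ?S + e / 2" if t: "t \<in> {m..T - m}" and x: "norm x = R" for t x
        proof -
          define y where "y = (1 / R) *\<^sub>R x"
          have y: "norm y = 1" using x R by (simp add: y_def)
          have "x = R *\<^sub>R y" using R by (simp add: y_def)
          then have "x - y = (R - 1) *\<^sub>R y" by (simp add: scaleR_left_diff_distrib)
          then have "dist x y = 1 - R" using y R by (simp add: dist_norm)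
          then have "dist (u (t, x)) (u (t, y)) < e / 2"
            using t x y R m by (intro d(2) CLI) (auto simp: dist_Pair_Pair)
          moreover have "u (t, y) \<le> ?S"
            using t m y by (intro uS parabolic_boundary_side) auto
          ultimately show ?thesis unfolding dist_real_def abs_less_iff by linarith
        qed
        show "?W = ennreal I" "0 \<le> I" using real by auto
      qed (use m R in auto)
      moreover have "dist (u (m, x0)) (u (0, x0)) < e / 2"
        using x0 m T by (intro d(2) CLI) (auto simp: dist_Pair_Pair dist_real_def)
      ultimately show "u (0, x0) \<le> ?S + ?N * psi x0 powr \<beta> * I powr (1 / ?d) + e"
        unfolding dist_real_def abs_less_iff by linarith
    qed
    moreover have "enn2ereal (ennreal (?N * psi x0 powr \<beta>) * ennreal_powr ?W (1 / ?d))
      = ereal (?N * psi x0 powr \<beta> * I powr (1 / ?d))"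
    proof -
      have "ennreal (?N * psi x0 powr \<beta>) * ennreal_powr ?W (1 / ?d) = ennreal (?N * psi x0 powr \<beta> * I powr (1 / ?d))"
        using real Np by (simp add: ennreal_powr_def ennreal_mult)
      then show ?thesis using Np by (simp add: enn2ereal_ennreal)
    qed
    ultimately show ?thesis by simp
  qed
qed

end
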